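(* Let $Q$ be an acyclic affine quiver and $\mathbf{F}_q$ a finite field. Let $P$ be a preprojective representation and $I$ a preinjective representation of $Q$ over $\mathbf{F}_q$. Then for any partition $\lambda$ and any closed points $x,y\in|\mathbf{P}^1_{\mathbf{F}_q}|\setminus D$, $$F^{P,I}_{I_\lambda(x)}=F^{P,I}_{I_\lambda(y)}.$$
   Context: For finite-dimensional representations $M,N,R$ of $Q$ over $\mathbf{F}_q$, let $a_M=|\mathrm{Aut}(M)|$, let $F^R_{M,N}$ be the number of subrepresentations $X\subset R$ with $X\simeq N$ and $R/X\simeq M$, and let $F_R^{M,N}=F^R_{M,N}\,\frac{a_Ma_N}{a_R}$. The Euler form of $Q=(I_0,\Omega)$ ($I_0$ the vertex set, $\Omega$ the arrow set) is $\langle \mathbf d,\mathbf d'\rangle=\sum_{i\in I_0} d_id'_i-\sum_{\alpha:i\to j}d_id'_j$. An affine quiver is a quiver whose underlying graph is an extended Dynkin diagram; it is acyclic if it has no oriented cycles. $\delta$ is the indivisible positive generator of the kernel of the symmetrized Euler form. An indecomposable representation $M$ is preprojective, regular or preinjective according to whether $\langle\delta,\dim M\rangle$ is $<0$, $=0$ or $>0$; a general representation is preprojective (resp. regular, preinjective) if all its indecomposable direct summands are. Regular representations form an abelian category which is a direct sum of blocks called tubes, indexed by the set $|\mathbf{P}^1_{\mathbf{F}_q}|$ of closed points of $\mathbf{P}^1_{\mathbf{F}_q}$ (a degree-compatible bijection provided by Ringel's theorem is fixed). There is a finite set $D\subset|\mathbf{P}^1_{\mathbf{F}_q}|$ of points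 of degree one indexing the non-homogeneous tubes (those with more than one simple object up to isomorphism). For $x\notin D$ the tube is homogeneous: it has a unique simple object, of dimension $\deg(x)\delta$, and for each $m\geq1$ a unique indecomposable object $I_m(x)$ of regular length $m$; for a partition $\lambda=(\lambda_1,\dots,\lambda_l)$ put $I_\lambda(x)=\bigoplus_iI_{\lambda_i}(x)$. *)

theory Defs
  imports
    "Jordan_Normal_Form.VS_Connect"
    "Graph_Theory.Graph_Theory"
    "HOL-Algebra.AbelCoset"
    "HOL-Library.Infinite_Typeclass"
begin

hide_const (open) Multiset.mult Modules.module_hom

section \<open>Acyclic affine quivers\<close>

text \<open>A quiver is a finite directed multigraph \<open>Q\<close> with vertex set \<open>verts Q\<close> and arrow set
  \<open>arcs Q\<close>; the arrow \<open>a\<close> goes from \<open>tail Q a\<close> to \<open>head Q a\<close>.\<close>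

definition acyclic_quiver :: "('i, 'a) pre_digraph \<Rightarrow> bool" where
  "acyclic_quiver Q \<longleftrightarrow> fin_digraph Q \<and> \<not> (\<exists>p. pre_digraph.cycle Q p)"

text \<open>The extended Dynkin diagram with index \<open>n\<close> has \<open>n + 1\<close> vertices \<open>0, \<dots>, n\<close>.  It is given by
  its list of edges, so that the double edge of type A with index \<open>1\<close> occurs as two entries.
  In type D the path \<open>2, 3, \<dots>, n - 2\<close> has the leaves \<open>0, 1\<close> attached to \<open>2\<close> and the leaves
  \<open>n - 1, n\<close> attached to \<open>n - 2\<close>; in the exceptional types \<open>0\<close> is the branching vertex.\<close>

datatype ext_dynkin = Atilde nat | Dtilde nat | E6tilde | E7tilde | E8tilde

fun ext_dynkin_valid :: "ext_dynkin \<Rightarrow> bool" where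
  "ext_dynkin_valid (Atilde n) \<longleftrightarrow> n \<ge> 1"
| "ext_dynkin_valid (Dtilde n) \<longleftrightarrow> n \<ge> 4"
| "ext_dynkin_valid E6tilde \<longleftrightarrow> True"
| "ext_dynkin_valid E7tilde \<longleftrightarrow> True"
| "ext_dynkin_valid E8tilde \<longleftrightarrow> True"

fun ext_dynkin_index :: "ext_dynkin \<Rightarrow> nat" where
  "ext_dynkin_index (Atilde n) = n"
| "ext_dynkin_index (Dtilde n) = n"
| "ext_dynkin_index E6tilde = 6"
| "ext_dynkin_index E7tilde = 7"
| "ext_dynkin_index E8tilde = 8"

fun ext_dynkin_edges :: "ext_dynkin \<Rightarrow> (nat \<times> nat) list" where
  "ext_dynkin_edges (Atilde n) = map (\<lambda>k. (k, Suc k)) [0..<n] @ [(n, 0)]"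
| "ext_dynkin_edges (Dtilde n) =
     [(0, 2), (1, 2)] @ map (\<lambda>k. (k, Suc k)) [2..<n - 2] @ [(n - 2, n - 1), (n - 2, n)]"
| "ext_dynkin_edges E6tilde = [(0, 1), (1, 2), (0, 3), (3, 4), (0, 5), (5, 6)]"
| "ext_dynkin_edges E7tilde = [(0, 1), (0, 2), (2, 3), (3, 4), (0, 5), (5, 6), (6, 7)]"
| "ext_dynkin_edges E8tilde = [(0, 1), (0, 2), (2, 3), (0, 4), (4, 5), (5, 6), (6, 7), (7, 8)]"

definition affine_quiver :: "('i, 'a) pre_digraph \<Rightarrow> bool" where
  "affine_quiver Q \<longleftrightarrow> fin_digraph Q \<and>
     (\<exists>T. ext_dynkin_valid T \<and>
       (\<exists>f g. bij_betw f (verts Q) {..ext_dynkin_index T} \<and>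
              bij_betw g (arcs Q) {..<length (ext_dynkin_edges T)} \<and>
              (\<forall>a\<in>arcs Q. {f (tail Q a), f (head Q a)} =
                 {fst (ext_dynkin_edges T ! g a), snd (ext_dynkin_edges T ! g a)})))"

definition euler_form :: "('i, 'a) pre_digraph \<Rightarrow> ('i \<Rightarrow> int) \<Rightarrow> ('i \<Rightarrow> int) \<Rightarrow> int" where
  "euler_form Q d d' =
     (\<Sum>i\<in>verts Q. d i * d' i) - (\<Sum>a\<in>arcs Q. d (tail Q a) * d' (head Q a))"

definition sym_euler_kernel :: "('i, 'a) pre_digraph \<Rightarrow> ('i \<Rightarrow> int) set" where
  "sym_euler_kernel Q = {d. \<forall>d'. euler_form Q d d' + euler_form Q d' d = 0}"

text \<open>Dimension vectors only matter on \<open>verts Q\<close>, hence the equality restricted to vertices.\<close>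

definition is_delta :: "('i, 'a) pre_digraph \<Rightarrow> ('i \<Rightarrow> int) \<Rightarrow> bool" where
  "is_delta Q \<delta> \<longleftrightarrow> \<delta> \<in> sym_euler_kernel Q \<and> (\<forall>i\<in>verts Q. \<delta> i > 0) \<and> Gcd (\<delta> ` verts Q) = 1 \<and>
     (\<forall>d\<in>sym_euler_kernel Q. \<exists>k. \<forall>i\<in>verts Q. d i = k * \<delta> i)"

section \<open>Representations\<close>

text \<open>The ground field is the finite type \<open>'k\<close>, and \<open>class_ring\<close> is this field seen as a
  HOL-Algebra structure.  Each vertex carries a vector space whose vectors are taken from \<open>'v\<close>.
  Values of the record outside \<open>verts Q\<close>, \<open>arcs Q\<close> and the carriers are irrelevant.\<close>

record ('i, 'a, 'k, 'v) quiver_rep =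
  rspace :: "'i \<Rightarrow> ('k, 'v) module"
  rmap :: "'a \<Rightarrow> 'v \<Rightarrow> 'v"

definition is_rep :: "('i, 'a) pre_digraph \<Rightarrow> ('i, 'a, 'k::field, 'v) quiver_rep \<Rightarrow> bool" where
  "is_rep Q M \<longleftrightarrow>
     (\<forall>i\<in>verts Q. vectorspace class_ring (rspace M i) \<and>
                  vectorspace.fin_dim class_ring (rspace M i)) \<and>
     (\<forall>a\<in>arcs Q. rmap M a \<in> module_hom class_ring (rspace M (tail Q a)) (rspace M (head Q a)))"

definition dimv :: "('i, 'a, 'k::field, 'v) quiver_rep \<Rightarrow> 'i \<Rightarrow> int" where
  "dimv M i = int (vectorspace.dim class_ring (rspace M i))"

definition zero_rep :: "('i, 'a) pre_digraph \<Rightarrow> ('i, 'a, 'k::field, 'v) quiver_rep \<Rightarrow> bool" where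
  "zero_rep Q M \<longleftrightarrow> (\<forall>i\<in>verts Q. carrier (rspace M i) = {\<zero>\<^bsub>rspace M i\<^esub>})"

text \<open>Morphisms are extensional families of linear maps, so that distinct elements of
  \<open>rep_hom Q M N\<close> are distinct morphisms and automorphisms can be counted.\<close>

definition rep_hom :: "('i, 'a) pre_digraph \<Rightarrow> ('i, 'a, 'k::field, 'v) quiver_rep \<Rightarrow>
    ('i, 'a, 'k, 'w) quiver_rep \<Rightarrow> ('i \<Rightarrow> 'v \<Rightarrow> 'w) set" where
  "rep_hom Q M N =
     {f \<in> (\<Pi>\<^sub>E i\<in>verts Q. module_hom class_ring (rspace M i) (rspace N i) \<inter>
                          extensional (carrier (rspace M i))).
        \<forall>a\<in>arcs Q. \<forall>v\<in>carrier (rspace M (tail Q a)).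
          f (head Q a) (rmap M a v) = rmap N a (f (tail Q a) v)}"

definition rep_isos :: "('i, 'a) pre_digraph \<Rightarrow> ('i, 'a, 'k::field, 'v) quiver_rep \<Rightarrow>
    ('i, 'a, 'k, 'w) quiver_rep \<Rightarrow> ('i \<Rightarrow> 'v \<Rightarrow> 'w) set" where
  "rep_isos Q M N =
     {f \<in> rep_hom Q M N. \<forall>i\<in>verts Q. bij_betw (f i) (carrier (rspace M i)) (carrier (rspace N i))}"

definition rep_iso :: "('i, 'a) pre_digraph \<Rightarrow> ('i, 'a, 'k::field, 'v) quiver_rep \<Rightarrow>
    ('i, 'a, 'k, 'w) quiver_rep \<Rightarrow> bool" where
  "rep_iso Q M N \<longleftrightarrow> rep_isos Q M N \<noteq> {}"

definition nonzero_hom :: "('i, 'a) pre_digraph \<Rightarrow> ('i, 'a, 'k::field, 'v) quiver_rep \<Rightarrow>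
    ('i, 'a, 'k, 'w) quiver_rep \<Rightarrow> bool" where
  "nonzero_hom Q M N \<longleftrightarrow>
     (\<exists>f\<in>rep_hom Q M N. \<exists>i\<in>verts Q. \<exists>v\<in>carrier (rspace M i). f i v \<noteq> \<zero>\<^bsub>rspace N i\<^esub>)"

text \<open>A subrepresentation is the extensional family of its underlying subspaces.\<close>

definition is_subrep :: "('i, 'a) pre_digraph \<Rightarrow> ('i, 'a, 'k::field, 'v) quiver_rep \<Rightarrow>
    ('i \<Rightarrow> 'v set) \<Rightarrow> bool" where
  "is_subrep Q M X \<longleftrightarrow> X \<in> extensional (verts Q) \<and>
     (\<forall>i\<in>verts Q. VectorSpace.subspace class_ring (X i) (rspace M i)) \<and>
     (\<forall>a\<in>arcs Q. rmap M a ` X (tail Q a) \<subseteq> X (head Q a))"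

definition zero_sub :: "('i, 'a) pre_digraph \<Rightarrow> ('i, 'a, 'k, 'v) quiver_rep \<Rightarrow> 'i \<Rightarrow> 'v set" where
  "zero_sub Q M = (\<lambda>i\<in>verts Q. {\<zero>\<^bsub>rspace M i\<^esub>})"

definition full_sub :: "('i, 'a) pre_digraph \<Rightarrow> ('i, 'a, 'k, 'v) quiver_rep \<Rightarrow> 'i \<Rightarrow> 'v set" where
  "full_sub Q M = (\<lambda>i\<in>verts Q. carrier (rspace M i))"

definition sub_rep :: "('i, 'a, 'k, 'v) quiver_rep \<Rightarrow> ('i \<Rightarrow> 'v set) \<Rightarrow>
    ('i, 'a, 'k, 'v) quiver_rep" where
  "sub_rep M X = M\<lparr>rspace := \<lambda>i. (rspace M i)\<lparr>carrier := X i\<rparr>\<rparr>"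

text \<open>The quotient space consists of cosets.  The unions below are over the representatives of a
  coset, which all give the same coset.  The fields \<open>mult\<close> and \<open>one\<close> of a module record have no
  meaning.\<close>

definition quot_space :: "('k, 'v) module \<Rightarrow> 'v set \<Rightarrow> ('k, 'v set) module" where
  "quot_space V W = \<lparr>carrier = a_rcosets\<^bsub>V\<^esub> W, mult = (\<lambda>A B. W), one = W, zero = W,
     add = (\<lambda>A B. A <+>\<^bsub>V\<^esub> B), smult = (\<lambda>c A. \<Union>v\<in>A. W +>\<^bsub>V\<^esub> (c \<odot>\<^bsub>V\<^esub> v))\<rparr>"

definition quot_rep :: "('i, 'a) pre_digraph \<Rightarrow> ('i, 'a, 'k, 'v) quiver_rep \<Rightarrow> ('i \<Rightarrow> 'v set) \<Rightarrow>
    ('i, 'a, 'k, 'v set) quiver_rep" where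
  "quot_rep Q M X = \<lparr>rspace = (\<lambda>i. quot_space (rspace M i) (X i)),
     rmap = (\<lambda>a A. \<Union>v\<in>A. X (head Q a) +>\<^bsub>rspace M (head Q a)\<^esub> rmap M a v)\<rparr>"

text \<open>The external direct sum \<open>Ms ! 0 \<oplus> \<dots> \<oplus> Ms ! (l - 1)\<close>, whose vectors are tuples indexed by
  \<open>{..<l}\<close>; for the empty list this is a zero representation.\<close>

definition dsum_space :: "('k, 'v) module list \<Rightarrow> ('k, nat \<Rightarrow> 'v) module" where
  "dsum_space Vs = \<lparr>carrier = (\<Pi>\<^sub>E j\<in>{..<length Vs}. carrier (Vs ! j)),
     mult = (\<lambda>u v. \<lambda>j\<in>{..<length Vs}. \<zero>\<^bsub>Vs ! j\<^esub>),
     one = (\<lambda>j\<in>{..<length Vs}. \<zero>\<^bsub>Vs ! j\<^esub>),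
     zero = (\<lambda>j\<in>{..<length Vs}. \<zero>\<^bsub>Vs ! j\<^esub>),
     add = (\<lambda>u v. \<lambda>j\<in>{..<length Vs}. u j \<oplus>\<^bsub>Vs ! j\<^esub> v j),
     smult = (\<lambda>c v. \<lambda>j\<in>{..<length Vs}. c \<odot>\<^bsub>Vs ! j\<^esub> v j)\<rparr>"

definition dsum_rep :: "('i, 'a, 'k, 'v) quiver_rep list \<Rightarrow> ('i, 'a, 'k, nat \<Rightarrow> 'v) quiver_rep" where
  "dsum_rep Ms = \<lparr>rspace = (\<lambda>i. dsum_space (map (\<lambda>M. rspace M i) Ms)),
     rmap = (\<lambda>a v. \<lambda>j\<in>{..<length Ms}. rmap (Ms ! j) a (v j))\<rparr>"

section \<open>Hall numbers\<close>

definition aut_card :: "('i, 'a) pre_digraph \<Rightarrow> ('i, 'a, 'k::field, 'v) quiver_rep \<Rightarrow> nat" where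
  "aut_card Q M = card (rep_isos Q M M)"

text \<open>\<open>hall_sub Q R M N\<close> is \<open>F\<^sup>R\<^sub>M\<^sub>,\<^sub>N\<close> (subobject \<open>N\<close>, quotient \<open>M\<close>), and \<open>hall_F Q R M N\<close> is
  \<open>F\<^sub>R\<^sup>M\<^sup>,\<^sup>N\<close>.\<close>

definition hall_sub :: "('i, 'a) pre_digraph \<Rightarrow> ('i, 'a, 'k::field, 'u) quiver_rep \<Rightarrow>
    ('i, 'a, 'k, 'v) quiver_rep \<Rightarrow> ('i, 'a, 'k, 'w) quiver_rep \<Rightarrow> nat" where
  "hall_sub Q R M N =
     card {X. is_subrep Q R X \<and> rep_iso Q (sub_rep R X) N \<and> rep_iso Q (quot_rep Q R X) M}"

definition hall_F :: "('i, 'a) pre_digraph \<Rightarrow> ('i, 'a, 'k::field, 'u) quiver_rep \<Rightarrow>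
    ('i, 'a, 'k, 'v) quiver_rep \<Rightarrow> ('i, 'a, 'k, 'w) quiver_rep \<Rightarrow> rat" where
  "hall_F Q R M N =
     of_nat (hall_sub Q R M N) * (of_nat (aut_card Q M) * of_nat (aut_card Q N) / of_nat (aut_card Q R))"

section \<open>Preprojective, regular and preinjective representations\<close>

definition complementary :: "('i, 'a) pre_digraph \<Rightarrow> ('i, 'a, 'k::field, 'v) quiver_rep \<Rightarrow>
    ('i \<Rightarrow> 'v set) \<Rightarrow> ('i \<Rightarrow> 'v set) \<Rightarrow> bool" where
  "complementary Q M X Y \<longleftrightarrow> is_subrep Q M X \<and> is_subrep Q M Y \<and>
     (\<forall>i\<in>verts Q. X i \<inter> Y i = {\<zero>\<^bsub>rspace M i\<^esub>} \<and>
                  X i <+>\<^bsub>rspace M i\<^esub> Y i = carrier (rspace M i))"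

definition indecomposable :: "('i, 'a) pre_digraph \<Rightarrow> ('i, 'a, 'k::field, 'v) quiver_rep \<Rightarrow> bool" where
  "indecomposable Q M \<longleftrightarrow> is_rep Q M \<and> \<not> zero_rep Q M \<and>
     (\<forall>X Y. complementary Q M X Y \<longrightarrow> X = zero_sub Q M \<or> Y = zero_sub Q M)"

definition indec_summands :: "('i, 'a) pre_digraph \<Rightarrow> ('i, 'a, 'k::field, 'v) quiver_rep \<Rightarrow>
    ('i, 'a, 'k, 'v) quiver_rep set" where
  "indec_summands Q M = {sub_rep M X |X. (\<exists>Y. complementary Q M X Y) \<and> indecomposable Q (sub_rep M X)}"

definition preprojective :: "('i, 'a) pre_digraph \<Rightarrow> ('i \<Rightarrow> int) \<Rightarrow>
    ('i, 'a, 'k::field, 'v) quiver_rep \<Rightarrow> bool" where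
  "preprojective Q \<delta> M \<longleftrightarrow> is_rep Q M \<and> (\<forall>S\<in>indec_summands Q M. euler_form Q \<delta> (dimv S) < 0)"

definition regular :: "('i, 'a) pre_digraph \<Rightarrow> ('i \<Rightarrow> int) \<Rightarrow>
    ('i, 'a, 'k::field, 'v) quiver_rep \<Rightarrow> bool" where
  "regular Q \<delta> M \<longleftrightarrow> is_rep Q M \<and> (\<forall>S\<in>indec_summands Q M. euler_form Q \<delta> (dimv S) = 0)"

definition preinjective :: "('i, 'a) pre_digraph \<Rightarrow> ('i \<Rightarrow> int) \<Rightarrow>
    ('i, 'a, 'k::field, 'v) quiver_rep \<Rightarrow> bool" where
  "preinjective Q \<delta> M \<longleftrightarrow> is_rep Q M \<and> (\<forall>S\<in>indec_summands Q M. euler_form Q \<delta> (dimv S) > 0)"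

section \<open>Tubes\<close>

text \<open>Simple objects and length are meant in the abelian category of regular representations:
  only regular subrepresentations count as subobjects.\<close>

definition regular_simple :: "('i, 'a) pre_digraph \<Rightarrow> ('i \<Rightarrow> int) \<Rightarrow>
    ('i, 'a, 'k::field, 'v) quiver_rep \<Rightarrow> bool" where
  "regular_simple Q \<delta> M \<longleftrightarrow> regular Q \<delta> M \<and> \<not> zero_rep Q M \<and>
     (\<forall>X. is_subrep Q M X \<and> regular Q \<delta> (sub_rep M X) \<longrightarrow> X = zero_sub Q M \<or> X = full_sub Q M)"

definition has_regular_length :: "('i, 'a) pre_digraph \<Rightarrow> ('i \<Rightarrow> int) \<Rightarrow>
    ('i, 'a, 'k::field, 'v) quiver_rep \<Rightarrow> nat \<Rightarrow> bool" where
  "has_regular_length Q \<delta> M m \<longleftrightarrow>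
     (\<exists>X. X 0 = zero_sub Q M \<and> X m = full_sub Q M \<and>
       (\<forall>k\<le>m. is_subrep Q M (X k) \<and> regular Q \<delta> (sub_rep M (X k))) \<and>
       (\<forall>k<m. (\<forall>i\<in>verts Q. X k i \<subseteq> X (Suc k) i) \<and>
              regular_simple Q \<delta> (quot_rep Q (sub_rep M (X (Suc k))) (X k))))"

definition regular_indecs :: "('i, 'a) pre_digraph \<Rightarrow> ('i \<Rightarrow> int) \<Rightarrow>
    ('i, 'a, 'k::field, 'v) quiver_rep set" where
  "regular_indecs Q \<delta> = {M. regular Q \<delta> M \<and> indecomposable Q M}"

text \<open>A tube, that is a block of the category of regular representations, is given by the set of
  its indecomposable objects; these sets are the classes of the equivalence relation generated by
  the existence of a nonzero morphism.  The class \<open>infinite\<close> makes \<open>'v\<close> large enough for every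
  finite-dimensional representation over a finite field to be isomorphic to one with vectors
  in \<open>'v\<close>.\<close>

definition linked :: "('i, 'a) pre_digraph \<Rightarrow> ('i \<Rightarrow> int) \<Rightarrow>
    ('i, 'a, 'k::field, 'v) quiver_rep rel" where
  "linked Q \<delta> = {(M, N). M \<in> regular_indecs Q \<delta> \<and> N \<in> regular_indecs Q \<delta> \<and>
                         (nonzero_hom Q M N \<or> nonzero_hom Q N M)}"

definition tubes :: "('i, 'a) pre_digraph \<Rightarrow> ('i \<Rightarrow> int) \<Rightarrow>
    ('i, 'a, 'k::{field, finite}, 'v::infinite) quiver_rep set set" where
  "tubes Q \<delta> = regular_indecs Q \<delta> // (linked Q \<delta>)\<^sup>*"

definition homogeneous :: "('i, 'a) pre_digraph \<Rightarrow> ('i \<Rightarrow> int) \<Rightarrow>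
    ('i, 'a, 'k::field, 'v) quiver_rep set \<Rightarrow> bool" where
  "homogeneous Q \<delta> T \<longleftrightarrow>
     (\<forall>S\<in>T. \<forall>S'\<in>T. regular_simple Q \<delta> S \<and> regular_simple Q \<delta> S' \<longrightarrow> rep_iso Q S S')"

text \<open>The closed points of the projective line over the field \<open>'k\<close>: the point at infinity \<open>None\<close>, and the
  maximal ideals of \<open>'k[t]\<close>, given by their monic irreducible generators.  The degree is the degree
  of the residue field over \<open>'k\<close>.\<close>

type_synonym 'k p1_point = "'k poly option"

definition closed_points :: "('k::field) p1_point set" where
  "closed_points = insert None (Some ` {p. lead_coeff p = 1 \<and> irreducible p})"

fun point_degree :: "('k::field) p1_point \<Rightarrow> nat" where
  "point_degree None = 1"
| "point_degree (Some p) = degree p"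

definition exceptional_points :: "('i, 'a) pre_digraph \<Rightarrow> ('i \<Rightarrow> int) \<Rightarrow>
    ('k::field p1_point \<Rightarrow> ('i, 'a, 'k, 'v) quiver_rep set) \<Rightarrow> 'k p1_point set" where
  "exceptional_points Q \<delta> tube = {x \<in> closed_points. \<not> homogeneous Q \<delta> (tube x)}"

text \<open>A degree-compatible bijection between closed points and tubes, as provided by Ringel's
  theorem.\<close>

definition tube_parametrization :: "('i, 'a) pre_digraph \<Rightarrow> ('i \<Rightarrow> int) \<Rightarrow>
    ('k::{field, finite} p1_point \<Rightarrow> ('i, 'a, 'k, 'v::infinite) quiver_rep set) \<Rightarrow> bool" where
  "tube_parametrization Q \<delta> tube \<longleftrightarrow> bij_betw tube closed_points (tubes Q \<delta>) \<and>
     (\<forall>x\<in>exceptional_points Q \<delta> tube. point_degree x = 1) \<and>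
     (\<forall>x\<in>closed_points - exceptional_points Q \<delta> tube. \<forall>S\<in>tube x. regular_simple Q \<delta> S \<longrightarrow>
        (\<forall>i\<in>verts Q. dimv S i = int (point_degree x) * \<delta> i))"

text \<open>\<open>Ind x m\<close> represents the isomorphism class of \<open>I\<^sub>m(x)\<close>.  Its indecomposability is part of
  \<open>Ind x m \<in> tube x\<close>.\<close>

definition homogeneous_indecs :: "('i, 'a) pre_digraph \<Rightarrow> ('i \<Rightarrow> int) \<Rightarrow>
    ('k::field p1_point \<Rightarrow> ('i, 'a, 'k, 'v) quiver_rep set) \<Rightarrow>
    ('k p1_point \<Rightarrow> nat \<Rightarrow> ('i, 'a, 'k, 'v) quiver_rep) \<Rightarrow> bool" where
  "homogeneous_indecs Q \<delta> tube Ind \<longleftrightarrow>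
     (\<forall>x\<in>closed_points - exceptional_points Q \<delta> tube. \<forall>m\<ge>1.
        Ind x m \<in> tube x \<and> has_regular_length Q \<delta> (Ind x m) m)"

definition is_partition :: "nat list \<Rightarrow> bool" where
  "is_partition lam \<longleftrightarrow> sorted_wrt (\<ge>) lam \<and> 0 \<notin> set lam"

definition I_lam :: "('k::field p1_point \<Rightarrow> nat \<Rightarrow> ('i, 'a, 'k, 'v) quiver_rep) \<Rightarrow>
    nat list \<Rightarrow> 'k p1_point \<Rightarrow> ('i, 'a, 'k, nat \<Rightarrow> 'v) quiver_rep" where
  "I_lam Ind lam x = dsum_rep (map (Ind x) lam)"

end

theory Submission
  imports Defs "HOL-Library.Function_Algebras"
begin

text \<open>If \<open>lam\<close> is empty, both middle terms are the same zero representation.  Otherwise both Hall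
  numbers vanish.  Write \<open>\<partial> d = euler_form Q \<delta> d\<close> for the defect.  The middle term \<open>R\<close> is a nonzero
  direct sum of indecomposables of defect zero, and up to a factor the Hall number counts the
  subrepresentations \<open>X\<close> of \<open>R\<close> that are isomorphic to \<open>I\<close> with \<open>R/X\<close> isomorphic to \<open>P\<close>.  There is no nonzero morphism
  from an indecomposable of positive defect to an indecomposable of defect zero
  (\<open>hom_positive_to_zero_defect\<close>), so \<open>X = 0\<close>, as \<open>I\<close> would otherwise have an indecomposable summand
  of positive defect.  Then \<open>P\<close> has the dimension vector of \<open>R\<close>, hence defect zero; since a nonzero
  preprojective representation has negative defect, \<open>P\<close> and hence \<open>R\<close> is zero, a contradiction
  (\<open>hall_sub_zero_defect\<close>).

  The vanishing of morphisms is proved with the reflections of Bernstein, Gelfand and Ponomarev, of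
  which only the effect on a pair of objects is needed.  Let \<open>S\<close> and \<open>Y\<close> be indecomposable with a
  nonzero morphism \<open>S \<rightarrow> Y\<close>, with \<open>\<partial> Y = 0\<close>, and let \<open>i\<close> be a source.  Neither is concentrated at
  \<open>i\<close>: this is clear for \<open>Y\<close>, as \<open>\<delta> i > 0\<close>, and the arrows leaving \<open>i\<close> are then jointly injective on
  \<open>Y\<close>, which excludes it for \<open>S\<close>.  Replacing the space at \<open>i\<close> by the cokernel of its embedding into
  the product of the spaces at the heads of these arrows, and reversing the arrows, gives another
  such pair with the same defects (\<open>linked_pair_reflect\<close>).  After all vertices have been reflected
  once, in an order compatible with the arrows, \<open>Q\<close> is restored and the dimension vector \<open>x\<close> of \<open>S\<close>
  has become a vector \<open>x'\<close> with \<open>\<langle>y, x\<rangle> = - \<langle>x', y\<rangle>\<close> for all \<open>y\<close> (\<open>full_round\<close>).  So there is an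
  infinite sequence of nonnegative vectors of this kind.  This is impossible if \<open>\<partial> x > 0\<close>
  (\<open>no_infinite_coxeter_orbit\<close>): the quadratic form is constant along the sequence and positive
  definite modulo \<open>\<delta>\<close>, so infinitely many members are congruent modulo \<open>\<delta>\<close>; if two members differ by
  \<open>k \<delta>\<close>, the sum \<open>e\<close> of the members between them satisfies \<open>2 \<langle>e, e\<rangle> = - k \<partial> e\<close>, which forces
  \<open>k < 0\<close>, and the entries would decrease for ever.

  Reflections change the spaces, so they are carried out in a coordinate model, in which the space at
  each vertex is a finite subspace of one fixed function space that is closed under the products
  that occur.  Dimensions are read off from cardinalities.\<close>

section \<open>Function spaces\<close>

text \<open>Scalar multiplication of functions, which makes a function space a vector space.\<close>

definition scl :: "'k::field \<Rightarrow> ('x \<Rightarrow> 'k) \<Rightarrow> 'x \<Rightarrow> 'k" where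
  "scl c w = (\<lambda>x. c * w x)"

interpretation fs: vector_space "scl :: 'k::field \<Rightarrow> ('x \<Rightarrow> 'k) \<Rightarrow> 'x \<Rightarrow> 'k"
  by unfold_locales (auto simp: scl_def fun_eq_iff algebra_simps)

interpretation fsp: vector_space_pair "scl :: 'k::field \<Rightarrow> ('x \<Rightarrow> 'k) \<Rightarrow> 'x \<Rightarrow> 'k"
    "scl :: 'k::field \<Rightarrow> ('y \<Rightarrow> 'k) \<Rightarrow> 'y \<Rightarrow> 'k"
  by unfold_locales

abbreviation fsubspace :: "('x \<Rightarrow> 'k::field) set \<Rightarrow> bool" where
  "fsubspace \<equiv> fs.subspace"

text \<open>Additivity of a map on a subgroup.\<close>

definition additive_on :: "'x::ab_group_add set \<Rightarrow> ('x \<Rightarrow> 'y::ab_group_add) \<Rightarrow> bool" where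
  "additive_on A g \<longleftrightarrow> (\<forall>x\<in>A. \<forall>y\<in>A. g (x + y) = g x + g y)"

text \<open>Linearity of a map on a subspace; nothing is required outside of it.\<close>

definition lin_on :: "('x \<Rightarrow> 'k::field) set \<Rightarrow> (('x \<Rightarrow> 'k) \<Rightarrow> 'y \<Rightarrow> 'k) \<Rightarrow> bool" where
  "lin_on A g \<longleftrightarrow> additive_on A g \<and> (\<forall>c. \<forall>x\<in>A. g (scl c x) = scl c (g x))"

lemma additive_on_zero: "additive_on A g \<Longrightarrow> 0 \<in> A \<Longrightarrow> g 0 = 0"
  unfolding additive_on_def by (metis add_cancel_right_left)

lemma lin_on_zero: "lin_on A g \<Longrightarrow> 0 \<in> A \<Longrightarrow> g 0 = 0"
  unfolding lin_on_def using additive_on_zero by blast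

lemma lin_on_subset: "lin_on B g \<Longrightarrow> A \<subseteq> B \<Longrightarrow> lin_on A g"
  unfolding lin_on_def additive_on_def by blast

lemma lin_on_UNIV_add: "lin_on UNIV g \<Longrightarrow> g (x + y) = g x + g y"
  unfolding lin_on_def additive_on_def by blast

lemma exists_projection:
  fixes K :: "('x \<Rightarrow> 'k::field) set"
  assumes "fsubspace K"
  shows "\<exists>g. range g \<subseteq> K \<and> Vector_Spaces.linear scl scl g \<and> (\<forall>v\<in>K. g v = v)"
  using fsp.linear_exists_left_inverse_on[OF fs.linear_id assms] by auto

lemma exists_complement:
  fixes K :: "('x \<Rightarrow> 'k::field) set"
  assumes K: "fsubspace K" and U: "fsubspace U" and KU: "K \<subseteq> U"
  shows "\<exists>C. fsubspace C \<and> C \<subseteq> U \<and> K \<inter> C = {0} \<and> (\<forall>u\<in>U. \<exists>k\<in>K. \<exists>c\<in>C. u = k + c)"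
proof -
  obtain g where g: "range g \<subseteq> K" "Vector_Spaces.linear scl scl g" "\<And>v. v \<in> K \<Longrightarrow> g v = v"
    using exists_projection[OF K] by blast
  interpret g: Vector_Spaces.linear scl scl g by (rule g(2))
  let ?C = "{u\<in>U. g u = 0}"
  have "fsubspace ?C"
    using U by (auto simp: fs.subspace_def g.add g.scale)
  moreover have "K \<inter> ?C = {0}"
    using g(3) fs.subspace_0[OF K] KU by auto
  moreover have "\<exists>k\<in>K. \<exists>c\<in>?C. u = k + c" if "u \<in> U" for u
  proof (rule bexI, rule bexI)
    show "u = g u + (u - g u)" by simp
    show "g u \<in> K" using g by blast
    then show "u - g u \<in> ?C" using that KU U g by (auto simp: g.diff intro: fs.subspace_diff)
  qed
  ultimately show ?thesis by (intro exI[of _ ?C]) auto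
qed

section \<open>Cokernel of a map into a product of spaces\<close>

text \<open>The coordinates are indexed by pairs of a basis label and a list of arrows, which makes room for
  products within the same type: prefixing the list with an arrow \<open>a\<close> is an embedding \<open>emb a\<close> of
  the function space into itself with left inverse \<open>slice a\<close>, and the images for different arrows
  are independent.\<close>

definition emb :: "'a \<Rightarrow> ('b \<times> 'a list \<Rightarrow> 'k::field) \<Rightarrow> 'b \<times> 'a list \<Rightarrow> 'k" where
  "emb a w = (\<lambda>(b, l). case l of [] \<Rightarrow> 0 | c # l' \<Rightarrow> if c = a then w (b, l') else 0)"

definition slice :: "'a \<Rightarrow> ('b \<times> 'a list \<Rightarrow> 'k::field) \<Rightarrow> 'b \<times> 'a list \<Rightarrow> 'k" where
  "slice a z = (\<lambda>(b, l). z (b, a # l))"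

lemma emb_add: "emb a (x + y) = emb a x + emb a y"
  by (auto simp: emb_def fun_eq_iff split: list.split)

lemma emb_scl: "emb a (scl c x) = scl c (emb a x)"
  by (auto simp: emb_def scl_def fun_eq_iff split: list.split)

lemma slice_emb: "slice a (emb c w) = (if c = a then w else 0)"
  by (auto simp: emb_def slice_def fun_eq_iff)

lemma slice_add: "slice a (x + y) = slice a x + slice a y"
  by (auto simp: slice_def fun_eq_iff)

lemma slice_sum_emb:
  assumes "finite A" "a \<in> A"
  shows "slice a (\<Sum>c\<in>A. emb c (u c)) = u a"
proof -
  have z: "slice a 0 = 0" by (auto simp: slice_def fun_eq_iff)
  have "slice a (\<Sum>c\<in>A. emb c (u c)) = (\<Sum>c\<in>A. slice a (emb c (u c)))"
    using sum_comp_morphism[of "slice a" "\<lambda>c. emb c (u c)" A] z slice_add by (metis (no_types, lifting) comp_apply sum.cong)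
  also have "\<dots> = u a" using assms by (simp add: slice_emb)
  finally show ?thesis .
qed

text \<open>The cokernel of an injective map \<open>v \<mapsto> (f a v)\<^sub>a\<close> into a finite product.  It is given by its space
  \<open>W\<close> and the components \<open>\<psi> a\<close> of the projection from the product to \<open>W\<close>.\<close>

lemma cokernel_exists:
  fixes U0 :: "('b \<times> 'a list \<Rightarrow> 'k::field) set" and U :: "'a \<Rightarrow> ('b \<times> 'a list \<Rightarrow> 'k) set"
  assumes A: "finite A"
    and U0: "fsubspace U0" "finite U0"
    and U: "\<And>a. a \<in> A \<Longrightarrow> fsubspace (U a)" "\<And>a. a \<in> A \<Longrightarrow> finite (U a)"
    and f: "\<And>a. a \<in> A \<Longrightarrow> lin_on U0 (f a)" "\<And>a. a \<in> A \<Longrightarrow> f a ` U0 \<subseteq> U a"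
    and inj: "\<And>v. v \<in> U0 \<Longrightarrow> \<forall>a\<in>A. f a v = 0 \<Longrightarrow> v = 0"
  shows "\<exists>(W :: ('b \<times> 'a list \<Rightarrow> 'k) set) \<psi>. fsubspace W \<and> finite W \<and> (\<forall>a. lin_on UNIV (\<psi> a)) \<and> (\<forall>a\<in>A. \<psi> a ` U a \<subseteq> W) \<and>
    (\<forall>w\<in>W. \<exists>u. (\<forall>a\<in>A. u a \<in> U a) \<and> w = (\<Sum>a\<in>A. \<psi> a (u a))) \<and>
    (\<forall>u. (\<forall>a\<in>A. u a \<in> U a) \<longrightarrow> ((\<Sum>a\<in>A. \<psi> a (u a)) = 0 \<longleftrightarrow> (\<exists>v\<in>U0. \<forall>a\<in>A. u a = f a v))) \<and>
    card W * card U0 = (\<Prod>a\<in>A. card (U a))"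
proof -
  \<comment> \<open>\<open>J\<close> realises the product as the subspace \<open>T\<close>, which contains the image \<open>K\<close> of \<open>U0\<close>.\<close>
  define J where "J u = (\<Sum>a\<in>A. emb a (u a))" for u :: "'a \<Rightarrow> 'b \<times> 'a list \<Rightarrow> 'k"
  define S where "S v = J (\<lambda>a. f a v)" for v
  define T where "T = J ` (\<Pi>\<^sub>E a\<in>A. U a)"
  define K where "K = S ` U0"
  have J_add: "J (\<lambda>a. u a + v a) = J u + J v" for u v
    by (simp add: J_def emb_add sum.distrib)
  have J_scl: "J (\<lambda>a. scl c (u a)) = scl c (J u)" for u c
    by (simp add: J_def emb_scl fs.scale_sum_right)
  have slJ: "slice a (J u) = u a" if "a \<in> A" for a u
    unfolding J_def using slice_sum_emb[OF A that] .
  have J_cong: "J u = J v" if "\<And>a. a \<in> A \<Longrightarrow> u a = v a" for u v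
    unfolding J_def using that by (auto intro: sum.cong)
  have J_eq: "J u = J v \<longleftrightarrow> (\<forall>a\<in>A. u a = v a)" for u v
    using slJ J_cong by metis
  have TI: "J u \<in> T" if "\<And>a. a \<in> A \<Longrightarrow> u a \<in> U a" for u
  proof -
    have "J u = J (restrict u A)" by (rule J_cong) auto
    then show ?thesis unfolding T_def using that by auto
  qed
  have TE: "\<exists>u. (\<forall>a\<in>A. u a \<in> U a) \<and> z = J u" if "z \<in> T" for z
    using that unfolding T_def by (auto simp: PiE_iff)
  have T0: "fsubspace T"
    unfolding fs.subspace_def
  proof (intro conjI ballI allI)
    show "0 \<in> T"
    proof -
      have "J (\<lambda>_. 0) = 0" using J_scl[of 0 "\<lambda>_. 0"] by simp
      then show ?thesis using TI[of "\<lambda>_. 0"] U fs.subspace_0 by fastforce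
    qed
    fix x y assume "x \<in> T" "y \<in> T"
    then obtain u v where "\<forall>a\<in>A. u a \<in> U a" "x = J u" "\<forall>a\<in>A. v a \<in> U a" "y = J v" using TE by blast
    moreover have "J (\<lambda>a. u a + v a) \<in> T" using calculation U(1) by (intro TI fs.subspace_add) auto
    ultimately show "x + y \<in> T" by (simp add: J_add)
  next
    fix c x assume "x \<in> T"
    then obtain u where "\<forall>a\<in>A. u a \<in> U a" "x = J u" using TE by blast
    moreover have "J (\<lambda>a. scl c (u a)) \<in> T" using calculation U(1) by (intro TI fs.subspace_scale) auto
    ultimately show "scl c x \<in> T" by (simp add: J_scl)
  qed
  have S_add: "S (v + w) = S v + S w" if "v \<in> U0" "w \<in> U0" for v w
    unfolding S_def J_add[symmetric]
    by (rule J_cong) (use f that in \<open>auto simp: lin_on_def additive_on_def\<close>)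
  have S_scl: "S (scl c v) = scl c (S v)" if "v \<in> U0" for v c
    unfolding S_def J_scl[symmetric]
    by (rule J_cong) (use f that in \<open>auto simp: lin_on_def additive_on_def\<close>)
  have Kz: "fsubspace K"
    unfolding fs.subspace_def
  proof (intro conjI ballI allI)
    have "S (scl 0 0) = scl 0 (S 0)" using S_scl fs.subspace_0[OF U0(1)] by blast
    then show "0 \<in> K" unfolding K_def using fs.subspace_0[OF U0(1)] by (auto intro!: image_eqI[of _ _ 0])
    fix x y assume "x \<in> K" "y \<in> K"
    then show "x + y \<in> K" unfolding K_def using S_add fs.subspace_add[OF U0(1)] by (auto simp: image_iff) metis
  next
    fix c x assume "x \<in> K"
    then show "scl c x \<in> K" unfolding K_def using S_scl fs.subspace_scale[OF U0(1)] by (auto simp: image_iff) metis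
  qed
  have KT: "K \<subseteq> T" unfolding K_def S_def using TI f by (auto simp: image_subset_iff)
  have injS: "inj_on S U0"
  proof (rule inj_onI)
    fix v w assume vw: "v \<in> U0" "w \<in> U0" "S v = S w"
    then have *: "\<forall>a\<in>A. f a v = f a w" by (auto simp: S_def J_eq)
    have "f a (v - w) = 0" if "a \<in> A" for a
    proof -
      have "f a v = f a ((v - w) + w)" by simp
      also have "\<dots> = f a (v - w) + f a w"
        using f(1)[OF that] vw fs.subspace_diff[OF U0(1)] unfolding lin_on_def additive_on_def by blast
      finally show ?thesis using * that by simp
    qed
    then have "v - w = 0" using inj vw fs.subspace_diff[OF U0(1)] by blast
    then show "v = w" by simp
  qed
  have finT: "finite T" unfolding T_def using A U(2) by (intro finite_imageI finite_PiE) auto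
  have injJ: "inj_on J (\<Pi>\<^sub>E a\<in>A. U a)"
  proof (rule inj_onI)
    fix u v assume "u \<in> (\<Pi>\<^sub>E a\<in>A. U a)" "v \<in> (\<Pi>\<^sub>E a\<in>A. U a)" "J u = J v"
    then show "u = v" unfolding J_eq by (metis PiE_ext)
  qed
  have cardT: "card T = (\<Prod>a\<in>A. card (U a))"
    unfolding T_def using injJ A by (simp add: card_image card_PiE)
  obtain g where g: "range g \<subseteq> K" "Vector_Spaces.linear scl scl g" "\<And>v. v \<in> K \<Longrightarrow> g v = v"
    using exists_projection[OF Kz] by blast
  interpret g: Vector_Spaces.linear scl scl g by (rule g(2))
  \<comment> \<open>The kernel of \<open>p\<close> is \<open>K\<close>, and \<open>p\<close> maps \<open>T\<close> to a complement \<open>W\<close> of \<open>K\<close> in \<open>T\<close>.\<close>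
  define p where "p z = z - g z" for z
  have p_add: "p (x + y) = p x + p y" for x y by (simp add: p_def g.add)
  have p_scl: "p (scl c x) = scl c (p x)" for c x by (simp add: p_def g.scale fs.scale_right_diff_distrib)
  have p0: "p z = 0 \<longleftrightarrow> z \<in> K" for z
  proof
    assume "p z = 0"
    then have "z = g z" by (simp add: p_def)
    then show "z \<in> K" using g(1) by (metis rangeI subsetD)
  qed (simp add: p_def g(3))
  have pT: "p z \<in> T" if "z \<in> T" for z
    using that g KT T0 unfolding p_def by (auto intro!: fs.subspace_diff)
  have pp: "p (p z) = p z" for z
  proof -
    have "p (z - p z) = 0" unfolding p0 using g by (auto simp: p_def)
    moreover have "p z = p (z - p z) + p (p z)" by (metis p_add diff_add_cancel)
    ultimately show ?thesis by simp
  qed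
  define W where "W = p ` T"
  define \<psi> where "\<psi> a w = p (emb a w)" for a and w :: "'b \<times> 'a list \<Rightarrow> 'k"
  have pJ: "(\<Sum>a\<in>A. \<psi> a (u a)) = p (J u)" for u
  proof -
    have "p 0 = 0" by (simp add: p_def)
    from sum_comp_morphism[of p "\<lambda>a. emb a (u a)" A, OF this p_add] show ?thesis
      by (simp add: \<psi>_def J_def comp_def)
  qed
  have W: "fsubspace W"
    unfolding W_def fs.subspace_def
  proof (intro conjI ballI allI)
    show "0 \<in> p ` T" using fs.subspace_0[OF T0] fs.subspace_0[OF Kz] p0 by (auto intro!: image_eqI[of _ _ 0])
    fix x y assume "x \<in> p ` T" "y \<in> p ` T"
    then show "x + y \<in> p ` T" using p_add fs.subspace_add[OF T0] by (auto simp: image_iff) metis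
  next
    fix c x assume "x \<in> p ` T"
    then show "scl c x \<in> p ` T" using p_scl fs.subspace_scale[OF T0] by (auto simp: image_iff) metis
  qed
  have "\<psi> a w \<in> W" if "a \<in> A" "w \<in> U a" for a w
  proof -
    let ?u = "\<lambda>c. if c = a then w else 0"
    have "emb a w = J ?u"
    proof -
      have "J ?u = (\<Sum>c\<in>A. if c = a then emb a w else 0)"
        unfolding J_def by (rule sum.cong) (auto simp: emb_def fun_eq_iff split: list.split)
      then show ?thesis using A that by simp
    qed
    moreover have "J ?u \<in> T" using that U fs.subspace_0 by (intro TI) auto
    ultimately show ?thesis by (auto simp: \<psi>_def W_def)
  qed
  moreover have "card W * card U0 = card T"
  proof -
    have "bij_betw (\<lambda>(w, k). w + k) (W \<times> K) T"
      unfolding bij_betw_def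
    proof
      show "inj_on (\<lambda>(w, k). w + k) (W \<times> K)"
      proof (rule inj_onI, clarsimp)
        fix w k w' k' assume *: "w \<in> W" "k \<in> K" "w' \<in> W" "k' \<in> K" "w + k = w' + k'"
        then have "p (w + k) = p (w' + k')" by simp
        moreover have "p k = 0" "p k' = 0" using * p0 by blast+
        ultimately have "p w = p w'" by (simp only: p_add add_0_right)
        then have "w = w'" using * pp by (auto simp: W_def)
        then show "w = w' \<and> k = k'" using * by simp
      qed
      show "(\<lambda>(w, k). w + k) ` (W \<times> K) = T"
      proof
        show "(\<lambda>(w, k). w + k) ` (W \<times> K) \<subseteq> T"
          using pT KT fs.subspace_add[OF T0] by (auto simp: W_def)
        show "T \<subseteq> (\<lambda>(w, k). w + k) ` (W \<times> K)"
        proof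
          fix z assume "z \<in> T"
          moreover have "z = p z + g z" by (simp add: p_def)
          moreover have "g z \<in> K" using g by auto
          ultimately show "z \<in> (\<lambda>(w, k). w + k) ` (W \<times> K)"
            unfolding W_def by (intro image_eqI[of _ _ "(p z, g z)"]) auto
        qed
      qed
    qed
    then have "card (W \<times> K) = card T" by (rule bij_betw_same_card)
    moreover have "card K = card U0" unfolding K_def using injS by (rule card_image)
    ultimately show ?thesis by (simp add: card_cartesian_product)
  qed
  moreover have "\<exists>u. (\<forall>a\<in>A. u a \<in> U a) \<and> w = (\<Sum>a\<in>A. \<psi> a (u a))" if "w \<in> W" for w
    using that TE unfolding W_def pJ by blast
  moreover have "(\<Sum>a\<in>A. \<psi> a (u a)) = 0 \<longleftrightarrow> (\<exists>v\<in>U0. \<forall>a\<in>A. u a = f a v)" for u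
    unfolding pJ p0 by (auto simp: K_def S_def J_eq)
  moreover have "lin_on UNIV (\<psi> a)" for a
    unfolding \<psi>_def lin_on_def additive_on_def by (simp add: emb_add emb_scl p_add p_scl)
  moreover have "finite W" unfolding W_def using finT by simp
  ultimately show ?thesis using W cardT by (intro exI[of _ W] exI[of _ \<psi>]) auto
qed

section \<open>Representations in coordinates\<close>

text \<open>A representation in coordinates consists of a family of finite subspaces and a family of maps,
  of which only the restrictions to these subspaces matter.\<close>

type_synonym ('i, 'b, 'a, 'k) cspaces = "'i \<Rightarrow> ('b \<times> 'a list \<Rightarrow> 'k) set"
type_synonym ('b, 'a, 'k) cmaps = "'a \<Rightarrow> ('b \<times> 'a list \<Rightarrow> 'k) \<Rightarrow> 'b \<times> 'a list \<Rightarrow> 'k"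

definition crep :: "('i, 'a) pre_digraph \<Rightarrow> ('i, 'b, 'a, 'k::field) cspaces \<Rightarrow> ('b, 'a, 'k) cmaps \<Rightarrow> bool" where
  "crep Q U f \<longleftrightarrow> (\<forall>i\<in>verts Q. fsubspace (U i) \<and> finite (U i)) \<and>
     (\<forall>a\<in>arcs Q. f a ` U (tail Q a) \<subseteq> U (head Q a) \<and> lin_on (U (tail Q a)) (f a))"

text \<open>\<open>A\<close> is a subrepresentation of \<open>(U, f)\<close>; its maps are again given by \<open>f\<close>.\<close>

definition csub :: "('i, 'a) pre_digraph \<Rightarrow> ('i, 'b, 'a, 'k::field) cspaces \<Rightarrow> ('b, 'a, 'k) cmaps \<Rightarrow>
    ('i, 'b, 'a, 'k) cspaces \<Rightarrow> bool" where
  "csub Q U f A \<longleftrightarrow> (\<forall>i\<in>verts Q. fsubspace (A i) \<and> A i \<subseteq> U i) \<and>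
     (\<forall>a\<in>arcs Q. f a ` A (tail Q a) \<subseteq> A (head Q a))"

text \<open>\<open>(U, f)\<close> is the direct sum of its subrepresentations \<open>A\<close> and \<open>B\<close>.\<close>

definition ccompl :: "('i, 'a) pre_digraph \<Rightarrow> ('i, 'b, 'a, 'k::field) cspaces \<Rightarrow> ('b, 'a, 'k) cmaps \<Rightarrow>
    ('i, 'b, 'a, 'k) cspaces \<Rightarrow> ('i, 'b, 'a, 'k) cspaces \<Rightarrow> bool" where
  "ccompl Q U f A B \<longleftrightarrow> csub Q U f A \<and> csub Q U f B \<and>
     (\<forall>i\<in>verts Q. A i \<inter> B i = {0} \<and> (\<forall>x\<in>U i. \<exists>a\<in>A i. \<exists>b\<in>B i. x = a + b))"

lemma ccompl_commute:
  assumes "ccompl Q U f A B" shows "ccompl Q U f B A"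
  unfolding ccompl_def
proof (intro conjI ballI)
  fix i assume i: "i \<in> verts Q"
  show "B i \<inter> A i = {0}" using assms i unfolding ccompl_def by blast
  fix x assume "x \<in> U i"
  then obtain a b where "a \<in> A i" "b \<in> B i" "x = a + b" using assms i unfolding ccompl_def by blast
  then show "\<exists>a\<in>B i. \<exists>b\<in>A i. x = a + b" using add.commute[of a b] by blast
qed (use assms in \<open>simp_all add: ccompl_def\<close>)

text \<open>\<open>(U, f)\<close> is an indecomposable representation; in particular it is nonzero.\<close>

definition cindec :: "('i, 'a) pre_digraph \<Rightarrow> ('i, 'b, 'a, 'k::field) cspaces \<Rightarrow> ('b, 'a, 'k) cmaps \<Rightarrow> bool" where
  "cindec Q U f \<longleftrightarrow> crep Q U f \<and> (\<exists>i\<in>verts Q. U i \<noteq> {0}) \<and>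
     (\<forall>A B. ccompl Q U f A B \<longrightarrow> (\<forall>i\<in>verts Q. A i = {0}) \<or> (\<forall>i\<in>verts Q. B i = {0}))"

text \<open>Morphisms are families of maps that commute with the maps along the arrows.  They only have to be
  additive on the spaces; compatibility with scalars plays no role in the argument.\<close>

definition chom :: "('i, 'a) pre_digraph \<Rightarrow> ('i, 'b, 'a, 'k::field) cspaces \<Rightarrow> ('b, 'a, 'k) cmaps \<Rightarrow>
    ('i, 'b, 'a, 'k) cspaces \<Rightarrow> ('b, 'a, 'k) cmaps \<Rightarrow>
    ('i \<Rightarrow> ('b \<times> 'a list \<Rightarrow> 'k) \<Rightarrow> 'b \<times> 'a list \<Rightarrow> 'k) \<Rightarrow> bool" where
  "chom Q U f U' f' g \<longleftrightarrow> (\<forall>i\<in>verts Q. additive_on (U i) (g i) \<and> g i ` U i \<subseteq> U' i) \<and>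
     (\<forall>a\<in>arcs Q. \<forall>x\<in>U (tail Q a). g (head Q a) (f a x) = f' a (g (tail Q a) x))"

definition nonzero_chom :: "('i, 'a) pre_digraph \<Rightarrow> ('i, 'b, 'a, 'k::field) cspaces \<Rightarrow> ('b, 'a, 'k) cmaps \<Rightarrow>
    ('i, 'b, 'a, 'k) cspaces \<Rightarrow> ('b, 'a, 'k) cmaps \<Rightarrow> bool" where
  "nonzero_chom Q U f U' f' \<longleftrightarrow> (\<exists>g. chom Q U f U' f' g \<and> (\<exists>i\<in>verts Q. \<exists>x\<in>U i. g i x \<noteq> 0))"

section \<open>Reflection at a source\<close>

text \<open>All arrows leaving the vertex are reversed.  This is the reflected quiver when the vertex is a
  source.\<close>

definition reflect :: "('i, 'a) pre_digraph \<Rightarrow> 'i \<Rightarrow> ('i, 'a) pre_digraph" where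
  "reflect Q i = Q\<lparr>tail := \<lambda>a. if tail Q a = i then head Q a else tail Q a,
                   head := \<lambda>a. if tail Q a = i then i else head Q a\<rparr>"

lemma reflect_simps [simp]:
  "verts (reflect Q i) = verts Q" "arcs (reflect Q i) = arcs Q"
  "tail (reflect Q i) = (\<lambda>a. if tail Q a = i then head Q a else tail Q a)"
  "head (reflect Q i) = (\<lambda>a. if tail Q a = i then i else head Q a)"
  by (simp_all add: reflect_def)

text \<open>\<open>i\<close> is a vertex at which no arrow ends.\<close>

definition source :: "('i, 'a) pre_digraph \<Rightarrow> 'i \<Rightarrow> bool" where
  "source Q i \<longleftrightarrow> i \<in> verts Q \<and> (\<forall>a\<in>arcs Q. head Q a \<noteq> i)"

lemma additive_on_diff:
  "additive_on A g \<Longrightarrow> fsubspace A \<Longrightarrow> x \<in> A \<Longrightarrow> y \<in> A \<Longrightarrow> g (x - y) = g x - g y"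
  using fs.subspace_diff[of A x y] unfolding additive_on_def
  by (metis add_diff_cancel diff_add_cancel)

lemma fsubspace_zero: "fsubspace {0}"
  by (auto simp: fs.subspace_def)

text \<open>An indecomposable representation that is not concentrated at the source \<open>i\<close> embeds its space at
  \<open>i\<close> into the product of the spaces at the heads of the arrows leaving \<open>i\<close>, since the common kernel
  of these arrows is a direct summand.\<close>

lemma star_injective:
  assumes fin: "fin_digraph Q" and ind: "cindec Q U f" and src: "source Q i"
    and j: "j \<in> verts Q" "j \<noteq> i" "U j \<noteq> {0}"
    and v: "v \<in> U i" "\<And>a. a \<in> arcs Q \<Longrightarrow> tail Q a = i \<Longrightarrow> f a v = 0"
  shows "v = 0"
proof -
  interpret fin_digraph Q by fact
  have rep: "crep Q U f" using ind unfolding cindec_def by blast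
  have i: "i \<in> verts Q" "\<And>a. a \<in> arcs Q \<Longrightarrow> head Q a \<noteq> i" using src unfolding source_def by auto
  have Us: "fsubspace (U j)" if "j \<in> verts Q" for j using rep that unfolding crep_def by blast
  have fa: "f a ` U (tail Q a) \<subseteq> U (head Q a)" "lin_on (U (tail Q a)) (f a)" if "a \<in> arcs Q" for a
    using rep that unfolding crep_def by blast+
  define K where "K = {v\<in>U i. \<forall>a\<in>arcs Q. tail Q a = i \<longrightarrow> f a v = 0}"
  have K: "fsubspace K"
    unfolding fs.subspace_def
  proof (intro conjI ballI allI)
    show "0 \<in> K" unfolding K_def using fa(2) lin_on_zero fs.subspace_0[OF Us[OF i(1)]] by blast
  next
    fix x y assume xy: "x \<in> K" "y \<in> K"
    have "f a (x + y) = 0" if "a \<in> arcs Q" "tail Q a = i" for a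
    proof -
      have "f a (x + y) = f a x + f a y"
        using fa(2)[OF that(1)] that(2) xy unfolding lin_on_def additive_on_def K_def by blast
      then show ?thesis using xy that by (simp add: K_def)
    qed
    then show "x + y \<in> K" using xy fs.subspace_add[OF Us[OF i(1)]] unfolding K_def by blast
  next
    fix c x assume x: "x \<in> K"
    have "f a (scl c x) = 0" if "a \<in> arcs Q" "tail Q a = i" for a
    proof -
      have "f a (scl c x) = scl c (f a x)"
        using fa(2)[OF that(1)] that(2) x unfolding lin_on_def K_def by blast
      then show ?thesis using x that by (simp add: K_def)
    qed
    then show "scl c x \<in> K" using x fs.subspace_scale[OF Us[OF i(1)]] unfolding K_def by blast
  qed
  obtain C where C: "fsubspace C" "C \<subseteq> U i" "K \<inter> C = {0}" "\<forall>u\<in>U i. \<exists>k\<in>K. \<exists>c\<in>C. u = k + c"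
    using exists_complement[OF K Us[OF i(1)]] unfolding K_def by blast
  define A where "A = (\<lambda>j. if j = i then K else {0})"
  define B where "B = U(i := C)"
  have "csub Q U f A"
    unfolding csub_def
  proof (intro conjI ballI)
    fix j assume j: "j \<in> verts Q"
    show "fsubspace (A j)" using K fsubspace_zero by (simp add: A_def)
    show "A j \<subseteq> U j" using fs.subspace_0[OF Us[OF j]] by (auto simp: A_def K_def)
  next
    fix a assume a: "a \<in> arcs Q"
    have "f a 0 = 0" using lin_on_zero[OF fa(2)[OF a]] fs.subspace_0[OF Us] a by simp
    then show "f a ` A (tail Q a) \<subseteq> A (head Q a)" using a i(2)[OF a] by (auto simp: A_def K_def)
  qed
  moreover have "csub Q U f B"
    unfolding csub_def
  proof (intro conjI ballI)
    fix j assume j: "j \<in> verts Q"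
    show "fsubspace (B j)" "B j \<subseteq> U j" using C Us[OF j] by (auto simp: B_def)
  next
    fix a assume a: "a \<in> arcs Q"
    show "f a ` B (tail Q a) \<subseteq> B (head Q a)"
      using fa(1)[OF a] i(2)[OF a] C(2) by (auto simp: B_def split: if_splits)
  qed
  moreover have "A j \<inter> B j = {0} \<and> (\<forall>x\<in>U j. \<exists>a\<in>A j. \<exists>b\<in>B j. x = a + b)" if "j \<in> verts Q" for j
    using C(3,4) fs.subspace_0[OF Us[OF that]] by (auto simp: A_def B_def)
  ultimately have "ccompl Q U f A B" unfolding ccompl_def by blast
  then have "(\<forall>i\<in>verts Q. A i = {0}) \<or> (\<forall>i\<in>verts Q. B i = {0})" using ind unfolding cindec_def by blast
  moreover have "B j \<noteq> {0}" using j by (simp add: B_def)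
  ultimately have "A i = {0}" using i(1) j(1) by blast
  then show ?thesis using v unfolding A_def K_def by auto
qed

text \<open>The data of the reflected representation at the new sink \<open>i\<close>: the space \<open>W\<close> is the cokernel of
  the map from \<open>U i\<close> to the product, and \<open>\<psi> a\<close> is the map along the reversed arrow \<open>a\<close>.\<close>

definition cokernel :: "('i, 'a) pre_digraph \<Rightarrow> 'i \<Rightarrow> ('i, 'b, 'a, 'k::field) cspaces \<Rightarrow> ('b, 'a, 'k) cmaps \<Rightarrow>
    ('b \<times> 'a list \<Rightarrow> 'k) set \<Rightarrow> ('b, 'a, 'k) cmaps \<Rightarrow> bool" where
  "cokernel Q i U f W \<psi> \<longleftrightarrow> (let A = {a\<in>arcs Q. tail Q a = i} in
    fsubspace W \<and> finite W \<and> (\<forall>a. lin_on UNIV (\<psi> a)) \<and> (\<forall>a\<in>A. \<psi> a ` U (head Q a) \<subseteq> W) \<and>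
    (\<forall>w\<in>W. \<exists>u. (\<forall>a\<in>A. u a \<in> U (head Q a)) \<and> w = (\<Sum>a\<in>A. \<psi> a (u a))) \<and>
    (\<forall>u. (\<forall>a\<in>A. u a \<in> U (head Q a)) \<longrightarrow> ((\<Sum>a\<in>A. \<psi> a (u a)) = 0 \<longleftrightarrow> (\<exists>v\<in>U i. \<forall>a\<in>A. u a = f a v))) \<and>
    card W * card (U i) = (\<Prod>a\<in>A. card (U (head Q a))))"

lemma reflected_exists:
  assumes fin: "fin_digraph Q" and ind: "cindec Q U f" and src: "source Q i"
    and j: "j \<in> verts Q" "j \<noteq> i" "U j \<noteq> {0}"
  shows "\<exists>W \<psi>. cokernel Q i U f W \<psi>"
proof -
  interpret fin_digraph Q by fact
  have rep: "crep Q U f" using ind unfolding cindec_def by blast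
  have i: "i \<in> verts Q" using src unfolding source_def by auto
  show ?thesis
    unfolding cokernel_def Let_def
  proof (rule cokernel_exists)
    show "finite {a\<in>arcs Q. tail Q a = i}" by simp
    show "fsubspace (U i)" "finite (U i)" using rep i unfolding crep_def by blast+
    fix v assume "v \<in> U i" "\<forall>a\<in>{a\<in>arcs Q. tail Q a = i}. f a v = 0"
    then show "v = 0" using star_injective[OF fin ind src j, of v] by blast
  qed (use rep in \<open>unfold crep_def, auto\<close>)
qed

text \<open>The maps of the reflected representation: those along the reversed arrows come from the cokernel.\<close>

definition reflect_maps :: "('i, 'a) pre_digraph \<Rightarrow> 'i \<Rightarrow> ('b, 'a, 'k) cmaps \<Rightarrow> ('b, 'a, 'k) cmaps \<Rightarrow> ('b, 'a, 'k) cmaps" where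
  "reflect_maps Q i f \<psi> = (\<lambda>a. if tail Q a = i then \<psi> a else f a)"

lemma sum_psi_diff:
  assumes "\<forall>a. lin_on UNIV (\<psi> a)"
  shows "(\<Sum>a\<in>A. \<psi> a (u a - u' a)) = (\<Sum>a\<in>A. \<psi> a (u a)) - (\<Sum>a\<in>A. \<psi> a (u' a))"
proof -
  have "\<psi> a (u a - u' a) = \<psi> a (u a) - \<psi> a (u' a)" for a
    using additive_on_diff[of UNIV "\<psi> a"] assms unfolding lin_on_def by (simp add: fs.subspace_UNIV)
  then show ?thesis by (simp add: sum_subtractf)
qed

lemma cindec_reflect:
  assumes fin: "fin_digraph Q" and ind: "cindec Q U f" and src: "source Q i"
    and j: "j \<in> verts Q" "j \<noteq> i" "U j \<noteq> {0}"
    and cok: "cokernel Q i U f W \<psi>"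
  shows "cindec (reflect Q i) (U(i := W)) (reflect_maps Q i f \<psi>)"
proof -
  interpret fin_digraph Q by fact
  define A where "A = {a\<in>arcs Q. tail Q a = i}"
  note cok = cok[unfolded cokernel_def Let_def, folded A_def]
  have W: "fsubspace W" "finite W" and lin: "\<forall>a. lin_on UNIV (\<psi> a)"
    and im: "\<And>a u. a \<in> A \<Longrightarrow> u \<in> U (head Q a) \<Longrightarrow> \<psi> a u \<in> W"
    and surj: "\<And>w. w \<in> W \<Longrightarrow> \<exists>u. (\<forall>a\<in>A. u a \<in> U (head Q a)) \<and> w = (\<Sum>a\<in>A. \<psi> a (u a))"
    and ker: "\<And>u. (\<forall>a\<in>A. u a \<in> U (head Q a)) \<Longrightarrow> (\<Sum>a\<in>A. \<psi> a (u a)) = 0 \<longleftrightarrow> (\<exists>v\<in>U i. \<forall>a\<in>A. u a = f a v)"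
    using cok by blast+
  have add: "\<psi> a (x + y) = \<psi> a x + \<psi> a y" for a x y
    using lin lin_on_UNIV_add by blast
  have rep: "crep Q U f" using ind unfolding cindec_def by blast
  have i: "i \<in> verts Q" "\<And>a. a \<in> arcs Q \<Longrightarrow> head Q a \<noteq> i" using src unfolding source_def by auto
  have Us: "fsubspace (U j)" if "j \<in> verts Q" for j using rep that unfolding crep_def by blast
  have fa: "f a ` U (tail Q a) \<subseteq> U (head Q a)" "lin_on (U (tail Q a)) (f a)" if "a \<in> arcs Q" for a
    using rep that unfolding crep_def by blast+
  have star: "v = 0" if "v \<in> U i" "\<And>a. a \<in> A \<Longrightarrow> f a v = 0" for v
    using star_injective[OF fin ind src j, of v] that unfolding A_def by blast
  let ?Q = "reflect Q i" and ?U = "U(i := W)" and ?f = "reflect_maps Q i f \<psi>"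
  have rep': "crep ?Q ?U ?f"
    unfolding crep_def reflect_maps_def using W rep i(2) im lin
    by (auto simp: crep_def A_def intro: lin_on_subset)
  \<comment> \<open>A subrepresentation of the reflected representation gives one of the original: at \<open>i\<close> take the
    vectors that all arrows map into it.  Summands give summands.\<close>
  have restrict: "csub Q U f (C(i := {v\<in>U i. \<forall>a\<in>A. f a v \<in> C (head Q a)}))"
    if C: "csub ?Q ?U ?f C" for C
    unfolding csub_def
  proof (intro conjI ballI)
    fix j assume j: "j \<in> verts Q"
    show "fsubspace ((C(i := {v\<in>U i. \<forall>a\<in>A. f a v \<in> C (head Q a)})) j)"
    proof (cases "j = i")
      case False then show ?thesis using C j unfolding csub_def by auto
    next
      case True
      have Cs: "fsubspace (C (head Q a))" if "a \<in> A" for a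
        using C that unfolding csub_def A_def by auto
      have f0: "f a 0 = 0" if "a \<in> A" for a
        using lin_on_zero[OF fa(2)] that fs.subspace_0[OF Us[OF i(1)]] unfolding A_def by auto
      have fadd: "f a (x + y) = f a x + f a y" if "a \<in> A" "x \<in> U i" "y \<in> U i" for a x y
        using fa(2)[of a] that unfolding A_def lin_on_def additive_on_def by auto
      have fscl: "f a (scl c x) = scl c (f a x)" if "a \<in> A" "x \<in> U i" for a c x
        using fa(2)[of a] that unfolding A_def lin_on_def by auto
      have "fsubspace {v\<in>U i. \<forall>a\<in>A. f a v \<in> C (head Q a)}"
        unfolding fs.subspace_def
        by (auto simp: f0 fadd fscl fs.subspace_0[OF Us[OF i(1)]] fs.subspace_add[OF Us[OF i(1)]]
            fs.subspace_scale[OF Us[OF i(1)]] fs.subspace_0[OF Cs] fs.subspace_add[OF Cs]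
            fs.subspace_scale[OF Cs])
      then show ?thesis using True by simp
    qed
    show "(C(i := {v\<in>U i. \<forall>a\<in>A. f a v \<in> C (head Q a)})) j \<subseteq> U j"
      using C j unfolding csub_def by (auto split: if_splits)
  next
    fix a assume a: "a \<in> arcs Q"
    show "f a ` (C(i := {v\<in>U i. \<forall>a\<in>A. f a v \<in> C (head Q a)})) (tail Q a)
      \<subseteq> (C(i := {v\<in>U i. \<forall>a\<in>A. f a v \<in> C (head Q a)})) (head Q a)"
      using a i(2)[OF a] C unfolding csub_def A_def reflect_maps_def by (auto split: if_splits)
  qed
  have psub: "\<psi> a x \<in> C i" if C: "csub ?Q ?U ?f C" and a: "a \<in> A" and x: "x \<in> C (head Q a)" for C a x
  proof -
    have "\<forall>a\<in>arcs ?Q. ?f a ` C (tail ?Q a) \<subseteq> C (head ?Q a)" using C unfolding csub_def by blast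
    then have "?f a ` C (tail ?Q a) \<subseteq> C (head ?Q a)" using a by (auto simp only: A_def reflect_simps)
    then show ?thesis using a x by (simp add: reflect_maps_def A_def image_subset_iff)
  qed
  have zero: "\<forall>j\<in>verts Q. C j = {0}"
    if CD: "ccompl ?Q ?U ?f C D" and z: "\<And>j. j \<in> verts Q \<Longrightarrow> j \<noteq> i \<Longrightarrow> C j = {0}" for C D
  proof
    fix j assume j: "j \<in> verts Q"
    show "C j = {0}"
    proof (cases "j = i")
      case True
      have "w = 0" if w: "w \<in> C i" for w
      proof -
        have "csub ?Q ?U ?f C" using CD by (simp add: ccompl_def)
        then have "C i \<subseteq> ?U i" unfolding csub_def using i(1) by (simp only: reflect_simps)
        then have "w \<in> W" using w by auto
        then obtain u where u: "\<forall>a\<in>A. u a \<in> U (head Q a)" "w = (\<Sum>a\<in>A. \<psi> a (u a))" using surj by blast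
        have D: "fsubspace (D i)" using CD i(1) unfolding ccompl_def csub_def by auto
        have "\<psi> a (u a) \<in> D i" if a: "a \<in> A" for a
        proof -
          have a': "a \<in> arcs Q" "tail Q a = i" "head Q a \<noteq> i" "head Q a \<in> verts Q" using a i(2) unfolding A_def by auto
          have "u a \<in> ?U (head Q a)" using u(1) a a'(3) by simp
          then obtain x y where "x \<in> C (head Q a)" "y \<in> D (head Q a)" "u a = x + y"
            using CD a'(4) unfolding ccompl_def reflect_simps by blast
          then have "u a \<in> D (head Q a)" using z[OF a'(4,3)] by simp
          then show ?thesis using psub[OF _ a] CD unfolding ccompl_def by blast
        qed
        then have "w \<in> D i" unfolding u(2) by (rule fs.subspace_sum[OF D])
        then show ?thesis using w CD i(1) unfolding ccompl_def by auto
      qed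
      moreover have "0 \<in> C i" using CD i(1) unfolding ccompl_def csub_def by (auto intro: fs.subspace_0)
      ultimately show ?thesis using True by auto
    qed (use z j in auto)
  qed
  have "(\<forall>i\<in>verts ?Q. C i = {0}) \<or> (\<forall>i\<in>verts ?Q. D i = {0})" if CD: "ccompl ?Q ?U ?f C D" for C D
  proof -
    let ?C = "C(i := {v\<in>U i. \<forall>a\<in>A. f a v \<in> C (head Q a)})"
    let ?D = "D(i := {v\<in>U i. \<forall>a\<in>A. f a v \<in> D (head Q a)})"
    have subs: "csub ?Q ?U ?f C" "csub ?Q ?U ?f D" using CD unfolding ccompl_def by auto
    have Ci: "fsubspace (C i)" "fsubspace (D i)" using subs i(1) unfolding csub_def by auto
    have other: "?C j \<inter> ?D j = {0} \<and> (\<forall>x\<in>U j. \<exists>a\<in>?C j. \<exists>b\<in>?D j. x = a + b)"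
      if "j \<in> verts Q" "j \<noteq> i" for j
    proof -
      have "\<forall>j\<in>verts Q. C j \<inter> D j = {0} \<and> (\<forall>x\<in>?U j. \<exists>a\<in>C j. \<exists>b\<in>D j. x = a + b)"
        using CD unfolding ccompl_def reflect_simps by blast
      from bspec[OF this that(1)] show ?thesis using that(2) by simp
    qed
    have hd: "head Q a \<in> verts Q" "head Q a \<noteq> i" if "a \<in> A" for a
      using that i(2) unfolding A_def by auto
    have inter: "?C i \<inter> ?D i = {0}"
    proof -
      have "v = 0" if "v \<in> ?C i" "v \<in> ?D i" for v
      proof (rule star)
        fix a assume a: "a \<in> A"
        have "f a v \<in> C (head Q a) \<inter> D (head Q a)" using that a by simp
        then show "f a v = 0" using other[OF hd[OF a]] hd(2)[OF a] by simp blast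
      qed (use that in simp)
      moreover have "0 \<in> ?C i" "0 \<in> ?D i"
        using restrict[OF subs(1)] restrict[OF subs(2)] i(1) fs.subspace_0 unfolding csub_def by blast+
      ultimately show ?thesis by blast
    qed
    have sum: "\<exists>a\<in>?C i. \<exists>b\<in>?D i. v = a + b" if v: "v \<in> U i" for v
    proof -
      have "\<exists>x y. x \<in> C (head Q a) \<and> y \<in> D (head Q a) \<and> f a v = x + y" if a: "a \<in> A" for a
      proof -
        have "f a v \<in> U (head Q a)" using fa(1)[of a] a v unfolding A_def by auto
        then show ?thesis using other[OF hd[OF a]] hd(2)[OF a] by simp blast
      qed
      then obtain x y where xy: "\<And>a. a \<in> A \<Longrightarrow> x a \<in> C (head Q a)" "\<And>a. a \<in> A \<Longrightarrow> y a \<in> D (head Q a)"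
        "\<And>a. a \<in> A \<Longrightarrow> f a v = x a + y a" by metis
      have sub: "E (head Q a) \<subseteq> U (head Q a)" if "csub ?Q ?U ?f E" "a \<in> A" for E a
      proof -
        have "E (head Q a) \<subseteq> ?U (head Q a)" using that(1) hd[OF that(2)] unfolding csub_def reflect_simps by blast
        then show ?thesis using hd[OF that(2)] by simp
      qed
      have xU: "\<forall>a\<in>A. x a \<in> U (head Q a)" using sub[OF subs(1)] xy(1) by blast
      have yU: "\<forall>a\<in>A. y a \<in> U (head Q a)" using sub[OF subs(2)] xy(2) by blast
      have vU: "\<forall>a\<in>A. f a v \<in> U (head Q a)" using fa(1) v unfolding A_def by auto
      have "(\<Sum>a\<in>A. \<psi> a (x a)) + (\<Sum>a\<in>A. \<psi> a (y a)) = (\<Sum>a\<in>A. \<psi> a (f a v))"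
        unfolding sum.distrib[symmetric] using xy by (intro sum.cong) (auto simp: add)
      also have "\<dots> = 0" using ker[OF vU] v by blast
      finally have s0: "(\<Sum>a\<in>A. \<psi> a (x a)) + (\<Sum>a\<in>A. \<psi> a (y a)) = 0" .
      have sx: "(\<Sum>a\<in>A. \<psi> a (x a)) \<in> C i"
      proof (rule fs.subspace_sum[OF Ci(1)])
        fix a assume "a \<in> A"
        then show "\<psi> a (x a) \<in> C i" using psub[OF subs(1)] xy(1) by blast
      qed
      have sy: "(\<Sum>a\<in>A. \<psi> a (y a)) \<in> D i"
      proof (rule fs.subspace_sum[OF Ci(2)])
        fix a assume "a \<in> A"
        then show "\<psi> a (y a) \<in> D i" using psub[OF subs(2)] xy(2) by blast
      qed
      have "(\<Sum>a\<in>A. \<psi> a (x a)) = - (\<Sum>a\<in>A. \<psi> a (y a))" using s0 by (simp add: eq_neg_iff_add_eq_0)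
      then have "(\<Sum>a\<in>A. \<psi> a (x a)) \<in> C i \<inter> D i" using sx fs.subspace_neg[OF Ci(2) sy] by simp
      then have x0: "(\<Sum>a\<in>A. \<psi> a (x a)) = 0" using CD i(1) unfolding ccompl_def by auto
      then have y0: "(\<Sum>a\<in>A. \<psi> a (y a)) = 0" using s0 by simp
      obtain v1 where v1: "v1 \<in> U i" "\<forall>a\<in>A. x a = f a v1" using ker[OF xU] x0 by blast
      obtain v2 where v2: "v2 \<in> U i" "\<forall>a\<in>A. y a = f a v2" using ker[OF yU] y0 by blast
      have "v - (v1 + v2) = 0"
      proof (rule star)
        show "v - (v1 + v2) \<in> U i" using v v1 v2 Us[OF i(1)] by (intro fs.subspace_diff fs.subspace_add)
        fix a assume a: "a \<in> A"
        have ad: "additive_on (U i) (f a)" using fa(2)[of a] a unfolding A_def lin_on_def by auto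
        have "f a (v - (v1 + v2)) = f a v - f a (v1 + v2)"
          using additive_on_diff[OF ad Us[OF i(1)] v] v1 v2 Us[OF i(1)] by (simp add: fs.subspace_add)
        also have "f a (v1 + v2) = f a v1 + f a v2" using ad v1 v2 unfolding additive_on_def by blast
        finally have d: "f a (v - (v1 + v2)) = f a v - (f a v1 + f a v2)" .
        have "f a v = f a v1 + f a v2" using xy(3)[OF a] v1 v2 a by simp
        then show "f a (v - (v1 + v2)) = 0" unfolding d by (simp only: diff_self)
      qed
      then have "v = v1 + v2" by simp
      moreover have "v1 \<in> ?C i" "v2 \<in> ?D i" using v1 v2 xy by auto
      ultimately show ?thesis by blast
    qed
    have "ccompl Q U f ?C ?D"
      unfolding ccompl_def
    proof (intro conjI restrict subs ballI)
      fix j assume j: "j \<in> verts Q"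
      show "?C j \<inter> ?D j = {0}" using other[OF j] inter by (cases "j = i") blast+
      fix x assume "x \<in> U j"
      then show "\<exists>a\<in>?C j. \<exists>b\<in>?D j. x = a + b" using other[OF j] sum by (cases "j = i") blast+
    qed
    then have "(\<forall>i\<in>verts Q. ?C i = {0}) \<or> (\<forall>i\<in>verts Q. ?D i = {0})" using ind unfolding cindec_def by blast
    then show ?thesis
    proof
      assume z: "\<forall>i\<in>verts Q. ?C i = {0}"
      have "\<forall>j\<in>verts Q. C j = {0}"
      proof (rule zero[OF CD])
        fix j assume "j \<in> verts Q" "j \<noteq> i"
        then show "C j = {0}" using bspec[OF z, of j] by simp
      qed
      then show ?thesis by simp
    next
      assume z: "\<forall>i\<in>verts Q. ?D i = {0}"
      have DC: "ccompl ?Q ?U ?f D C"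
        using CD by (rule ccompl_commute)
      have "\<forall>j\<in>verts Q. D j = {0}"
      proof (rule zero[OF DC])
        fix j assume "j \<in> verts Q" "j \<noteq> i"
        then show "D j = {0}" using bspec[OF z, of j] by simp
      qed
      then show ?thesis by simp
    qed
  qed
  moreover have "\<exists>j\<in>verts ?Q. ?U j \<noteq> {0}" using j by auto
  ultimately show ?thesis using rep' unfolding cindec_def by blast
qed

lemma nonzero_chom_reflect:
  assumes fin: "fin_digraph Q" and src: "source Q i"
    and ind: "cindec Q U f" and ind': "cindec Q U' f'" and hom: "nonzero_chom Q U f U' f'"
    and j: "j \<in> verts Q" "j \<noteq> i" "U' j \<noteq> {0}"
    and cok: "cokernel Q i U f W \<psi>" and cok': "cokernel Q i U' f' W' \<psi>'"
  shows "nonzero_chom (reflect Q i) (U(i := W)) (reflect_maps Q i f \<psi>) (U'(i := W')) (reflect_maps Q i f' \<psi>')"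
proof -
  interpret fin_digraph Q by fact
  define A where "A = {a\<in>arcs Q. tail Q a = i}"
  note cok = cok[unfolded cokernel_def Let_def, folded A_def]
  note cok' = cok'[unfolded cokernel_def Let_def, folded A_def]
  have W: "fsubspace W" and lin: "\<forall>a. lin_on UNIV (\<psi> a)"
    and surj: "\<And>w. w \<in> W \<Longrightarrow> \<exists>u. (\<forall>a\<in>A. u a \<in> U (head Q a)) \<and> w = (\<Sum>a\<in>A. \<psi> a (u a))"
    and ker: "\<And>u. (\<forall>a\<in>A. u a \<in> U (head Q a)) \<Longrightarrow> (\<Sum>a\<in>A. \<psi> a (u a)) = 0 \<longleftrightarrow> (\<exists>v\<in>U i. \<forall>a\<in>A. u a = f a v)"
    using cok by blast+
  have W': "fsubspace W'" and lin': "\<forall>a. lin_on UNIV (\<psi>' a)"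
    and im': "\<And>a u. a \<in> A \<Longrightarrow> u \<in> U' (head Q a) \<Longrightarrow> \<psi>' a u \<in> W'"
    and ker': "\<And>u. (\<forall>a\<in>A. u a \<in> U' (head Q a)) \<Longrightarrow> (\<Sum>a\<in>A. \<psi>' a (u a)) = 0 \<longleftrightarrow> (\<exists>v\<in>U' i. \<forall>a\<in>A. u a = f' a v)"
    using cok' by blast+
  have add: "\<psi> a (x + y) = \<psi> a x + \<psi> a y" "\<psi>' a (x + y) = \<psi>' a x + \<psi>' a y" for a x y
    using lin_on_UNIV_add[OF spec[OF lin]] lin_on_UNIV_add[OF spec[OF lin']] by blast+
  have i: "i \<in> verts Q" "\<And>a. a \<in> arcs Q \<Longrightarrow> head Q a \<noteq> i" using src unfolding source_def by auto
  have Us: "fsubspace (U j)" if "j \<in> verts Q" for j using ind that unfolding cindec_def crep_def by blast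
  have hd: "head Q a \<in> verts Q" "head Q a \<noteq> i" if "a \<in> A" for a
    using that i(2) unfolding A_def by auto
  obtain g where g: "chom Q U f U' f' g" "\<exists>i\<in>verts Q. \<exists>x\<in>U i. g i x \<noteq> 0"
    using hom unfolding nonzero_chom_def by blast
  have gadd: "additive_on (U j) (g j)" "g j ` U j \<subseteq> U' j" if "j \<in> verts Q" for j
    using g(1) that unfolding chom_def by blast+
  have gcomm: "g (head Q a) (f a x) = f' a (g (tail Q a) x)" if "a \<in> arcs Q" "x \<in> U (tail Q a)" for a x
    using g(1) that unfolding chom_def by blast
  define G where "G u = (\<Sum>a\<in>A. \<psi>' a (g (head Q a) (u a)))" for u
  have Gdiff: "G u = G u'" if u: "\<forall>a\<in>A. u a \<in> U (head Q a)" and u': "\<forall>a\<in>A. u' a \<in> U (head Q a)"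
    and eq: "(\<Sum>a\<in>A. \<psi> a (u a)) = (\<Sum>a\<in>A. \<psi> a (u' a))" for u u'
  proof -
    have d: "\<forall>a\<in>A. u a - u' a \<in> U (head Q a)" using u u' hd Us by (auto intro: fs.subspace_diff)
    have "(\<Sum>a\<in>A. \<psi> a (u a - u' a)) = 0" using sum_psi_diff[OF lin, of u u' A] eq by simp
    then obtain v where v: "v \<in> U i" "\<forall>a\<in>A. u a - u' a = f a v" using ker[OF d] by blast
    have "G u - G u' = (\<Sum>a\<in>A. \<psi>' a (g (head Q a) (u a) - g (head Q a) (u' a)))"
      unfolding G_def sum_psi_diff[OF lin'] ..
    also have "\<dots> = (\<Sum>a\<in>A. \<psi>' a (f' a (g i v)))"
    proof (intro sum.cong refl)
      fix a assume a: "a \<in> A"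
      have "g (head Q a) (u a) - g (head Q a) (u' a) = g (head Q a) (u a - u' a)"
        using additive_on_diff[OF gadd(1)[OF hd(1)[OF a]] Us[OF hd(1)[OF a]]] u u' a by simp
      also have "\<dots> = f' a (g i v)" using gcomm[of a v] v a unfolding A_def by auto
      finally show "\<psi>' a (g (head Q a) (u a) - g (head Q a) (u' a)) = \<psi>' a (f' a (g i v))" by simp
    qed
    also have "\<dots> = 0"
    proof -
      have gv: "g i v \<in> U' i" using gadd(2)[OF i(1)] v(1) by auto
      have "\<forall>a\<in>A. f' a (g i v) \<in> U' (head Q a)"
        using ind' gv unfolding cindec_def crep_def A_def by auto
      then show ?thesis using ker'[of "\<lambda>a. f' a (g i v)"] gv by blast
    qed
    finally show ?thesis by simp
  qed
  \<comment> \<open>By \<open>Gdiff\<close>, the value of \<open>G\<close> at a preimage depends only on its class in the cokernel.\<close>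
  define h where "h w = G (SOME u. (\<forall>a\<in>A. u a \<in> U (head Q a)) \<and> w = (\<Sum>a\<in>A. \<psi> a (u a)))" for w
  have hG: "h (\<Sum>a\<in>A. \<psi> a (u a)) = G u" if "\<forall>a\<in>A. u a \<in> U (head Q a)" for u
  proof -
    let ?P = "\<lambda>u'. (\<forall>a\<in>A. u' a \<in> U (head Q a)) \<and> (\<Sum>a\<in>A. \<psi> a (u a)) = (\<Sum>a\<in>A. \<psi> a (u' a))"
    have "?P (SOME u'. ?P u')" using that by (intro someI[of ?P u]) simp
    then show ?thesis unfolding h_def using Gdiff[OF that, of "SOME u'. ?P u'"] by simp
  qed
  have Gadd: "G (\<lambda>a. u a + u' a) = G u + G u'"
    if u: "\<forall>a\<in>A. u a \<in> U (head Q a)" and u': "\<forall>a\<in>A. u' a \<in> U (head Q a)" for u u'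
    unfolding G_def sum.distrib[symmetric]
  proof (intro sum.cong refl)
    fix a assume a: "a \<in> A"
    have "g (head Q a) (u a + u' a) = g (head Q a) (u a) + g (head Q a) (u' a)"
      using gadd(1)[OF hd(1)[OF a]] u u' a unfolding additive_on_def by blast
    then show "\<psi>' a (g (head Q a) (u a + u' a)) = \<psi>' a (g (head Q a) (u a)) + \<psi>' a (g (head Q a) (u' a))"
      by (simp add: add)
  qed
  have hadd: "additive_on W h"
    unfolding additive_on_def
  proof (intro ballI)
    fix x y assume xy: "x \<in> W" "y \<in> W"
    from surj[OF xy(1)] obtain u where u: "\<forall>a\<in>A. u a \<in> U (head Q a)" "x = (\<Sum>a\<in>A. \<psi> a (u a))"
      by blast
    from surj[OF xy(2)] obtain u' where u': "\<forall>a\<in>A. u' a \<in> U (head Q a)" "y = (\<Sum>a\<in>A. \<psi> a (u' a))"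
      by blast
    have s: "\<forall>a\<in>A. u a + u' a \<in> U (head Q a)" using u u' hd Us by (auto intro: fs.subspace_add)
    have "x + y = (\<Sum>a\<in>A. \<psi> a (u a + u' a))" using u u' by (simp add: add sum.distrib)
    then show "h (x + y) = h x + h y" using hG[OF s] Gadd[OF u(1) u'(1)] hG[OF u(1)] hG[OF u'(1)] u u' by simp
  qed
  have him: "h ` W \<subseteq> W'"
  proof clarify
    fix w assume "w \<in> W"
    then obtain u where u: "\<forall>a\<in>A. u a \<in> U (head Q a)" "w = (\<Sum>a\<in>A. \<psi> a (u a))" using surj by metis
    have "G u \<in> W'" unfolding G_def
      by (rule fs.subspace_sum[OF W']) (use u gadd(2)[OF hd(1)] im' in \<open>simp add: image_subset_iff\<close>)
    then show "h w \<in> W'" using hG[OF u(1)] u(2) by simp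
  qed
  have finA: "finite A" unfolding A_def by simp
  have hpsi: "h (\<psi> a x) = \<psi>' a (g (head Q a) x)" if a: "a \<in> A" and x: "x \<in> U (head Q a)" for a x
  proof -
    let ?u = "\<lambda>c. if c = a then x else 0"
    have u: "\<forall>c\<in>A. ?u c \<in> U (head Q c)" using x hd Us by (auto intro: fs.subspace_0)
    have z: "\<psi> c 0 = 0" "\<psi>' c 0 = 0" for c
      using lin lin' by (auto intro: lin_on_zero)
    have g0: "g (head Q c) 0 = 0" if "c \<in> A" for c
      using additive_on_zero[OF gadd(1)[OF hd(1)[OF that]]] fs.subspace_0[OF Us[OF hd(1)[OF that]]] .
    have "(\<Sum>c\<in>A. \<psi> c (?u c)) = (\<Sum>c\<in>A. if c = a then \<psi> a x else 0)"
      by (intro sum.cong refl) (auto simp: z)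
    then have 1: "(\<Sum>c\<in>A. \<psi> c (?u c)) = \<psi> a x" using a finA by simp
    have "G ?u = (\<Sum>c\<in>A. if c = a then \<psi>' a (g (head Q a) x) else 0)"
      unfolding G_def by (intro sum.cong refl) (auto simp: z g0)
    then have 2: "G ?u = \<psi>' a (g (head Q a) x)" using a finA by simp
    show ?thesis using hG[OF u] unfolding 1 2 .
  qed
  have "chom (reflect Q i) (U(i := W)) (reflect_maps Q i f \<psi>) (U'(i := W')) (reflect_maps Q i f' \<psi>') (g(i := h))"
    unfolding chom_def
  proof (intro conjI ballI)
    fix j assume "j \<in> verts (reflect Q i)"
    then show "additive_on ((U(i := W)) j) ((g(i := h)) j)" "(g(i := h)) j ` (U(i := W)) j \<subseteq> (U'(i := W')) j"
      using gadd[of j] hadd him by (cases "j = i"; simp)+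
  next
    fix a x assume a: "a \<in> arcs (reflect Q i)" and x: "x \<in> (U(i := W)) (tail (reflect Q i) a)"
    show "(g(i := h)) (head (reflect Q i) a) (reflect_maps Q i f \<psi> a x) =
      reflect_maps Q i f' \<psi>' a ((g(i := h)) (tail (reflect Q i) a) x)"
    proof (cases "tail Q a = i")
      case True
      then have aA: "a \<in> A" using a unfolding A_def by simp
      then show ?thesis using hpsi[OF aA, of x] x True hd(2)[OF aA] by (simp add: reflect_maps_def)
    next
      case False
      then show ?thesis using gcomm[of a x] x a i(2)[of a] by (simp add: reflect_maps_def)
    qed
  qed
  moreover have "\<exists>j\<in>verts Q. j \<noteq> i \<and> (\<exists>x\<in>U j. g j x \<noteq> 0)"
  proof (rule ccontr)
    assume n: "\<not> ?thesis"
    have "g i v = 0" if v: "v \<in> U i" for v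
    proof (rule star_injective[OF fin ind' src j])
      show "g i v \<in> U' i" using gadd(2)[OF i(1)] v by auto
      fix a assume a: "a \<in> arcs Q" "tail Q a = i"
      have "f a v \<in> U (head Q a)" using ind v a unfolding cindec_def crep_def by auto
      then have "g (head Q a) (f a v) = 0" using n a i(2)[OF a(1)] by auto
      then show "f' a (g i v) = 0" using gcomm[of a v] a v by simp
    qed
    moreover obtain j0 x0 where "j0 \<in> verts Q" "x0 \<in> U j0" "g j0 x0 \<noteq> 0" using g(2) by auto
    ultimately show False using n by (cases "j0 = i") auto
  qed
  then obtain j x where "j \<in> verts Q" "j \<noteq> i" "x \<in> U j" "g j x \<noteq> 0" by blast
  then have "\<exists>j\<in>verts (reflect Q i). \<exists>x\<in>(U(i := W)) j. (g(i := h)) j x \<noteq> 0"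
    by (intro bexI[of _ j] bexI[of _ x]) simp_all
  ultimately show ?thesis unfolding nonzero_chom_def by blast
qed

section \<open>The Euler form and sequences of dimension vectors\<close>

text \<open>The characteristic relation between a vector \<open>x\<close> and its image \<open>x'\<close> under a Coxeter
  transformation, that is, the successive reflection at all vertices in an order compatible with the
  arrows.\<close>

definition coxeter_step :: "('i, 'a) pre_digraph \<Rightarrow> ('i \<Rightarrow> int) \<Rightarrow> ('i \<Rightarrow> int) \<Rightarrow> bool" where
  "coxeter_step Q x x' \<longleftrightarrow> (\<forall>y. euler_form Q y x = - euler_form Q x' y)"

lemma euler_form_add_right: "euler_form Q y (\<lambda>i. x i + x' i) = euler_form Q y x + euler_form Q y x'"
  by (simp add: euler_form_def sum.distrib algebra_simps)

lemma euler_form_add_left: "euler_form Q (\<lambda>i. x i + x' i) y = euler_form Q x y + euler_form Q x' y"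
  by (simp add: euler_form_def sum.distrib algebra_simps)

lemma euler_form_scale_left: "euler_form Q (\<lambda>i. k * x i) y = k * euler_form Q x y"
  by (simp add: euler_form_def sum_distrib_left algebra_simps)

lemma euler_form_sum_right:
  "finite J \<Longrightarrow> euler_form Q y (\<lambda>i. \<Sum>j\<in>J. x j i) = (\<Sum>j\<in>J. euler_form Q y (x j))"
  by (induction J rule: finite_induct) (simp_all add: euler_form_add_right, simp add: euler_form_def)

lemma euler_form_sum_left:
  "finite J \<Longrightarrow> euler_form Q (\<lambda>i. \<Sum>j\<in>J. x j i) y = (\<Sum>j\<in>J. euler_form Q (x j) y)"
  by (induction J rule: finite_induct) (simp_all add: euler_form_add_left, simp add: euler_form_def)

lemma euler_form_cong:
  assumes "wf_digraph Q" "\<And>i. i \<in> verts Q \<Longrightarrow> x i = x' i" "\<And>i. i \<in> verts Q \<Longrightarrow> y i = y' i"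
  shows "euler_form Q x y = euler_form Q x' y'"
  unfolding euler_form_def using assms by (simp add: wf_digraph.tail_in_verts wf_digraph.head_in_verts)

lemma sum_by_vertex:
  assumes "finite V" "finite E" "\<And>a. a \<in> E \<Longrightarrow> t a \<in> V"
  shows "(\<Sum>a\<in>E. F (t a) a) = (\<Sum>v\<in>V. \<Sum>a\<in>E. if t a = v then F v a else 0)"
proof -
  have "(\<Sum>v\<in>V. \<Sum>a\<in>E. if t a = v then F v a else 0) = (\<Sum>a\<in>E. \<Sum>v\<in>V. if t a = v then F v a else 0)"
    by (rule sum.swap)
  also have "\<dots> = (\<Sum>a\<in>E. F (t a) a)"
    using assms by (intro sum.cong) auto
  finally show ?thesis ..
qed

text \<open>The sum of \<open>x\<close> over the neighbours of \<open>i\<close>, counted with the multiplicity of the edges.\<close>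

definition neighbour_sum :: "('i, 'a) pre_digraph \<Rightarrow> ('i \<Rightarrow> 'r) \<Rightarrow> 'i \<Rightarrow> 'r::comm_monoid_add" where
  "neighbour_sum Q x i = (\<Sum>a\<in>arcs Q. (if tail Q a = i then x (head Q a) else 0) +
     (if head Q a = i then x (tail Q a) else 0))"

lemma sym_euler_form_unit:
  assumes "fin_digraph Q" "i \<in> verts Q"
  shows "euler_form Q x (\<lambda>j. if j = i then 1 else 0) + euler_form Q (\<lambda>j. if j = i then 1 else 0) x
    = 2 * x i - neighbour_sum Q x i"
proof -
  interpret fin_digraph Q by fact
  have "(\<Sum>a\<in>arcs Q. x (tail Q a) * (if head Q a = i then 1 else 0)) +
      (\<Sum>a\<in>arcs Q. (if tail Q a = i then 1 else 0) * x (head Q a)) = neighbour_sum Q x i"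
    unfolding neighbour_sum_def sum.distrib[symmetric] by (intro sum.cong) auto
  moreover have "(\<Sum>j\<in>verts Q. x j * (if j = i then 1 else 0)) = x i"
    "(\<Sum>j\<in>verts Q. (if j = i then 1 else 0) * x j) = x i"
    using assms(2) sum.delta[of "verts Q" i x] by (simp_all add: if_distrib if_distribR cong: if_cong)
  ultimately show ?thesis unfolding euler_form_def by simp
qed

lemma kernel_neighbour_sum:
  assumes "fin_digraph Q" "x \<in> sym_euler_kernel Q" "i \<in> verts Q"
  shows "neighbour_sum Q x i = 2 * x i"
  using sym_euler_form_unit[OF assms(1,3), of x] assms(2) unfolding sym_euler_kernel_def by simp

lemma sym_euler_form_expand:
  assumes "fin_digraph Q"
  shows "euler_form Q x y + euler_form Q y x = (\<Sum>i\<in>verts Q. (2 * x i - neighbour_sum Q x i) * y i)"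
proof -
  interpret fin_digraph Q by fact
  have t: "(\<Sum>a\<in>arcs Q. y (tail Q a) * x (head Q a)) =
      (\<Sum>i\<in>verts Q. \<Sum>a\<in>arcs Q. if tail Q a = i then y i * x (head Q a) else 0)"
    by (rule sum_by_vertex) auto
  have h: "(\<Sum>a\<in>arcs Q. x (tail Q a) * y (head Q a)) =
      (\<Sum>i\<in>verts Q. \<Sum>a\<in>arcs Q. if head Q a = i then x (tail Q a) * y i else 0)"
    by (rule sum_by_vertex) auto
  have n: "neighbour_sum Q x i * y i = (\<Sum>a\<in>arcs Q. if tail Q a = i then y i * x (head Q a) else 0) +
      (\<Sum>a\<in>arcs Q. if head Q a = i then x (tail Q a) * y i else 0)" for i
    unfolding neighbour_sum_def sum_distrib_right sum.distrib[symmetric]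
    by (intro sum.cong) auto
  show ?thesis
    unfolding euler_form_def t h left_diff_distrib n
    by (simp add: sum.distrib sum_subtractf sum_distrib_left ac_simps)
qed

lemma sym_euler_kernelI:
  assumes "fin_digraph Q" "\<And>i. i \<in> verts Q \<Longrightarrow> neighbour_sum Q x i = 2 * x i"
  shows "x \<in> sym_euler_kernel Q"
  unfolding sym_euler_kernel_def using sym_euler_form_expand[OF assms(1), of x] assms(2) by simp

text \<open>A positive vector in the radical writes the quadratic form as a positive combination of squares,
  one for each arrow.  Hence it is positive semidefinite, and its values bound the numbers that are
  squared.\<close>

lemma euler_form_sum_of_squares:
  fixes x :: "'i \<Rightarrow> int"
  assumes Q: "fin_digraph Q" and \<delta>: "\<delta> \<in> sym_euler_kernel Q" "\<And>i. i \<in> verts Q \<Longrightarrow> \<delta> i > 0"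
  shows "2 * real_of_int (euler_form Q x x) =
    (\<Sum>a\<in>arcs Q. (of_int (\<delta> (head Q a) * x (tail Q a) - \<delta> (tail Q a) * x (head Q a)))\<^sup>2 /
       of_int (\<delta> (tail Q a) * \<delta> (head Q a)))"
proof -
  interpret fin_digraph Q by fact
  define X where "X i = real_of_int (x i)" for i
  define D where "D i = real_of_int (\<delta> i)" for i
  have Dpos: "D i > 0" if "i \<in> verts Q" for i using \<delta>(2)[OF that] by (simp add: D_def)
  have ns: "2 * D i = (\<Sum>a\<in>arcs Q. (if tail Q a = i then D (head Q a) else 0) +
     (if head Q a = i then D (tail Q a) else 0))" if "i \<in> verts Q" for i
  proof -
    have "2 * D i = of_int (neighbour_sum Q \<delta> i)"
      using kernel_neighbour_sum[OF Q \<delta>(1) that] by (simp add: D_def)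
    also have "\<dots> = (\<Sum>a\<in>arcs Q. (if tail Q a = i then D (head Q a) else 0) +
     (if head Q a = i then D (tail Q a) else 0))"
      unfolding neighbour_sum_def D_def of_int_sum by (intro sum.cong refl) simp
    finally show ?thesis .
  qed
  have sq: "2 * (\<Sum>i\<in>verts Q. X i * X i) =
     (\<Sum>a\<in>arcs Q. (X (tail Q a))\<^sup>2 * D (head Q a) / D (tail Q a)) +
     (\<Sum>a\<in>arcs Q. (X (head Q a))\<^sup>2 * D (tail Q a) / D (head Q a))"
  proof -
    have "2 * (X i * X i) = (\<Sum>a\<in>arcs Q. if tail Q a = i then (X i)\<^sup>2 * D (head Q a) / D i else 0) +
       (\<Sum>a\<in>arcs Q. if head Q a = i then (X i)\<^sup>2 * D (tail Q a) / D i else 0)" if "i \<in> verts Q" for i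
    proof -
      have "2 * (X i * X i) = (X i)\<^sup>2 / D i * (2 * D i)"
        using Dpos[OF that] by (simp add: power2_eq_square)
      also have "\<dots> = (X i)\<^sup>2 / D i * (\<Sum>a\<in>arcs Q. (if tail Q a = i then D (head Q a) else 0) +
         (if head Q a = i then D (tail Q a) else 0))"
        using ns[OF that] by simp
      also have "\<dots> = (\<Sum>a\<in>arcs Q. (if tail Q a = i then (X i)\<^sup>2 * D (head Q a) / D i else 0) +
       (if head Q a = i then (X i)\<^sup>2 * D (tail Q a) / D i else 0))"
        unfolding sum_distrib_left by (intro sum.cong) (auto simp: field_simps)
      finally show ?thesis by (simp add: sum.distrib)
    qed
    then show ?thesis
      unfolding sum_distrib_left
      by (subst (1 2) sum_by_vertex[of "verts Q"]) (auto simp: sum.distrib)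
  qed
  have "2 * real_of_int (euler_form Q x x) =
     2 * (\<Sum>i\<in>verts Q. X i * X i) - 2 * (\<Sum>a\<in>arcs Q. X (tail Q a) * X (head Q a))"
    by (simp add: euler_form_def X_def)
  also have "\<dots> = (\<Sum>a\<in>arcs Q. (X (tail Q a))\<^sup>2 * D (head Q a) / D (tail Q a) +
      (X (head Q a))\<^sup>2 * D (tail Q a) / D (head Q a) - 2 * (X (tail Q a) * X (head Q a)))"
    unfolding sq by (simp add: sum.distrib sum_subtractf sum_distrib_left)
  also have "\<dots> = (\<Sum>a\<in>arcs Q. (D (head Q a) * X (tail Q a) - D (tail Q a) * X (head Q a))\<^sup>2 /
      (D (tail Q a) * D (head Q a)))"
  proof (intro sum.cong refl)
    fix a assume "a \<in> arcs Q"
    then have "D (tail Q a) > 0" "D (head Q a) > 0" using Dpos by auto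
    then show "(X (tail Q a))\<^sup>2 * D (head Q a) / D (tail Q a) +
      (X (head Q a))\<^sup>2 * D (tail Q a) / D (head Q a) - 2 * (X (tail Q a) * X (head Q a)) =
      (D (head Q a) * X (tail Q a) - D (tail Q a) * X (head Q a))\<^sup>2 / (D (tail Q a) * D (head Q a))"
      by (simp add: field_simps power2_eq_square)
  qed
  finally show ?thesis by (simp add: X_def D_def)
qed

text \<open>The differences of \<open>x / \<delta>\<close> along the arrows, with denominators cleared.  They determine \<open>x\<close> on
  the vertices up to a multiple of \<open>\<delta>\<close>, because the radical is generated by \<open>\<delta>\<close>.\<close>

definition arc_diff :: "('i, 'a) pre_digraph \<Rightarrow> ('i \<Rightarrow> int) \<Rightarrow> ('i \<Rightarrow> int) \<Rightarrow> 'a \<Rightarrow> int" where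
  "arc_diff Q \<delta> x = (\<lambda>a\<in>arcs Q. \<delta> (head Q a) * x (tail Q a) - \<delta> (tail Q a) * x (head Q a))"

lemma arc_diff_eq_imp:
  assumes Q: "fin_digraph Q" and \<delta>: "is_delta Q \<delta>" and eq: "arc_diff Q \<delta> x = arc_diff Q \<delta> x'"
  shows "\<exists>k. \<forall>i\<in>verts Q. x i = x' i + k * \<delta> i"
proof -
  interpret fin_digraph Q by fact
  define z where "z i = x i - x' i" for i
  have ker: "\<delta> \<in> sym_euler_kernel Q" and pos: "\<And>i. i \<in> verts Q \<Longrightarrow> \<delta> i > 0"
    using \<delta> unfolding is_delta_def by auto
  have z: "\<delta> (head Q a) * z (tail Q a) = \<delta> (tail Q a) * z (head Q a)" if "a \<in> arcs Q" for a
    using fun_cong[OF eq, of a] that by (simp add: arc_diff_def z_def algebra_simps)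
  have "z \<in> sym_euler_kernel Q"
  proof (rule sym_euler_kernelI[OF Q])
    fix i assume i: "i \<in> verts Q"
    have "\<delta> i * neighbour_sum Q z i = z i * neighbour_sum Q \<delta> i"
      unfolding neighbour_sum_def sum_distrib_left
      by (intro sum.cong refl) (use z in \<open>auto simp: algebra_simps\<close>)
    then show "neighbour_sum Q z i = 2 * z i"
      using kernel_neighbour_sum[OF Q ker i] pos[OF i] by simp
  qed
  then obtain k where "\<forall>i\<in>verts Q. z i = k * \<delta> i" using \<delta> unfolding is_delta_def by blast
  then show ?thesis by (intro exI[of _ k]) (auto simp: z_def)
qed

lemma euler_form_delta_delta: "\<delta> \<in> sym_euler_kernel Q \<Longrightarrow> euler_form Q \<delta> \<delta> = 0"
  unfolding sym_euler_kernel_def by (simp, drule spec[of _ \<delta>]) simp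

lemma euler_form_kernel_swap: "\<delta> \<in> sym_euler_kernel Q \<Longrightarrow> euler_form Q x \<delta> = - euler_form Q \<delta> x"
  unfolding sym_euler_kernel_def by (auto simp: eq_neg_iff_add_eq_0 add.commute)

lemma euler_form_nonneg:
  assumes Q: "fin_digraph Q" and \<delta>: "is_delta Q \<delta>"
  shows "euler_form Q x x \<ge> 0"
proof -
  interpret fin_digraph Q by fact
  have "0 \<le> 2 * real_of_int (euler_form Q x x)"
    using \<delta> unfolding is_delta_def
    by (subst euler_form_sum_of_squares[OF Q]) (auto intro!: sum_nonneg divide_nonneg_pos)
  then show ?thesis by simp
qed

lemma euler_form_zero_imp_defect_zero:
  assumes Q: "fin_digraph Q" and \<delta>: "is_delta Q \<delta>" and z: "euler_form Q x x = 0"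
  shows "euler_form Q \<delta> x = 0"
proof -
  interpret fin_digraph Q by fact
  have ker: "\<delta> \<in> sym_euler_kernel Q" and pos: "\<And>i. i \<in> verts Q \<Longrightarrow> \<delta> i > 0"
    using \<delta> unfolding is_delta_def by auto
  let ?s = "\<lambda>a. (real_of_int (\<delta> (head Q a) * x (tail Q a) - \<delta> (tail Q a) * x (head Q a)))\<^sup>2 /
       of_int (\<delta> (tail Q a) * \<delta> (head Q a))"
  have "(\<Sum>a\<in>arcs Q. ?s a) = 0"
    using euler_form_sum_of_squares[OF Q ker pos, of x] z by simp
  moreover have "?s a \<ge> 0" if "a \<in> arcs Q" for a
    using pos that by (intro divide_nonneg_pos) auto
  ultimately have s0: "?s a = 0" if "a \<in> arcs Q" for a
    using that sum_nonneg_eq_0_iff[of "arcs Q" ?s] by auto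
  have "arc_diff Q \<delta> x = arc_diff Q \<delta> (\<lambda>i. 0)"
  proof
    fix a
    show "arc_diff Q \<delta> x a = arc_diff Q \<delta> (\<lambda>i. 0) a"
    proof (cases "a \<in> arcs Q")
      case True
      then have "\<delta> (tail Q a) > 0" "\<delta> (head Q a) > 0" using pos by auto
      with s0[OF True] show ?thesis unfolding arc_diff_def
        by (simp del: of_int_diff of_int_mult) 
    qed (simp add: arc_diff_def)
  qed
  from arc_diff_eq_imp[OF Q \<delta> this] obtain k where "\<forall>i\<in>verts Q. x i = k * \<delta> i" by auto
  then have "euler_form Q x \<delta> = euler_form Q (\<lambda>i. k * \<delta> i) \<delta>"
    by (intro euler_form_cong wf_digraph_axioms) auto
  then have "euler_form Q x \<delta> = 0"
    by (simp add: euler_form_scale_left euler_form_delta_delta[OF ker])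
  then show ?thesis using euler_form_kernel_swap[OF ker, of x] by simp
qed

lemma finite_arc_diff:
  assumes Q: "fin_digraph Q" and \<delta>: "is_delta Q \<delta>"
  shows "finite (arc_diff Q \<delta> ` {x. euler_form Q x x = c})"
proof -
  interpret fin_digraph Q by fact
  have ker: "\<delta> \<in> sym_euler_kernel Q" and pos: "\<And>i. i \<in> verts Q \<Longrightarrow> \<delta> i > 0"
    using \<delta> unfolding is_delta_def by auto
  define m where "m a = 2 * \<bar>c\<bar> * (\<delta> (tail Q a) * \<delta> (head Q a))" for a
  let ?d = "\<lambda>x a. \<delta> (head Q a) * x (tail Q a) - \<delta> (tail Q a) * x (head Q a)"
  have bound: "\<bar>?d x a\<bar> \<le> m a" if c: "euler_form Q x x = c" and a: "a \<in> arcs Q" for x a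
  proof -
    let ?s = "\<lambda>a. (real_of_int (?d x a))\<^sup>2 / of_int (\<delta> (tail Q a) * \<delta> (head Q a))"
    have p: "\<delta> (tail Q a) * \<delta> (head Q a) > 0" using pos a by simp
    have "?s a \<le> (\<Sum>a\<in>arcs Q. ?s a)"
      using a pos by (intro member_le_sum) (auto intro!: divide_nonneg_pos)
    also have "\<dots> = of_int (2 * c)"
      using euler_form_sum_of_squares[OF Q ker pos, of x] c by simp
    finally have "(real_of_int (?d x a))\<^sup>2 \<le> of_int (2 * c) * of_int (\<delta> (tail Q a) * \<delta> (head Q a))"
      using p by (subst (asm) pos_divide_le_eq) (simp_all del: of_int_mult)
    then have "(?d x a)\<^sup>2 \<le> 2 * c * (\<delta> (tail Q a) * \<delta> (head Q a))"
      by (metis of_int_le_iff of_int_mult of_int_power)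
    also have "\<dots> \<le> m a" unfolding m_def using p by (intro mult_right_mono) auto
    finally have "(?d x a)\<^sup>2 \<le> m a" .
    moreover have "\<bar>?d x a\<bar> \<le> (?d x a)\<^sup>2"
    proof (cases "?d x a = 0")
      case False
      then have "\<bar>?d x a\<bar> * 1 \<le> \<bar>?d x a\<bar> * \<bar>?d x a\<bar>" by (intro mult_left_mono) auto
      then show ?thesis by (simp add: power2_eq_square abs_mult_self_eq)
    qed simp
    ultimately show ?thesis by linarith
  qed
  have "arc_diff Q \<delta> ` {x. euler_form Q x x = c} \<subseteq> (\<Pi>\<^sub>E a\<in>arcs Q. {- m a..m a})"
  proof (rule image_subsetI)
    fix x assume "x \<in> {x. euler_form Q x x = c}"
    then have "?d x a \<in> {- m a..m a}" if "a \<in> arcs Q" for a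
      using bound[of x a] that by (simp add: abs_le_iff)
    then show "arc_diff Q \<delta> x \<in> (\<Pi>\<^sub>E a\<in>arcs Q. {- m a..m a})"
      unfolding arc_diff_def by (simp add: PiE_iff)
  qed
  then show ?thesis by (rule finite_subset) (auto intro: finite_PiE)
qed

lemma coxeter_step_form:
  assumes "coxeter_step Q x x'" shows "euler_form Q x' x' = euler_form Q x x"
proof -
  have "euler_form Q x x = - euler_form Q x' x" "euler_form Q x' x = - euler_form Q x' x'"
    using assms unfolding coxeter_step_def by blast+
  then show ?thesis by simp
qed

lemma coxeter_step_defect:
  assumes "coxeter_step Q x x'" "\<delta> \<in> sym_euler_kernel Q"
  shows "euler_form Q \<delta> x' = euler_form Q \<delta> x"
  using assms euler_form_kernel_swap[of \<delta> Q x'] unfolding coxeter_step_def by auto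

lemma no_infinite_coxeter_orbit:
  assumes Q: "fin_digraph Q" and \<delta>: "is_delta Q \<delta>"
    and step: "\<And>n. coxeter_step Q (x n) (x (Suc n))"
    and nonneg: "\<And>n i. i \<in> verts Q \<Longrightarrow> x n i \<ge> 0"
    and pos: "euler_form Q \<delta> (x 0) > 0"
  shows False
proof -
  interpret fin_digraph Q by fact
  have ker: "\<delta> \<in> sym_euler_kernel Q" and dpos: "\<And>i. i \<in> verts Q \<Longrightarrow> \<delta> i > 0"
    using \<delta> unfolding is_delta_def by auto
  have defect: "euler_form Q \<delta> (x n) = euler_form Q \<delta> (x 0)" for n
    by (induction n) (use coxeter_step_defect[OF step ker] in auto)
  have form: "euler_form Q (x n) (x n) = euler_form Q (x 0) (x 0)" for n
    by (induction n) (use coxeter_step_form[OF step] in auto)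
  have "finite (range (\<lambda>n. arc_diff Q \<delta> (x n)))"
    by (rule finite_subset[OF _ finite_arc_diff[OF Q \<delta>, of "euler_form Q (x 0) (x 0)"]]) (use form in auto)
  then obtain n0 where n0: "infinite {n. arc_diff Q \<delta> (x n) = arc_diff Q \<delta> (x n0)}"
    using pigeonhole_infinite[of UNIV "\<lambda>n. arc_diff Q \<delta> (x n)"] by auto
  define N where "N = {n. arc_diff Q \<delta> (x n) = arc_diff Q \<delta> (x n0)}"
  obtain v where v: "v \<in> verts Q"
  proof (cases "verts Q = {}")
    case True
    then have "arcs Q = {}" using tail_in_verts by blast
    with True pos show thesis by (simp add: euler_form_def)
  qed blast
  have decr: "x n' v < x n v" if nn: "n \<in> N" "n' \<in> N" "n < n'" for n n'
  proof -
    obtain k where k: "\<forall>i\<in>verts Q. x n' i = x n i + k * \<delta> i"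
      using arc_diff_eq_imp[OF Q \<delta>, of "x n'" "x n"] nn(1,2) unfolding N_def by auto
    \<comment> \<open>Summing the relations for \<open>x j\<close> and \<open>x (Suc j)\<close> relates \<open>e\<close> to \<open>e + k \<delta>\<close>.\<close>
    define e where "e = (\<lambda>i. \<Sum>j\<in>{n..<n'}. x j i)"
    have de: "euler_form Q \<delta> e = int (n' - n) * euler_form Q \<delta> (x 0)"
    proof -
      have "euler_form Q \<delta> e = (\<Sum>j\<in>{n..<n'}. euler_form Q \<delta> (x j))"
        unfolding e_def by (simp add: euler_form_sum_right)
      also have "\<dots> = (\<Sum>j\<in>{n..<n'}. euler_form Q \<delta> (x 0))"
        by (rule sum.cong[OF refl defect])
      finally show ?thesis by simp
    qed
    have "euler_form Q e e = (\<Sum>j\<in>{n..<n'}. euler_form Q e (x j))"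
      unfolding e_def by (subst euler_form_sum_right) auto
    also have "\<dots> = (\<Sum>j\<in>{n..<n'}. - euler_form Q (x (Suc j)) e)"
      using step unfolding coxeter_step_def by simp
    also have "\<dots> = - euler_form Q (\<lambda>i. \<Sum>j\<in>{n..<n'}. x (Suc j) i) e"
      by (simp add: euler_form_sum_left sum_negf)
    also have "euler_form Q (\<lambda>i. \<Sum>j\<in>{n..<n'}. x (Suc j) i) e = euler_form Q (\<lambda>i. e i + k * \<delta> i) e"
    proof (rule euler_form_cong[OF wf_digraph_axioms])
      fix i assume "i \<in> verts Q"
      have "(\<Sum>j\<in>{n..<n'}. x (Suc j) i) - (\<Sum>j\<in>{n..<n'}. x j i) = x n' i - x n i"
        unfolding sum_subtractf[symmetric] using sum_Suc_diff'[of n n' "\<lambda>j. x j i"] \<open>n < n'\<close> by simp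
      then show "(\<Sum>j\<in>{n..<n'}. x (Suc j) i) = e i + k * \<delta> i"
        using k \<open>i \<in> verts Q\<close> by (simp add: e_def)
    qed simp
    finally have "2 * euler_form Q e e = - k * euler_form Q \<delta> e"
      by (simp add: euler_form_add_left euler_form_scale_left)
    moreover have "euler_form Q e e \<ge> 0" by (rule euler_form_nonneg[OF Q \<delta>])
    moreover have dp: "euler_form Q \<delta> e > 0" using de pos that by simp
    moreover have "euler_form Q e e \<noteq> 0" using dp euler_form_zero_imp_defect_zero[OF Q \<delta>, of e] by auto
    ultimately have "- k * euler_form Q \<delta> e > 0" by linarith
    then have "k < 0" using dp by (simp add: zero_less_mult_iff mult_less_0_iff)
    then have "k * \<delta> v < 0" using dpos[OF v] by (simp add: mult_neg_pos)
    then show ?thesis using k v by simp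
  qed
  \<comment> \<open>A member of the infinite set \<open>N\<close> with minimal entry at \<open>v\<close> contradicts \<open>decr\<close>.\<close>
  define b where "b = (ARG_MIN (\<lambda>n. nat (x n v)) n. n \<in> N)"
  have ne: "n0 \<in> N" by (simp add: N_def)
  have b: "b \<in> N" "\<And>n. n \<in> N \<Longrightarrow> nat (x b v) \<le> nat (x n v)"
    unfolding b_def using arg_min_nat_lemma[of "\<lambda>n. n \<in> N", OF ne, of "\<lambda>n. nat (x n v)"] by auto
  obtain n where "n \<in> N" "b < n" using n0 unfolding N_def[symmetric] infinite_nat_iff_unbounded by blast
  then show False using decr[OF b(1)] b(2)[of n] nonneg[OF v, of n] nonneg[OF v, of b] by force
qed

section \<open>Reflecting linked pairs\<close>

text \<open>\<open>x\<close> is the dimension vector of the family \<open>U\<close> of finite vector spaces.\<close>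

definition dims_of :: "('i, 'a) pre_digraph \<Rightarrow> ('i, 'b, 'a, 'k::{field, finite}) cspaces \<Rightarrow> ('i \<Rightarrow> int) \<Rightarrow> bool" where
  "dims_of Q U x \<longleftrightarrow> (\<forall>i\<in>verts Q. x i \<ge> 0 \<and> card (U i) = card (UNIV :: 'k set) ^ nat (x i))"

text \<open>\<open>x\<close> is the dimension vector of an indecomposable representation that has a nonzero morphism to an
  indecomposable representation of defect zero.  The type argument fixes the coordinate space.\<close>

definition linked_pair :: "('b \<times> 'k::{field, finite}) itself \<Rightarrow> ('i, 'a) pre_digraph \<Rightarrow> ('i \<Rightarrow> int) \<Rightarrow> ('i \<Rightarrow> int) \<Rightarrow> bool" where
  "linked_pair T Q \<delta> x \<longleftrightarrow> (\<exists>(U :: ('i, 'b, 'a, 'k) cspaces) f U' f' y.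
     cindec Q U f \<and> cindec Q U' f' \<and> nonzero_chom Q U f U' f' \<and>
     dims_of Q U x \<and> dims_of Q U' y \<and> euler_form Q \<delta> y = 0)"

text \<open>The effect of the reflection at a source on dimension vectors.\<close>

definition reflect_dim :: "('i, 'a) pre_digraph \<Rightarrow> 'i \<Rightarrow> ('i \<Rightarrow> int) \<Rightarrow> 'i \<Rightarrow> int" where
  "reflect_dim Q i x = x(i := - x i + (\<Sum>a\<in>{a\<in>arcs Q. tail Q a = i}. x (head Q a)))"

lemma card_field_gt_1: "card (UNIV :: 'k::{field, finite} set) > 1"
proof -
  have "card {0, 1::'k} \<le> card (UNIV :: 'k set)" by (rule card_mono) auto
  then show ?thesis by simp
qed

lemma fin_digraph_reflect:
  assumes "fin_digraph Q" "source Q i"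
  shows "fin_digraph (reflect Q i)"
proof -
  interpret fin_digraph Q by fact
  show ?thesis using assms(2) by unfold_locales (auto simp: source_def)
qed

lemma euler_form_reflect:
  assumes Q: "fin_digraph Q" and src: "source Q i" and ker: "\<delta> \<in> sym_euler_kernel Q"
  shows "euler_form (reflect Q i) \<delta> (reflect_dim Q i x) = euler_form Q \<delta> x"
proof -
  interpret fin_digraph Q by fact
  have i: "i \<in> verts Q" "\<And>a. a \<in> arcs Q \<Longrightarrow> head Q a \<noteq> i" using src unfolding source_def by auto
  define A where "A = {a\<in>arcs Q. tail Q a = i}"
  have A: "A \<subseteq> arcs Q" "finite A" "\<And>a. a \<in> A \<Longrightarrow> tail Q a = i" unfolding A_def by auto
  define x' where "x' = reflect_dim Q i x"
  have x'i: "x' i = - x i + (\<Sum>a\<in>A. x (head Q a))" by (simp add: x'_def reflect_dim_def A_def)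
  have x'j: "x' j = x j" if "j \<noteq> i" for j using that by (simp add: x'_def reflect_dim_def)
  have d: "2 * \<delta> i = (\<Sum>a\<in>A. \<delta> (head Q a))"
  proof -
    have "2 * \<delta> i = (\<Sum>a\<in>arcs Q. if tail Q a = i then \<delta> (head Q a) else 0)"
      unfolding kernel_neighbour_sum[OF Q ker i(1), symmetric] neighbour_sum_def
      by (intro sum.cong refl) (use i(2) in auto)
    then show ?thesis by (simp add: A_def sum.inter_filter)
  qed
  have v: "(\<Sum>j\<in>verts Q. \<delta> j * z j) = \<delta> i * z i + (\<Sum>j\<in>verts Q - {i}. \<delta> j * z j)" for z :: "'a \<Rightarrow> int"
    using i(1) by (simp add: sum.remove)
  have e: "(\<Sum>a\<in>arcs Q. F a) = (\<Sum>a\<in>A. F a) + (\<Sum>a\<in>arcs Q - A. F a)" for F :: "'b \<Rightarrow> int"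
    using A sum.subset_diff[of A "arcs Q" F] by simp
  have 1: "(\<Sum>j\<in>verts Q - {i}. \<delta> j * x' j) = (\<Sum>j\<in>verts Q - {i}. \<delta> j * x j)"
    by (intro sum.cong) (auto simp: x'j)
  have 2: "(\<Sum>a\<in>arcs Q - A. \<delta> (tail (reflect Q i) a) * x' (head (reflect Q i) a)) =
     (\<Sum>a\<in>arcs Q - A. \<delta> (tail Q a) * x (head Q a))"
    by (intro sum.cong refl) (use i(2) in \<open>auto simp: A_def x'j\<close>)
  have 3: "(\<Sum>a\<in>A. \<delta> (tail (reflect Q i) a) * x' (head (reflect Q i) a)) = 2 * \<delta> i * x' i"
    unfolding d sum_distrib_right by (intro sum.cong) (auto simp: A_def)
  have 4: "(\<Sum>a\<in>A. \<delta> (tail Q a) * x (head Q a)) = \<delta> i * (\<Sum>a\<in>A. x (head Q a))"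
    unfolding sum_distrib_left by (intro sum.cong) (auto simp: A_def)
  have "euler_form (reflect Q i) \<delta> x' = \<delta> i * x' i + (\<Sum>j\<in>verts Q - {i}. \<delta> j * x j) -
     (2 * \<delta> i * x' i + (\<Sum>a\<in>arcs Q - A. \<delta> (tail Q a) * x (head Q a)))"
    unfolding euler_form_def reflect_simps(1,2) v[of x'] e[of "\<lambda>a. \<delta> (tail (reflect Q i) a) * x' (head (reflect Q i) a)"] 1 2 3 ..
  moreover have "euler_form Q \<delta> x = \<delta> i * x i + (\<Sum>j\<in>verts Q - {i}. \<delta> j * x j) -
     (\<delta> i * (\<Sum>a\<in>A. x (head Q a)) + (\<Sum>a\<in>arcs Q - A. \<delta> (tail Q a) * x (head Q a)))"
    unfolding euler_form_def v[of x] e[of "\<lambda>a. \<delta> (tail Q a) * x (head Q a)"] 4 ..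
  ultimately show ?thesis unfolding x'_def[symmetric] by (simp add: x'i algebra_simps)
qed

lemma dims_of_reflect:
  fixes U :: "('i, 'b, 'a, 'k::{field, finite}) cspaces"
  assumes Q: "fin_digraph Q" and src: "source Q i" and dims: "dims_of Q U x" and cok: "cokernel Q i U f W \<psi>"
  shows "dims_of (reflect Q i) (U(i := W)) (reflect_dim Q i x)"
proof -
  interpret fin_digraph Q by fact
  have i: "i \<in> verts Q" using src unfolding source_def by auto
  define A where "A = {a\<in>arcs Q. tail Q a = i}"
  define q where "q = card (UNIV :: 'k set)"
  have q: "q > 1" unfolding q_def by (rule card_field_gt_1)
  have dx: "x j \<ge> 0" "card (U j) = q ^ nat (x j)" if "j \<in> verts Q" for j
    using dims that unfolding dims_of_def q_def by auto
  have "card W * card (U i) = (\<Prod>a\<in>A. card (U (head Q a)))"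
    using cok unfolding cokernel_def Let_def A_def by blast
  also have "\<dots> = (\<Prod>a\<in>A. q ^ nat (x (head Q a)))"
    by (intro prod.cong refl dx(2)) (auto simp: A_def)
  also have "\<dots> = q ^ (\<Sum>a\<in>A. nat (x (head Q a)))" by (rule power_sum[symmetric])
  finally have eq: "card W * q ^ nat (x i) = q ^ (\<Sum>a\<in>A. nat (x (head Q a)))" using dx(2)[OF i] by simp
  have W: "card W \<ge> 1" using eq q by (cases "card W") auto
  have "q ^ nat (x i) \<le> q ^ (\<Sum>a\<in>A. nat (x (head Q a)))" unfolding eq[symmetric] using W by simp
  then have le: "nat (x i) \<le> (\<Sum>a\<in>A. nat (x (head Q a)))" using q by simp
  have s: "int (\<Sum>a\<in>A. nat (x (head Q a))) = (\<Sum>a\<in>A. x (head Q a))"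
    unfolding of_nat_sum by (intro sum.cong refl) (auto simp: A_def dx(1))
  have "card W * q ^ nat (x i) = q ^ ((\<Sum>a\<in>A. nat (x (head Q a))) - nat (x i)) * q ^ nat (x i)"
    unfolding eq power_add[symmetric] using le by simp
  then have "card W = q ^ ((\<Sum>a\<in>A. nat (x (head Q a))) - nat (x i))" using q by simp
  moreover have "m - nat (x i) = nat (- x i + int m)" "- x i + int m \<ge> 0" if "nat (x i) \<le> m" for m
    using that dx(1)[OF i] by linarith+
  note this[OF le, unfolded s]
  ultimately have "reflect_dim Q i x i \<ge> 0" "card W = q ^ nat (reflect_dim Q i x i)"
    unfolding reflect_dim_def A_def by simp_all
  moreover have "reflect_dim Q i x j = x j" if "j \<noteq> i" for j using that by (simp add: reflect_dim_def)
  ultimately show ?thesis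
    using dx unfolding dims_of_def q_def by simp
qed

lemma cindec_subspace: "cindec Q U f \<Longrightarrow> i \<in> verts Q \<Longrightarrow> fsubspace (U i)"
  unfolding cindec_def crep_def by blast

lemma cindec_nonzero: "cindec Q U f \<Longrightarrow> \<exists>i\<in>verts Q. U i \<noteq> {0}"
  unfolding cindec_def by blast

lemma cindec_arrow: "cindec Q U f \<Longrightarrow> a \<in> arcs Q \<Longrightarrow> v \<in> U (tail Q a) \<Longrightarrow> f a v \<in> U (head Q a)"
  unfolding cindec_def crep_def by blast

lemma chom_additive: "chom Q U f U' f' g \<Longrightarrow> i \<in> verts Q \<Longrightarrow> additive_on (U i) (g i)"
  unfolding chom_def by blast

lemma chom_in: "chom Q U f U' f' g \<Longrightarrow> i \<in> verts Q \<Longrightarrow> v \<in> U i \<Longrightarrow> g i v \<in> U' i"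
  unfolding chom_def by blast

lemma chom_commute:
  "chom Q U f U' f' g \<Longrightarrow> a \<in> arcs Q \<Longrightarrow> v \<in> U (tail Q a) \<Longrightarrow> g (head Q a) (f a v) = f' a (g (tail Q a) v)"
  unfolding chom_def by blast

lemma linked_pair_reflect:
  fixes T :: "('b \<times> 'k::{field, finite}) itself"
  assumes Q: "fin_digraph Q" and src: "source Q i" and ker: "\<delta> \<in> sym_euler_kernel Q"
    and pos: "\<delta> i > 0" and lp: "linked_pair T Q \<delta> x"
  shows "linked_pair T (reflect Q i) \<delta> (reflect_dim Q i x)"
proof -
  interpret fin_digraph Q by fact
  have i: "i \<in> verts Q" "\<And>a. a \<in> arcs Q \<Longrightarrow> head Q a \<noteq> i" using src unfolding source_def by auto
  obtain U :: "('a, 'b, 'c, 'k) cspaces" and f U' f' y where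
    ind: "cindec Q U f" "cindec Q U' f'" and hom: "nonzero_chom Q U f U' f'" and
    dims: "dims_of Q U x" "dims_of Q U' y" and y0: "euler_form Q \<delta> y = 0"
    using lp unfolding linked_pair_def by blast
  have q: "card (UNIV :: 'k set) > 1" by (rule card_field_gt_1)
  have Us: "0 \<in> U j" "0 \<in> U' j" if "j \<in> verts Q" for j
    using fs.subspace_0[OF cindec_subspace[OF ind(1) that]] fs.subspace_0[OF cindec_subspace[OF ind(2) that]]
    by auto
  \<comment> \<open>If the target were concentrated at the source \<open>i\<close>, its defect would be \<open>\<delta> i * y i\<close>.\<close>
  have "\<exists>j\<in>verts Q. j \<noteq> i \<and> U' j \<noteq> {0}"
  proof (rule ccontr)
    assume n: "\<not> ?thesis"
    have yj: "y j = 0" if "j \<in> verts Q" "j \<noteq> i" for j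
    proof -
      have "card (U' j) = 1" using n that by auto
      then have "card (UNIV :: 'k set) ^ nat (y j) = 1" "y j \<ge> 0" using dims(2) that unfolding dims_of_def by auto
      then show ?thesis using q by simp
    qed
    have "(\<Sum>a\<in>arcs Q. \<delta> (tail Q a) * y (head Q a)) = 0"
      by (rule sum.neutral) (use yj i(2) in auto)
    moreover have "(\<Sum>j\<in>verts Q. \<delta> j * y j) = \<delta> i * y i"
      using i(1) yj by (simp add: sum.remove)
    ultimately have "y i = 0" using y0 pos unfolding euler_form_def by simp
    then have "card (U' i) = 1" using dims(2) i(1) unfolding dims_of_def by simp
    then have "U' i = {0}" using Us(2)[OF i(1)] by (auto simp: card_1_singleton_iff)
    moreover obtain j where "j \<in> verts Q" "U' j \<noteq> {0}" using cindec_nonzero[OF ind(2)] by (elim bexE)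
    ultimately show False using n by metis
  qed
  then obtain j' where j': "j' \<in> verts Q" "j' \<noteq> i" "U' j' \<noteq> {0}" by (elim bexE conjE)
  \<comment> \<open>If the domain were concentrated at \<open>i\<close>, its image would lie in the kernel of all arrows from \<open>i\<close>.\<close>
  have "\<exists>j\<in>verts Q. j \<noteq> i \<and> U j \<noteq> {0}"
  proof (rule ccontr)
    assume n: "\<not> ?thesis"
    obtain g where g: "chom Q U f U' f' g" "\<exists>i\<in>verts Q. \<exists>x\<in>U i. g i x \<noteq> 0"
      using hom unfolding nonzero_chom_def by (elim exE conjE)
    have g0: "g j 0 = 0" if "j \<in> verts Q" for j
      by (rule additive_on_zero[OF chom_additive[OF g(1) that] Us(1)[OF that]])
    obtain j v where v: "j \<in> verts Q" "v \<in> U j" "g j v \<noteq> 0" using g(2) by (elim bexE)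
    have ji: "j = i"
    proof (rule ccontr)
      assume "j \<noteq> i"
      then have "U j = {0}" using n v(1) by metis
      then have "v = 0" using v(2) by simp
      then show False using g0[OF v(1)] v(3) by simp
    qed
    have "g i v = 0"
    proof (rule star_injective[OF Q ind(2) src j'])
      show "g i v \<in> U' i" using chom_in[OF g(1) v(1,2)] ji by simp
      fix a assume a: "a \<in> arcs Q" "tail Q a = i"
      have "f a v \<in> U (head Q a)" using cindec_arrow[OF ind(1) a(1)] v(2) ji a(2) by simp
      moreover have "U (head Q a) = {0}" using n i(2)[OF a(1)] a head_in_verts by metis
      ultimately have "f a v = 0" by simp
      moreover have "g (head Q a) (f a v) = f' a (g i v)" using chom_commute[OF g(1) a(1)] v(2) ji a(2) by simp
      ultimately show "f' a (g i v) = 0" using g0 a by simp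
    qed
    then show False using v ji by simp
  qed
  then obtain j where j: "j \<in> verts Q" "j \<noteq> i" "U j \<noteq> {0}" by (elim bexE conjE)
  obtain W \<psi> where cok: "cokernel Q i U f W \<psi>" using reflected_exists[OF Q ind(1) src j] by blast
  obtain W' \<psi>' where cok': "cokernel Q i U' f' W' \<psi>'" using reflected_exists[OF Q ind(2) src j'] by blast
  have "euler_form (reflect Q i) \<delta> (reflect_dim Q i y) = 0"
    using euler_form_reflect[OF Q src ker] y0 by simp
  then show ?thesis
    unfolding linked_pair_def
    using cindec_reflect[OF Q ind(1) src j cok] cindec_reflect[OF Q ind(2) src j' cok']
      nonzero_chom_reflect[OF Q src ind hom j' cok cok'] dims_of_reflect[OF Q src dims(1) cok]
      dims_of_reflect[OF Q src dims(2) cok'] by blast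
qed

lemma linked_pair_cong:
  assumes Q: "fin_digraph Q" and eq: "verts Q' = verts Q" "arcs Q' = arcs Q"
    "\<And>a. a \<in> arcs Q \<Longrightarrow> tail Q' a = tail Q a" "\<And>a. a \<in> arcs Q \<Longrightarrow> head Q' a = head Q a"
    and lp: "linked_pair T Q \<delta> x"
  shows "linked_pair T Q' \<delta> x"
proof -
  have rep: "crep Q' U f = crep Q U f" for U f unfolding crep_def using eq by (simp cong: ball_cong)
  have sub: "csub Q' U f A = csub Q U f A" for U f A unfolding csub_def using eq by (simp cong: ball_cong)
  have ind: "cindec Q' U f = cindec Q U f" for U f unfolding cindec_def ccompl_def rep sub eq(1) ..
  have hom: "chom Q' U f U' f' g = chom Q U f U' f' g" for U f U' f' g
    unfolding chom_def using eq by (simp cong: ball_cong)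
  have dims: "dims_of Q' U y = dims_of Q U y" for U y unfolding dims_of_def eq(1) ..
  have "euler_form Q' \<delta> y = euler_form Q \<delta> y" for y unfolding euler_form_def using eq by simp
  then show ?thesis using lp unfolding linked_pair_def ind nonzero_chom_def hom dims eq(1) by simp
qed

text \<open>The orientation after reflecting once at each vertex of \<open>D\<close>, where \<open>D\<close> is closed under
  predecessors: an arrow inside \<open>D\<close> has been reversed twice, and exactly the arrows leaving \<open>D\<close> are
  reversed.\<close>

definition orient :: "('i, 'a) pre_digraph \<Rightarrow> 'i set \<Rightarrow> ('i, 'a) pre_digraph" where
  "orient Q D = Q\<lparr>tail := \<lambda>a. if tail Q a \<in> D \<and> head Q a \<notin> D then head Q a else tail Q a,
                  head := \<lambda>a. if tail Q a \<in> D \<and> head Q a \<notin> D then tail Q a else head Q a\<rparr>"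

lemma orient_simps [simp]:
  "verts (orient Q D) = verts Q" "arcs (orient Q D) = arcs Q"
  "tail (orient Q D) = (\<lambda>a. if tail Q a \<in> D \<and> head Q a \<notin> D then head Q a else tail Q a)"
  "head (orient Q D) = (\<lambda>a. if tail Q a \<in> D \<and> head Q a \<notin> D then tail Q a else head Q a)"
  by (simp_all add: orient_def)

lemma fin_digraph_orient:
  assumes "fin_digraph Q" shows "fin_digraph (orient Q D)"
proof -
  interpret fin_digraph Q by fact
  show ?thesis by unfold_locales auto
qed

lemma sym_euler_kernel_orient: "sym_euler_kernel (orient Q D) = sym_euler_kernel Q"
proof -
  have "euler_form (orient Q D) d d' + euler_form (orient Q D) d' d = euler_form Q d d' + euler_form Q d' d" for d d'
  proof -
    have "(\<Sum>a\<in>arcs Q. d (tail (orient Q D) a) * d' (head (orient Q D) a)) +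
       (\<Sum>a\<in>arcs Q. d' (tail (orient Q D) a) * d (head (orient Q D) a)) =
      (\<Sum>a\<in>arcs Q. d (tail Q a) * d' (head Q a)) + (\<Sum>a\<in>arcs Q. d' (tail Q a) * d (head Q a))"
      unfolding sum.distrib[symmetric] by (intro sum.cong refl) auto
    then show ?thesis by (simp add: euler_form_def)
  qed
  then show ?thesis by (simp add: sym_euler_kernel_def)
qed

lemma acyclic_quiver_sink:
  assumes Q: "acyclic_quiver Q" and D: "D \<subseteq> verts Q" "D \<noteq> {}"
  shows "\<exists>v\<in>D. \<forall>a\<in>arcs Q. tail Q a = v \<longrightarrow> head Q a \<notin> D"
proof -
  interpret fin_digraph Q using Q unfolding acyclic_quiver_def by blast
  have nc: "\<And>p. \<not> cycle p" using Q unfolding acyclic_quiver_def by blast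
  have fin: "finite (arcs_ends Q)" unfolding arcs_ends_def by simp
  have "acyclic (arcs_ends Q)"
  proof (rule acyclicI, rule allI, rule notI)
    fix u assume "(u, u) \<in> (arcs_ends Q)\<^sup>+"
    then obtain p where "awalk u p u" "p \<noteq> []" using reachable1_awalk by auto
    then have "closed_w p" unfolding closed_w_def by auto
    then show False using closed_w_imp_cycle nc by blast
  qed
  then have "wf ((arcs_ends Q)\<inverse>)" by (rule finite_acyclic_wf_converse[OF fin])
  from wfE_min'[OF this D(2)] obtain z where z: "z \<in> D" "\<And>y. (y, z) \<in> (arcs_ends Q)\<inverse> \<Longrightarrow> y \<notin> D"
    by blast
  have "head Q a \<notin> D" if "a \<in> arcs Q" "tail Q a = z" for a
    using z(2)[of "head Q a"] that by (auto simp: arcs_ends_def arc_to_ends_def image_iff)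
  with z(1) show ?thesis by blast
qed

text \<open>The vertices of \<open>D\<close> are reflected in an order compatible with the arrows.  The equation says that
  \<open>\<langle>e\<^sub>v, x\<rangle> = - \<langle>x', e\<^sub>v\<rangle>\<close> for the unit vector \<open>e\<^sub>v\<close> of a vertex \<open>v\<close> of \<open>D\<close>.\<close>

lemma partial_round:
  assumes Q: "acyclic_quiver Q" and \<delta>: "is_delta Q \<delta>" and lp: "linked_pair T Q \<delta> x"
    and D: "D \<subseteq> verts Q" "\<And>a. a \<in> arcs Q \<Longrightarrow> head Q a \<in> D \<Longrightarrow> tail Q a \<in> D"
  shows "\<exists>x'. linked_pair T (orient Q D) \<delta> x' \<and> (\<forall>v\<in>verts Q - D. x' v = x v) \<and>
    (\<forall>v\<in>D. x v - (\<Sum>a\<in>{a\<in>arcs Q. tail Q a = v}. x (head Q a)) =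
      - (x' v - (\<Sum>a\<in>{a\<in>arcs Q. head Q a = v}. x' (tail Q a))))"
  using D
proof (induction "card D" arbitrary: D)
  case 0
  interpret fin_digraph Q using Q unfolding acyclic_quiver_def by blast
  have "D = {}" using 0 finite_subset[OF 0(2) finite_verts] by simp
  have "linked_pair T (orient Q D) \<delta> x"
    by (rule linked_pair_cong[OF fin_digraph_axioms _ _ _ _ lp]) (simp_all add: \<open>D = {}\<close>)
  then show ?case using \<open>D = {}\<close> by blast
next
  case (Suc n)
  interpret fin_digraph Q using Q unfolding acyclic_quiver_def by blast
  have finD: "finite D" using Suc.prems(1) finite_verts by (rule finite_subset)
  have "D \<noteq> {}" using Suc.hyps(2) by auto
  \<comment> \<open>The last vertex to be reflected is a sink of the subquiver on \<open>D\<close>.\<close>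
  then obtain v where v: "v \<in> D" "\<And>a. a \<in> arcs Q \<Longrightarrow> tail Q a = v \<Longrightarrow> head Q a \<notin> D"
    using acyclic_quiver_sink[OF Q Suc.prems(1)] by blast
  define E where "E = D - {v}"
  have E: "n = card E" "E \<subseteq> verts Q" "D = insert v E" "v \<notin> E"
    using Suc.hyps(2) v(1) finD Suc.prems(1) unfolding E_def by auto
  have cl: "tail Q a \<in> E" if "a \<in> arcs Q" "head Q a \<in> D" for a
    using Suc.prems(2)[OF that] v(2)[OF that(1)] that(2) unfolding E_def by auto
  have "\<And>a. a \<in> arcs Q \<Longrightarrow> head Q a \<in> E \<Longrightarrow> tail Q a \<in> E" using cl E(3) by blast
  from Suc.hyps(1)[OF E(1,2) this] obtain x0 where x0: "linked_pair T (orient Q E) \<delta> x0"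
    "\<forall>v\<in>verts Q - E. x0 v = x v"
    "\<forall>v\<in>E. x v - (\<Sum>a\<in>{a\<in>arcs Q. tail Q a = v}. x (head Q a)) =
      - (x0 v - (\<Sum>a\<in>{a\<in>arcs Q. head Q a = v}. x0 (tail Q a)))" by blast
  have vV: "v \<in> verts Q" using v(1) Suc.prems(1) by blast
  have vD: "head Q a \<noteq> v" if "a \<in> arcs Q" "tail Q a \<notin> E" for a
    using cl[OF that(1)] that(2) v(1) by auto
  let ?O = "orient Q E"
  have fO: "fin_digraph ?O" by (rule fin_digraph_orient[OF fin_digraph_axioms])
  have src: "source ?O v"
    unfolding source_def using vV vD E(4) by auto
  have ker: "\<delta> \<in> sym_euler_kernel ?O" and pos: "\<delta> v > 0"
    using \<delta> vV unfolding is_delta_def sym_euler_kernel_orient by auto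
  define x' where "x' = reflect_dim ?O v x0"
  have "linked_pair T (reflect ?O v) \<delta> x'"
    unfolding x'_def by (rule linked_pair_reflect[OF fO src ker pos x0(1)])
  then have lp': "linked_pair T (orient Q D) \<delta> x'"
  proof (rule linked_pair_cong[OF fin_digraph_reflect[OF fO src], rotated -1])
    fix a assume "a \<in> arcs (reflect ?O v)"
    then have a: "a \<in> arcs Q" by simp
    have "tail Q a = v \<Longrightarrow> head Q a \<notin> D" "head Q a \<in> D \<Longrightarrow> tail Q a \<in> E"
      using v(2) cl a by auto
    then show "tail (orient Q D) a = tail (reflect ?O v) a" "head (orient Q D) a = head (reflect ?O v) a"
      using E(3,4) by auto
  qed simp_all
  have x'v: "x' v = - x v + ((\<Sum>a\<in>{a\<in>arcs Q. tail Q a = v}. x (head Q a)) +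
      (\<Sum>a\<in>{a\<in>arcs Q. head Q a = v}. x' (tail Q a)))"
  proof -
    have "{a\<in>arcs ?O. tail ?O a = v} = {a\<in>arcs Q. tail Q a = v} \<union> {a\<in>arcs Q. head Q a = v}"
      using cl v E(3,4) by auto
    moreover have "{a\<in>arcs Q. tail Q a = v} \<inter> {a\<in>arcs Q. head Q a = v} = {}"
    proof -
      have False if "a \<in> arcs Q" "tail Q a = v" "head Q a = v" for a using v(2)[OF that(1,2)] v(1) that(3) by simp
      then show ?thesis by blast
    qed
    ultimately have "(\<Sum>a\<in>{a\<in>arcs ?O. tail ?O a = v}. x0 (head ?O a)) =
      (\<Sum>a\<in>{a\<in>arcs Q. tail Q a = v}. x0 (head ?O a)) + (\<Sum>a\<in>{a\<in>arcs Q. head Q a = v}. x0 (head ?O a))"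
      by (simp only:) (rule sum.union_disjoint, auto)
    also have "(\<Sum>a\<in>{a\<in>arcs Q. tail Q a = v}. x0 (head ?O a)) = (\<Sum>a\<in>{a\<in>arcs Q. tail Q a = v}. x (head Q a))"
      using v(2) E(3,4) x0(2) by (intro sum.cong refl) auto
    also have "(\<Sum>a\<in>{a\<in>arcs Q. head Q a = v}. x0 (head ?O a)) = (\<Sum>a\<in>{a\<in>arcs Q. head Q a = v}. x' (tail Q a))"
    proof (intro sum.cong refl)
      fix a assume a: "a \<in> {a\<in>arcs Q. head Q a = v}"
      then have "tail Q a \<in> E" using cl v(1) by auto
      then show "x0 (head ?O a) = x' (tail Q a)" using a E(4) by (auto simp: x'_def reflect_dim_def)
    qed
    finally show ?thesis using x0(2) vV E(4) unfolding x'_def by (simp add: reflect_dim_def)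
  qed
  have x'w: "x' w = x0 w" if "w \<noteq> v" for w using that by (simp add: x'_def reflect_dim_def)
  have "x w - (\<Sum>a\<in>{a\<in>arcs Q. tail Q a = w}. x (head Q a)) =
      - (x' w - (\<Sum>a\<in>{a\<in>arcs Q. head Q a = w}. x' (tail Q a)))" if "w \<in> D" for w
  proof (cases "w = v")
    case True
    then show ?thesis using x'v by simp
  next
    case False
    then have "w \<in> E" using that E(3) by simp
    moreover have "(\<Sum>a\<in>{a\<in>arcs Q. head Q a = w}. x' (tail Q a)) = (\<Sum>a\<in>{a\<in>arcs Q. head Q a = w}. x0 (tail Q a))"
    proof (intro sum.cong refl x'w)
      fix a assume "a \<in> {a\<in>arcs Q. head Q a = w}"
      then have "tail Q a \<in> E" using cl that by auto
      then show "tail Q a \<noteq> v" using E(4) by auto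
    qed
    ultimately show ?thesis using x0(3) x'w[OF False] by simp
  qed
  moreover have "\<forall>w\<in>verts Q - D. x' w = x w" using x0(2) x'w E(3) by auto
  ultimately show ?case using lp' by blast
qed

text \<open>Reflecting once at each vertex restores the orientation of \<open>Q\<close>.\<close>

lemma full_round:
  assumes Q: "acyclic_quiver Q" and \<delta>: "is_delta Q \<delta>" and lp: "linked_pair T Q \<delta> x"
  shows "\<exists>x'. linked_pair T Q \<delta> x' \<and> coxeter_step Q x x'"
proof -
  interpret fin_digraph Q using Q unfolding acyclic_quiver_def by blast
  obtain x' where x': "linked_pair T (orient Q (verts Q)) \<delta> x'"
    "\<forall>v\<in>verts Q. x v - (\<Sum>a\<in>{a\<in>arcs Q. tail Q a = v}. x (head Q a)) =
      - (x' v - (\<Sum>a\<in>{a\<in>arcs Q. head Q a = v}. x' (tail Q a)))"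
    using partial_round[OF Q \<delta> lp, of "verts Q"] by auto
  have "linked_pair T Q \<delta> x'"
    by (rule linked_pair_cong[OF fin_digraph_orient[OF fin_digraph_axioms] _ _ _ _ x'(1)]) auto
  moreover have "euler_form Q y x = - euler_form Q x' y" for y
  proof -
    have l: "euler_form Q y x = (\<Sum>v\<in>verts Q. y v * (x v - (\<Sum>a\<in>{a\<in>arcs Q. tail Q a = v}. x (head Q a))))"
    proof -
      have "(\<Sum>a\<in>arcs Q. y (tail Q a) * x (head Q a)) =
        (\<Sum>v\<in>verts Q. \<Sum>a\<in>arcs Q. if tail Q a = v then y v * x (head Q a) else 0)"
        by (rule sum_by_vertex) auto
      also have "\<dots> = (\<Sum>v\<in>verts Q. y v * (\<Sum>a\<in>{a\<in>arcs Q. tail Q a = v}. x (head Q a)))"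
        by (simp add: sum_distrib_left sum.inter_filter) (intro sum.cong refl, simp)
      finally show ?thesis by (simp add: euler_form_def right_diff_distrib sum_subtractf)
    qed
    have r: "euler_form Q x' y = (\<Sum>v\<in>verts Q. y v * (x' v - (\<Sum>a\<in>{a\<in>arcs Q. head Q a = v}. x' (tail Q a))))"
    proof -
      have "(\<Sum>a\<in>arcs Q. x' (tail Q a) * y (head Q a)) =
        (\<Sum>v\<in>verts Q. \<Sum>a\<in>arcs Q. if head Q a = v then x' (tail Q a) * y v else 0)"
        by (rule sum_by_vertex) auto
      also have "\<dots> = (\<Sum>v\<in>verts Q. y v * (\<Sum>a\<in>{a\<in>arcs Q. head Q a = v}. x' (tail Q a)))"
        by (simp add: sum_distrib_left sum.inter_filter) (intro sum.cong refl, simp)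
      finally show ?thesis by (simp add: euler_form_def right_diff_distrib sum_subtractf mult.commute)
    qed
    show ?thesis unfolding l r sum_negf[symmetric] using x'(2)
      by (intro sum.cong refl) (simp add: right_diff_distrib)
  qed
  ultimately show ?thesis unfolding coxeter_step_def by blast
qed

lemma linked_pair_defect_nonpos:
  assumes Q: "acyclic_quiver Q" and \<delta>: "is_delta Q \<delta>" and lp: "linked_pair T Q \<delta> x"
  shows "euler_form Q \<delta> x \<le> 0"
proof (rule ccontr)
  assume pos: "\<not> ?thesis"
  have "\<exists>X. \<forall>n. (linked_pair T Q \<delta> (X n) \<and> (n = 0 \<longrightarrow> X n = x)) \<and> coxeter_step Q (X n) (X (Suc n))"
    by (rule dependent_nat_choice) (use lp full_round[OF Q \<delta>] in auto)
  then obtain X where X: "\<And>n. linked_pair T Q \<delta> (X n)" "X 0 = x" "\<And>n. coxeter_step Q (X n) (X (Suc n))"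
    by blast
  have "X n i \<ge> 0" if "i \<in> verts Q" for n i
    using X(1)[of n] that unfolding linked_pair_def dims_of_def by blast
  moreover have "fin_digraph Q" using Q unfolding acyclic_quiver_def by blast
  ultimately show False using no_infinite_coxeter_orbit[OF _ \<delta>, of X] X(2,3) pos by auto
qed

section \<open>Coordinates for representations\<close>

lemma subspace_class_ring_iff:
  assumes "vectorspace (class_ring :: 'k::field ring) V"
  shows "VectorSpace.subspace (class_ring :: 'k ring) W V \<longleftrightarrow> W \<subseteq> carrier V \<and> \<zero>\<^bsub>V\<^esub> \<in> W \<and>
    (\<forall>v\<in>W. \<forall>w\<in>W. v \<oplus>\<^bsub>V\<^esub> w \<in> W) \<and> (\<forall>c. \<forall>v\<in>W. c \<odot>\<^bsub>V\<^esub> v \<in> W)"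
  using assms unfolding VectorSpace.subspace_def submodule_def
  by (auto simp: vectorspace_def)

text \<open>\<open>\<beta>\<close> is an injective linear map from \<open>V\<close> to a function space.\<close>

definition is_coordinates :: "('k::field, 'v) module \<Rightarrow> ('v \<Rightarrow> 'x \<Rightarrow> 'k) \<Rightarrow> bool" where
  "is_coordinates V \<beta> \<longleftrightarrow> inj_on \<beta> (carrier V) \<and>
     (\<forall>v\<in>carrier V. \<forall>w\<in>carrier V. \<beta> (v \<oplus>\<^bsub>V\<^esub> w) = \<beta> v + \<beta> w) \<and>
     (\<forall>c. \<forall>v\<in>carrier V. \<beta> (c \<odot>\<^bsub>V\<^esub> v) = scl c (\<beta> v))"

lemma coordinates_exist:
  fixes V :: "('k::{field, finite}, 'v) module"
  assumes V: "vectorspace class_ring V" and fd: "vectorspace.fin_dim class_ring V"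
  shows "\<exists>\<beta> :: 'v \<Rightarrow> 'v \<times> 'a list \<Rightarrow> 'k. is_coordinates V \<beta>"
    and "finite (carrier V)"
    and "card (carrier V) = card (UNIV :: 'k set) ^ vectorspace.dim class_ring V"
proof -
  interpret V: vectorspace class_ring V by fact
  obtain B where B: "finite B" "V.basis B" using V.finite_basis_exists[OF fd] by blast
  have BV: "B \<subseteq> carrier V" using B(2) unfolding V.basis_def by blast
  define L where "L a = V.lincomb a B" for a
  have crit: "\<exists>!a. a \<in> B \<rightarrow>\<^sub>E UNIV \<and> L a = v" if "v \<in> carrier V" for v
    using V.basis_criterion[OF B(1) BV] B(2) that unfolding L_def by simp
  have L_in: "L a \<in> carrier V" for a
    unfolding L_def by (rule V.lincomb_closed[OF BV]) simp
  have bij: "bij_betw L (B \<rightarrow>\<^sub>E UNIV) (carrier V)"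
    unfolding bij_betw_def
  proof
    show "inj_on L (B \<rightarrow>\<^sub>E UNIV)" using crit L_in by (intro inj_onI) blast
    show "L ` (B \<rightarrow>\<^sub>E UNIV) = carrier V" using crit L_in by (auto simp: image_iff) metis
  qed
  have "finite (B \<rightarrow>\<^sub>E (UNIV :: 'k set))" using B(1) by (simp add: finite_PiE)
  then show "finite (carrier V)" using bij_betw_finite[OF bij] by simp
  have "card (carrier V) = card (B \<rightarrow>\<^sub>E (UNIV :: 'k set))" using bij_betw_same_card[OF bij] by simp
  then show "card (carrier V) = card (UNIV :: 'k set) ^ vectorspace.dim class_ring V"
    using V.dim_basis[OF B] B(1) by (simp add: card_PiE)
  define co where "co v = (THE a. a \<in> B \<rightarrow>\<^sub>E UNIV \<and> L a = v)" for v
  have co: "co v \<in> B \<rightarrow>\<^sub>E UNIV" "L (co v) = v" if "v \<in> carrier V" for v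
    using theI'[OF crit[OF that]] unfolding co_def by blast+
  have L_co: "co (L a) b = a b" if "b \<in> B" for a b
  proof -
    have "L (restrict a B) = L a" unfolding L_def
      by (rule V.lincomb_cong[OF refl BV]) simp_all
    moreover have "restrict a B \<in> B \<rightarrow>\<^sub>E UNIV" by simp
    ultimately have "co (L a) = restrict a B" using crit[OF L_in[of a]] co[OF L_in[of a]] by blast
    then show ?thesis using that by simp
  qed
  define \<beta> :: "'v \<Rightarrow> 'v \<times> 'a list \<Rightarrow> 'k"
    where "\<beta> v = (\<lambda>(b, l). if b \<in> B \<and> l = [] then co v b else 0)" for v
  have "inj_on \<beta> (carrier V)"
  proof (rule inj_onI)
    fix v w assume vw: "v \<in> carrier V" "w \<in> carrier V" "\<beta> v = \<beta> w"
    have "co v b = co w b" if "b \<in> B" for b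
      using fun_cong[OF vw(3), of "(b, [])"] that by (simp add: \<beta>_def)
    then have "co v = co w" using co(1)[OF vw(1)] co(1)[OF vw(2)] by (intro PiE_ext)
    then show "v = w" using co(2) vw by metis
  qed
  moreover have "\<beta> (v \<oplus>\<^bsub>V\<^esub> w) = \<beta> v + \<beta> w" if "v \<in> carrier V" "w \<in> carrier V" for v w
  proof -
    have "L (\<lambda>b. co v b + co w b) = v \<oplus>\<^bsub>V\<^esub> w"
      using V.lincomb_sum[OF B(1) BV, of "co v" "co w"] co(2) that unfolding L_def by simp
    then have "co (v \<oplus>\<^bsub>V\<^esub> w) b = co v b + co w b" if "b \<in> B" for b using L_co[OF that] by metis
    then show ?thesis by (auto simp: \<beta>_def fun_eq_iff)
  qed
  moreover have "\<beta> (c \<odot>\<^bsub>V\<^esub> v) = scl c (\<beta> v)" if "v \<in> carrier V" for c v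
  proof -
    have "L (\<lambda>b. c * co v b) = c \<odot>\<^bsub>V\<^esub> v"
      using V.lincomb_smult[OF BV, of "co v" c] co(2) that unfolding L_def by simp
    then have "co (c \<odot>\<^bsub>V\<^esub> v) b = c * co v b" if "b \<in> B" for b using L_co[OF that] by metis
    then show ?thesis by (auto simp: \<beta>_def scl_def fun_eq_iff)
  qed
  ultimately show "\<exists>\<beta> :: 'v \<Rightarrow> 'v \<times> 'a list \<Rightarrow> 'k. is_coordinates V \<beta>"
    unfolding is_coordinates_def by blast
qed

lemma is_coordinates_zero:
  assumes "vectorspace class_ring V" "is_coordinates V \<beta>"
  shows "\<beta> \<zero>\<^bsub>V\<^esub> = 0"
proof -
  interpret V: vectorspace class_ring V by fact
  have "\<beta> \<zero>\<^bsub>V\<^esub> + \<beta> \<zero>\<^bsub>V\<^esub> = \<beta> \<zero>\<^bsub>V\<^esub>"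
    using assms(2) V.M.zero_closed V.M.l_zero[OF V.M.zero_closed] unfolding is_coordinates_def by metis
  then show ?thesis by simp
qed

lemma fsubspace_coordinates:
  assumes V: "vectorspace class_ring V" and \<beta>: "is_coordinates V \<beta>"
    and W: "VectorSpace.subspace class_ring W V"
  shows "fsubspace (\<beta> ` W)"
proof -
  interpret V: vectorspace class_ring V by fact
  note W = W[unfolded subspace_class_ring_iff[OF V]]
  show ?thesis
    unfolding fs.subspace_def
  proof (intro conjI ballI allI)
    show "0 \<in> \<beta> ` W" using is_coordinates_zero[OF V \<beta>] W by force
    fix x y assume "x \<in> \<beta> ` W" "y \<in> \<beta> ` W"
    then obtain v w where vw: "v \<in> W" "x = \<beta> v" "w \<in> W" "y = \<beta> w" by blast
    then have "x + y = \<beta> (v \<oplus>\<^bsub>V\<^esub> w)" using \<beta> W unfolding is_coordinates_def by (simp add: subset_eq)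
    then show "x + y \<in> \<beta> ` W" using vw W by simp
  next
    fix c x assume "x \<in> \<beta> ` W"
    then obtain v where v: "v \<in> W" "x = \<beta> v" by blast
    then have "scl c x = \<beta> (c \<odot>\<^bsub>V\<^esub> v)" using \<beta> W unfolding is_coordinates_def by (simp add: subset_eq)
    then show "scl c x \<in> \<beta> ` W" using v W by simp
  qed
qed

lemma subspace_coordinates_preimage:
  assumes V: "vectorspace class_ring V" and \<beta>: "is_coordinates V \<beta>" and A: "fsubspace A"
  shows "VectorSpace.subspace class_ring {v\<in>carrier V. \<beta> v \<in> A} V"
proof -
  interpret V: vectorspace class_ring V by fact
  have "\<beta> (v \<oplus>\<^bsub>V\<^esub> w) = \<beta> v + \<beta> w" "\<beta> (c \<odot>\<^bsub>V\<^esub> v) = scl c (\<beta> v)"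
    if "v \<in> carrier V" "w \<in> carrier V" for v w c
    using \<beta> that unfolding is_coordinates_def by blast+
  then show ?thesis
    unfolding subspace_class_ring_iff[OF V]
    using is_coordinates_zero[OF V \<beta>] A by (auto simp: fs.subspace_def)
qed

lemma is_repD:
  assumes "is_rep Q M"
  shows "i \<in> verts Q \<Longrightarrow> vectorspace class_ring (rspace M i)"
    and "i \<in> verts Q \<Longrightarrow> vectorspace.fin_dim class_ring (rspace M i)"
    and "a \<in> arcs Q \<Longrightarrow> v \<in> carrier (rspace M (tail Q a)) \<Longrightarrow> rmap M a v \<in> carrier (rspace M (head Q a))"
    and "a \<in> arcs Q \<Longrightarrow> v \<in> carrier (rspace M (tail Q a)) \<Longrightarrow> w \<in> carrier (rspace M (tail Q a)) \<Longrightarrow>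
      rmap M a (v \<oplus>\<^bsub>rspace M (tail Q a)\<^esub> w) = rmap M a v \<oplus>\<^bsub>rspace M (head Q a)\<^esub> rmap M a w"
    and "a \<in> arcs Q \<Longrightarrow> v \<in> carrier (rspace M (tail Q a)) \<Longrightarrow>
      rmap M a (c \<odot>\<^bsub>rspace M (tail Q a)\<^esub> v) = c \<odot>\<^bsub>rspace M (head Q a)\<^esub> rmap M a v"
  using assms unfolding is_rep_def LinearCombinations.module_hom_def by (auto simp: Pi_iff)

lemma set_add_iff: "x \<in> H <+>\<^bsub>G\<^esub> K \<longleftrightarrow> (\<exists>h\<in>H. \<exists>k\<in>K. x = h \<oplus>\<^bsub>G\<^esub> k)"
  by (auto simp: set_add_def set_mult_def)

text \<open>An indecomposable representation has an indecomposable copy in coordinates: the vectors are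
  expanded in bases of the spaces, whose elements serve as labels.\<close>

lemma indecomposable_coordinates:
  fixes M :: "('i, 'a, 'k::{field, finite}, 'v) quiver_rep"
  assumes Q: "fin_digraph Q" and ind: "indecomposable Q M"
  shows "\<exists>(\<beta> :: 'i \<Rightarrow> 'v \<Rightarrow> 'v \<times> 'a list \<Rightarrow> 'k) f. (\<forall>i\<in>verts Q. is_coordinates (rspace M i) (\<beta> i)) \<and>
    cindec Q (\<lambda>i. \<beta> i ` carrier (rspace M i)) f \<and>
    dims_of Q (\<lambda>i. \<beta> i ` carrier (rspace M i)) (dimv M) \<and>
    (\<forall>a\<in>arcs Q. \<forall>v\<in>carrier (rspace M (tail Q a)). f a (\<beta> (tail Q a) v) = \<beta> (head Q a) (rmap M a v))"
proof -
  interpret fin_digraph Q by fact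
  have M: "is_rep Q M" using ind unfolding indecomposable_def by blast
  note vs = is_repD(1)[OF M]
  let ?C = "\<lambda>i. carrier (rspace M i)"
  have "\<forall>i\<in>verts Q. \<exists>\<beta> :: 'v \<Rightarrow> 'v \<times> 'a list \<Rightarrow> 'k. is_coordinates (rspace M i) \<beta>"
    using coordinates_exist(1)[OF is_repD(1,2)[OF M]] by blast
  then obtain \<beta> :: "'i \<Rightarrow> 'v \<Rightarrow> 'v \<times> 'a list \<Rightarrow> 'k" where \<beta>: "\<And>i. i \<in> verts Q \<Longrightarrow> is_coordinates (rspace M i) (\<beta> i)"
    by metis
  have inj: "inj_on (\<beta> i) (?C i)" if "i \<in> verts Q" for i using \<beta>[OF that] unfolding is_coordinates_def by blast
  have badd: "\<beta> i (v \<oplus>\<^bsub>rspace M i\<^esub> w) = \<beta> i v + \<beta> i w" if "i \<in> verts Q" "v \<in> ?C i" "w \<in> ?C i" for i v w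
    using \<beta>[OF that(1)] that(2,3) unfolding is_coordinates_def by blast
  have bscl: "\<beta> i (c \<odot>\<^bsub>rspace M i\<^esub> v) = scl c (\<beta> i v)" if "i \<in> verts Q" "v \<in> ?C i" for i c v
    using \<beta>[OF that(1)] that(2) unfolding is_coordinates_def by blast
  have b0: "\<beta> i \<zero>\<^bsub>rspace M i\<^esub> = 0" if "i \<in> verts Q" for i
    by (rule is_coordinates_zero[OF vs[OF that] \<beta>[OF that]])
  have zero: "\<zero>\<^bsub>rspace M i\<^esub> \<in> ?C i" if "i \<in> verts Q" for i
  proof -
    interpret vectorspace class_ring "rspace M i" by (rule vs[OF that])
    show ?thesis by simp
  qed
  define U where "U i = \<beta> i ` ?C i" for i
  define f where "f a w = \<beta> (head Q a) (rmap M a (inv_into (?C (tail Q a)) (\<beta> (tail Q a)) w))" for a w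
  have f: "f a (\<beta> (tail Q a) v) = \<beta> (head Q a) (rmap M a v)" if "a \<in> arcs Q" "v \<in> ?C (tail Q a)" for a v
    using inj that by (simp add: f_def)
  have full: "VectorSpace.subspace class_ring (?C i) (rspace M i)" if "i \<in> verts Q" for i
  proof -
    interpret vectorspace class_ring "rspace M i" by (rule vs[OF that])
    show ?thesis unfolding subspace_class_ring_iff[OF vs[OF that]] by auto
  qed
  have rep: "crep Q U f"
    unfolding crep_def
  proof (intro conjI ballI)
    fix i assume i: "i \<in> verts Q"
    show "fsubspace (U i)" unfolding U_def by (rule fsubspace_coordinates[OF vs[OF i] \<beta>[OF i] full[OF i]])
    show "finite (U i)" unfolding U_def using coordinates_exist(2)[OF is_repD(1,2)[OF M i]] by simp
  next
    fix a assume a: "a \<in> arcs Q"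
    show "f a ` U (tail Q a) \<subseteq> U (head Q a)"
      unfolding U_def using f[OF a] is_repD(3)[OF M a] by auto
    have t: "tail Q a \<in> verts Q" "head Q a \<in> verts Q" using a by auto
    interpret T: vectorspace class_ring "rspace M (tail Q a)" by (rule vs[OF t(1)])
    show "lin_on (U (tail Q a)) (f a)"
      unfolding lin_on_def additive_on_def U_def
    proof (intro conjI ballI allI)
      fix x y assume "x \<in> \<beta> (tail Q a) ` ?C (tail Q a)" "y \<in> \<beta> (tail Q a) ` ?C (tail Q a)"
      then obtain v w where vw: "v \<in> ?C (tail Q a)" "x = \<beta> (tail Q a) v" "w \<in> ?C (tail Q a)" "y = \<beta> (tail Q a) w"
        by blast
      have "f a (x + y) = f a (\<beta> (tail Q a) (v \<oplus>\<^bsub>rspace M (tail Q a)\<^esub> w))"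
        using vw badd[OF t(1)] by simp
      also have "\<dots> = \<beta> (head Q a) (rmap M a v \<oplus>\<^bsub>rspace M (head Q a)\<^esub> rmap M a w)"
        using f[OF a] vw is_repD(4)[OF M a] by simp
      also have "\<dots> = f a x + f a y"
        using badd[OF t(2)] f[OF a] vw is_repD(3)[OF M a] by simp
      finally show "f a (x + y) = f a x + f a y" .
    next
      fix c x assume "x \<in> \<beta> (tail Q a) ` ?C (tail Q a)"
      then obtain v where v: "v \<in> ?C (tail Q a)" "x = \<beta> (tail Q a) v" by blast
      have "f a (scl c x) = f a (\<beta> (tail Q a) (c \<odot>\<^bsub>rspace M (tail Q a)\<^esub> v))"
        using v bscl[OF t(1)] by simp
      also have "\<dots> = \<beta> (head Q a) (c \<odot>\<^bsub>rspace M (head Q a)\<^esub> rmap M a v)"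
        using f[OF a] v is_repD(5)[OF M a] by simp
      also have "\<dots> = scl c (f a x)"
        using bscl[OF t(2)] f[OF a] v is_repD(3)[OF M a] by simp
      finally show "f a (scl c x) = scl c (f a x)" .
    qed
  qed
  have nz: "\<exists>i\<in>verts Q. U i \<noteq> {0}"
  proof -
    obtain i where i: "i \<in> verts Q" "?C i \<noteq> {\<zero>\<^bsub>rspace M i\<^esub>}"
      using ind unfolding indecomposable_def zero_rep_def by blast
    then obtain v where v: "v \<in> ?C i" "v \<noteq> \<zero>\<^bsub>rspace M i\<^esub>" using zero[OF i(1)] by blast
    have "\<beta> i v \<noteq> \<beta> i \<zero>\<^bsub>rspace M i\<^esub>" using inj_onD[OF inj[OF i(1)]] v zero[OF i(1)] by blast
    then have "\<beta> i v \<noteq> 0" using b0[OF i(1)] by simp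
    then have "U i \<noteq> {0}" unfolding U_def using v(1) by blast
    then show ?thesis using i(1) by blast
  qed
  define pre where "pre A = (\<lambda>i\<in>verts Q. {v\<in>?C i. \<beta> i v \<in> A i})" for A
  have subrep: "is_subrep Q M (pre A)" if A: "csub Q U f A" for A
    unfolding is_subrep_def
  proof (intro conjI ballI)
    show "pre A \<in> extensional (verts Q)" by (simp add: pre_def)
    fix i assume i: "i \<in> verts Q"
    have "fsubspace (A i)" using A i unfolding csub_def by blast
    then show "VectorSpace.subspace class_ring (pre A i) (rspace M i)"
      using subspace_coordinates_preimage[OF vs[OF i] \<beta>[OF i]] i by (simp add: pre_def)
  next
    fix a assume a: "a \<in> arcs Q"
    then have t: "tail Q a \<in> verts Q" "head Q a \<in> verts Q" by auto
    show "rmap M a ` pre A (tail Q a) \<subseteq> pre A (head Q a)"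
    proof (rule image_subsetI)
      fix v assume "v \<in> pre A (tail Q a)"
      then have v: "v \<in> ?C (tail Q a)" "\<beta> (tail Q a) v \<in> A (tail Q a)" using t by (simp_all add: pre_def)
      have "f a ` A (tail Q a) \<subseteq> A (head Q a)" using A a unfolding csub_def by blast
      then have "f a (\<beta> (tail Q a) v) \<in> A (head Q a)" using v(2) by blast
      then show "rmap M a v \<in> pre A (head Q a)" using f[OF a v(1)] is_repD(3)[OF M a v(1)] t by (simp add: pre_def)
    qed
  qed
  have preI: "A i = \<beta> i ` pre A i" if "csub Q U f A" "i \<in> verts Q" for A i
  proof -
    have "A i \<subseteq> U i" using that unfolding csub_def by blast
    then show ?thesis using that(2) unfolding U_def by (auto simp: pre_def)
  qed
  have "(\<forall>i\<in>verts Q. A i = {0}) \<or> (\<forall>i\<in>verts Q. B i = {0})" if AB: "ccompl Q U f A B" for A B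
  proof -
    have sub: "csub Q U f A" "csub Q U f B" using AB unfolding ccompl_def by blast+
    have "complementary Q M (pre A) (pre B)"
      unfolding complementary_def
    proof (intro conjI ballI subrep sub)
      fix i assume i: "i \<in> verts Q"
      have AB': "A i \<inter> B i = {0}" "\<And>x. x \<in> U i \<Longrightarrow> \<exists>a\<in>A i. \<exists>b\<in>B i. x = a + b"
        using AB i unfolding ccompl_def by blast+
      show "pre A i \<inter> pre B i = {\<zero>\<^bsub>rspace M i\<^esub>}"
      proof
        show "{\<zero>\<^bsub>rspace M i\<^esub>} \<subseteq> pre A i \<inter> pre B i"
          using AB'(1) b0[OF i] zero[OF i] i by (auto simp: pre_def)
        show "pre A i \<inter> pre B i \<subseteq> {\<zero>\<^bsub>rspace M i\<^esub>}"
        proof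
          fix v assume "v \<in> pre A i \<inter> pre B i"
          then have v: "v \<in> ?C i" "\<beta> i v \<in> A i \<inter> B i" using i by (auto simp: pre_def)
          then have "\<beta> i v = \<beta> i \<zero>\<^bsub>rspace M i\<^esub>" using AB'(1) b0[OF i] by auto
          then show "v \<in> {\<zero>\<^bsub>rspace M i\<^esub>}" using inj_onD[OF inj[OF i] _ v(1) zero[OF i]] by simp
        qed
      qed
      interpret V: vectorspace class_ring "rspace M i" by (rule vs[OF i])
      show "pre A i <+>\<^bsub>rspace M i\<^esub> pre B i = ?C i"
      proof
        show "pre A i <+>\<^bsub>rspace M i\<^esub> pre B i \<subseteq> ?C i"
          using i by (auto simp: set_add_iff pre_def)
        show "?C i \<subseteq> pre A i <+>\<^bsub>rspace M i\<^esub> pre B i"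
        proof
          fix v assume v: "v \<in> ?C i"
          then obtain a b where "a \<in> A i" "b \<in> B i" "\<beta> i v = a + b" using AB'(2) unfolding U_def by blast
          moreover obtain x y where xy: "x \<in> pre A i" "a = \<beta> i x" "y \<in> pre B i" "b = \<beta> i y"
            using preI[OF sub(1) i] preI[OF sub(2) i] calculation(1,2) by blast
          moreover have "x \<in> ?C i" "y \<in> ?C i" using xy i by (auto simp: pre_def)
          ultimately have "\<beta> i v = \<beta> i (x \<oplus>\<^bsub>rspace M i\<^esub> y)" "x \<oplus>\<^bsub>rspace M i\<^esub> y \<in> ?C i"
            using badd[OF i] by simp_all
          then have "v = x \<oplus>\<^bsub>rspace M i\<^esub> y" using inj_onD[OF inj[OF i]] v by blast
          then show "v \<in> pre A i <+>\<^bsub>rspace M i\<^esub> pre B i" using xy by (auto simp: set_add_iff)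
        qed
      qed
    qed
    then have "pre A = zero_sub Q M \<or> pre B = zero_sub Q M" using ind unfolding indecomposable_def by blast
    then show ?thesis
      using preI[OF sub(1)] preI[OF sub(2)] b0 by (auto simp: zero_sub_def)
  qed
  then have "cindec Q U f" using rep nz unfolding cindec_def by blast
  moreover have "dims_of Q U (dimv M)"
    unfolding dims_of_def
  proof (intro ballI conjI)
    fix i assume i: "i \<in> verts Q"
    show "0 \<le> dimv M i" by (simp add: dimv_def)
    have "card (U i) = card (?C i)" unfolding U_def by (rule card_image[OF inj[OF i]])
    then show "card (U i) = card (UNIV :: 'k set) ^ nat (dimv M i)"
      using coordinates_exist(3)[OF is_repD(1,2)[OF M i]] by (simp add: dimv_def)
  qed
  ultimately show ?thesis using \<beta> f unfolding U_def by blast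
qed

lemma hom_positive_to_zero_defect:
  fixes S Y :: "('i, 'a, 'k::{field, finite}, 'v) quiver_rep"
  assumes Q: "acyclic_quiver Q" and \<delta>: "is_delta Q \<delta>"
    and S: "indecomposable Q S" "euler_form Q \<delta> (dimv S) > 0"
    and Y: "indecomposable Q Y" "euler_form Q \<delta> (dimv Y) = 0"
    and g: "\<And>i v. i \<in> verts Q \<Longrightarrow> v \<in> carrier (rspace S i) \<Longrightarrow> g i v \<in> carrier (rspace Y i)"
      "\<And>i v w. i \<in> verts Q \<Longrightarrow> v \<in> carrier (rspace S i) \<Longrightarrow> w \<in> carrier (rspace S i) \<Longrightarrow>
        g i (v \<oplus>\<^bsub>rspace S i\<^esub> w) = g i v \<oplus>\<^bsub>rspace Y i\<^esub> g i w"
      "\<And>a v. a \<in> arcs Q \<Longrightarrow> v \<in> carrier (rspace S (tail Q a)) \<Longrightarrow>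
        g (head Q a) (rmap S a v) = rmap Y a (g (tail Q a) v)"
    and v: "i \<in> verts Q" "v \<in> carrier (rspace S i)"
  shows "g i v = \<zero>\<^bsub>rspace Y i\<^esub>"
proof (rule ccontr)
  assume nz: "g i v \<noteq> \<zero>\<^bsub>rspace Y i\<^esub>"
  interpret fin_digraph Q using Q unfolding acyclic_quiver_def by blast
  have rep: "is_rep Q S" "is_rep Q Y" using S Y unfolding indecomposable_def by blast+
  obtain \<beta> :: "'i \<Rightarrow> 'v \<Rightarrow> 'v \<times> 'a list \<Rightarrow> 'k" and f where
    \<beta>: "\<forall>i\<in>verts Q. is_coordinates (rspace S i) (\<beta> i)" and
    U: "cindec Q (\<lambda>i. \<beta> i ` carrier (rspace S i)) f"
       "dims_of Q (\<lambda>i. \<beta> i ` carrier (rspace S i)) (dimv S)" and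
    f: "\<forall>a\<in>arcs Q. \<forall>v\<in>carrier (rspace S (tail Q a)). f a (\<beta> (tail Q a) v) = \<beta> (head Q a) (rmap S a v)"
    using indecomposable_coordinates[OF fin_digraph_axioms S(1)] by blast
  obtain \<beta>' :: "'i \<Rightarrow> 'v \<Rightarrow> 'v \<times> 'a list \<Rightarrow> 'k" and f' where
    \<beta>': "\<forall>i\<in>verts Q. is_coordinates (rspace Y i) (\<beta>' i)" and
    U': "cindec Q (\<lambda>i. \<beta>' i ` carrier (rspace Y i)) f'"
       "dims_of Q (\<lambda>i. \<beta>' i ` carrier (rspace Y i)) (dimv Y)" and
    f': "\<forall>a\<in>arcs Q. \<forall>v\<in>carrier (rspace Y (tail Q a)). f' a (\<beta>' (tail Q a) v) = \<beta>' (head Q a) (rmap Y a v)"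
    using indecomposable_coordinates[OF fin_digraph_axioms Y(1)] by blast
  define h where "h j w = \<beta>' j (g j (inv_into (carrier (rspace S j)) (\<beta> j) w))" for j w
  have h: "h j (\<beta> j u) = \<beta>' j (g j u)" if "j \<in> verts Q" "u \<in> carrier (rspace S j)" for j u
    using \<beta> that unfolding h_def is_coordinates_def by (simp add: inv_into_f_f)
  have "chom Q (\<lambda>i. \<beta> i ` carrier (rspace S i)) f (\<lambda>i. \<beta>' i ` carrier (rspace Y i)) f' h"
    unfolding chom_def
  proof (intro conjI ballI)
    fix j assume j: "j \<in> verts Q"
    interpret vectorspace class_ring "rspace S j" by (rule is_repD(1)[OF rep(1) j])
    show "additive_on (\<beta> j ` carrier (rspace S j)) (h j)"
      unfolding additive_on_def
    proof (intro ballI)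
      fix x y assume "x \<in> \<beta> j ` carrier (rspace S j)" "y \<in> \<beta> j ` carrier (rspace S j)"
      then obtain u w where uw: "u \<in> carrier (rspace S j)" "x = \<beta> j u" "w \<in> carrier (rspace S j)" "y = \<beta> j w"
        by blast
      have "x + y = \<beta> j (u \<oplus>\<^bsub>rspace S j\<^esub> w)" using \<beta> j uw unfolding is_coordinates_def by simp
      then have "h j (x + y) = \<beta>' j (g j u \<oplus>\<^bsub>rspace Y j\<^esub> g j w)" using h[OF j] uw g(2)[OF j] by simp
      also have "\<dots> = \<beta>' j (g j u) + \<beta>' j (g j w)"
        using \<beta>' j g(1)[OF j uw(1)] g(1)[OF j uw(3)] unfolding is_coordinates_def by simp
      finally show "h j (x + y) = h j x + h j y" using h[OF j] uw by simp
    qed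
    show "h j ` \<beta> j ` carrier (rspace S j) \<subseteq> \<beta>' j ` carrier (rspace Y j)"
      using h[OF j] g(1)[OF j] by auto
  next
    fix a x assume a: "a \<in> arcs Q" and "x \<in> \<beta> (tail Q a) ` carrier (rspace S (tail Q a))"
    then obtain u where u: "u \<in> carrier (rspace S (tail Q a))" "x = \<beta> (tail Q a) u" by blast
    have t: "tail Q a \<in> verts Q" "head Q a \<in> verts Q" using a by auto
    have "h (head Q a) (f a x) = \<beta>' (head Q a) (g (head Q a) (rmap S a u))"
      using f a u h[OF t(2)] is_repD(3)[OF rep(1) a] by simp
    also have "\<dots> = f' a (\<beta>' (tail Q a) (g (tail Q a) u))"
      using g(3)[OF a u(1)] f' a g(1)[OF t(1) u(1)] by simp
    finally show "h (head Q a) (f a x) = f' a (h (tail Q a) x)" using h[OF t(1)] u by simp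
  qed
  moreover have "h i (\<beta> i v) \<noteq> 0"
  proof -
    interpret Yi: vectorspace class_ring "rspace Y i" by (rule is_repD(1)[OF rep(2) v(1)])
    have "\<beta>' i (g i v) \<noteq> \<beta>' i \<zero>\<^bsub>rspace Y i\<^esub>"
      using \<beta>' v(1) g(1)[OF v] nz unfolding is_coordinates_def inj_on_def by blast
    then show ?thesis using h[OF v] is_coordinates_zero[OF Yi.vectorspace_axioms, of "\<beta>' i"] \<beta>' v(1) by simp
  qed
  ultimately have "nonzero_chom Q (\<lambda>i. \<beta> i ` carrier (rspace S i)) f (\<lambda>i. \<beta>' i ` carrier (rspace Y i)) f'"
    unfolding nonzero_chom_def using v by (intro exI[of _ h] conjI bexI[of _ i] bexI[of _ "\<beta> i v"]) auto
  then have "linked_pair TYPE('v \<times> 'k) Q \<delta> (dimv S)"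
    unfolding linked_pair_def using U U' Y(2) by blast
  then show False using linked_pair_defect_nonpos[OF Q \<delta>] S(2) by force
qed

section \<open>Decomposition into indecomposable summands\<close>

lemma subspace_uminus:
  assumes V: "vectorspace (class_ring :: 'k::field ring) V" and W: "VectorSpace.subspace (class_ring :: 'k ring) W V"
    and w: "w \<in> W"
  shows "\<ominus>\<^bsub>V\<^esub> w \<in> W"
proof -
  interpret V: vectorspace class_ring V by fact
  note W = W[unfolded subspace_class_ring_iff[OF V]]
  have "w \<in> carrier V" using W w by blast
  then have "\<ominus>\<^bsub>V\<^esub> w = (- 1) \<odot>\<^bsub>V\<^esub> w" using V.smult_minus_1[of w] by (simp add: class_ring_simps)
  then show ?thesis using W w by simp
qed

lemma subspace_vectorspace:
  assumes "vectorspace (class_ring :: 'k::field ring) V" "VectorSpace.subspace (class_ring :: 'k ring) W V"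
  shows "vectorspace (class_ring :: 'k ring) (V\<lparr>carrier := W\<rparr>)"
  using vectorspace.subspace_is_vs[OF assms] .

lemma fin_dim_of_finite:
  assumes "vectorspace (class_ring :: 'k::field ring) V" and fin: "finite (carrier V)"
  shows "vectorspace.fin_dim (class_ring :: 'k ring) V"
proof -
  interpret V: vectorspace class_ring V by fact
  have "V.span (carrier V) = carrier V"
    using V.in_own_span[of "carrier V"] V.span_is_subset2[of "carrier V"] by blast
  then show ?thesis unfolding V.fin_dim_def using fin by blast
qed

lemma subspace_direct_sum_card:
  assumes V: "vectorspace (class_ring :: 'k::field ring) V"
    and Z: "VectorSpace.subspace (class_ring :: 'k ring) Z V" and Z': "VectorSpace.subspace (class_ring :: 'k ring) Z' V"
    and int: "Z \<inter> Z' = {\<zero>\<^bsub>V\<^esub>}"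
  shows "card (Z <+>\<^bsub>V\<^esub> Z') = card Z * card Z'"
proof -
  interpret V: vectorspace class_ring V by fact
  have sub: "Z \<subseteq> carrier V" "Z' \<subseteq> carrier V"
    using Z Z' unfolding subspace_class_ring_iff[OF V] by blast+
  have "bij_betw (\<lambda>(z, z'). z \<oplus>\<^bsub>V\<^esub> z') (Z \<times> Z') (Z <+>\<^bsub>V\<^esub> Z')"
    unfolding bij_betw_def
  proof
    show "(\<lambda>(z, z'). z \<oplus>\<^bsub>V\<^esub> z') ` (Z \<times> Z') = Z <+>\<^bsub>V\<^esub> Z'" by (auto simp: set_add_iff) blast
    show "inj_on (\<lambda>(z, z'). z \<oplus>\<^bsub>V\<^esub> z') (Z \<times> Z')"
    proof (rule inj_onI, clarify)
      fix z z' y y' assume *: "z \<in> Z" "z' \<in> Z'" "y \<in> Z" "y' \<in> Z'" "z \<oplus>\<^bsub>V\<^esub> z' = y \<oplus>\<^bsub>V\<^esub> y'"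
      have c: "z \<in> carrier V" "z' \<in> carrier V" "y \<in> carrier V" "y' \<in> carrier V" using * sub by auto
      let ?d = "z \<oplus>\<^bsub>V\<^esub> (\<ominus>\<^bsub>V\<^esub> y)"
      have "?d = y' \<oplus>\<^bsub>V\<^esub> (\<ominus>\<^bsub>V\<^esub> z')"
      proof -
        have "?d = (z \<oplus>\<^bsub>V\<^esub> z') \<oplus>\<^bsub>V\<^esub> (\<ominus>\<^bsub>V\<^esub> z' \<oplus>\<^bsub>V\<^esub> (\<ominus>\<^bsub>V\<^esub> y))"
          using c by (simp add: V.M.a_assoc V.M.r_neg1 V.M.r_neg2)
        also have "\<dots> = (y' \<oplus>\<^bsub>V\<^esub> y) \<oplus>\<^bsub>V\<^esub> (\<ominus>\<^bsub>V\<^esub> y \<oplus>\<^bsub>V\<^esub> (\<ominus>\<^bsub>V\<^esub> z'))"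
          using c *(5) by (simp add: V.M.a_comm)
        also have "\<dots> = y' \<oplus>\<^bsub>V\<^esub> (\<ominus>\<^bsub>V\<^esub> z')"
          using c by (simp add: V.M.a_assoc V.M.r_neg1 V.M.r_neg2)
        finally show ?thesis .
      qed
      moreover have "?d \<in> Z" "y' \<oplus>\<^bsub>V\<^esub> (\<ominus>\<^bsub>V\<^esub> z') \<in> Z'"
        using * subspace_uminus[OF V Z *(3)] subspace_uminus[OF V Z' *(2)] Z Z'
        unfolding subspace_class_ring_iff[OF V] by blast+
      ultimately have "?d = \<zero>\<^bsub>V\<^esub>" "y' \<oplus>\<^bsub>V\<^esub> (\<ominus>\<^bsub>V\<^esub> z') = \<zero>\<^bsub>V\<^esub>" using int by auto
      then show "z = y \<and> z' = y'" using c V.M.minus_equality V.M.minus_minus V.M.a_comm V.M.a_inv_closed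
        by metis
    qed
  qed
  from bij_betw_same_card[OF this] show ?thesis by (simp add: card_cartesian_product)
qed

lemma set_add_carrier_update [simp]: "H <+>\<^bsub>V\<lparr>carrier := X\<rparr>\<^esub> K = H <+>\<^bsub>V\<^esub> K"
  by (auto simp: set_add_iff)

text \<open>From \<open>V = X \<oplus> Y\<close> and \<open>X = Z \<oplus> Z'\<close> it follows that \<open>Z\<close> has the complement \<open>Z' + Y\<close> in \<open>V\<close>.\<close>

lemma direct_sum_trans:
  assumes V: "vectorspace (class_ring :: 'k::field ring) V"
    and X: "VectorSpace.subspace (class_ring :: 'k ring) X V" and Y: "VectorSpace.subspace (class_ring :: 'k ring) Y V"
    and XY: "X \<inter> Y = {\<zero>\<^bsub>V\<^esub>}" "X <+>\<^bsub>V\<^esub> Y = carrier V"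
    and Z: "VectorSpace.subspace (class_ring :: 'k ring) Z (V\<lparr>carrier := X\<rparr>)"
    and Z': "VectorSpace.subspace (class_ring :: 'k ring) Z' (V\<lparr>carrier := X\<rparr>)"
    and ZZ: "Z \<inter> Z' = {\<zero>\<^bsub>V\<^esub>}" "Z <+>\<^bsub>V\<^esub> Z' = X"
  shows "VectorSpace.subspace (class_ring :: 'k ring) Z V"
    and "VectorSpace.subspace (class_ring :: 'k ring) (Z' <+>\<^bsub>V\<^esub> Y) V"
    and "Z \<inter> (Z' <+>\<^bsub>V\<^esub> Y) = {\<zero>\<^bsub>V\<^esub>}" "Z <+>\<^bsub>V\<^esub> (Z' <+>\<^bsub>V\<^esub> Y) = carrier V"
proof -
  interpret V: vectorspace class_ring V by fact
  note X' = X[unfolded subspace_class_ring_iff[OF V]] and Y' = Y[unfolded subspace_class_ring_iff[OF V]]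
  have VX: "vectorspace (class_ring :: 'k ring) (V\<lparr>carrier := X\<rparr>)" by (rule subspace_vectorspace[OF V X])
  have Zi: "W \<subseteq> X \<and> VectorSpace.subspace (class_ring :: 'k ring) W V"
    if "VectorSpace.subspace (class_ring :: 'k ring) W (V\<lparr>carrier := X\<rparr>)" for W
    using that X' unfolding subspace_class_ring_iff[OF VX] subspace_class_ring_iff[OF V] by auto
  show ZV: "VectorSpace.subspace (class_ring :: 'k ring) Z V" using Zi[OF Z] by blast
  have Z'V: "VectorSpace.subspace (class_ring :: 'k ring) Z' V" using Zi[OF Z'] by blast
  note Zs = ZV[unfolded subspace_class_ring_iff[OF V]] and Z's = Z'V[unfolded subspace_class_ring_iff[OF V]]
  have ZX: "Z \<subseteq> X" "Z' \<subseteq> X" using Zi Z Z' by blast+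
  show "VectorSpace.subspace (class_ring :: 'k ring) (Z' <+>\<^bsub>V\<^esub> Y) V"
    unfolding subspace_class_ring_iff[OF V]
  proof (intro conjI ballI allI)
    show "Z' <+>\<^bsub>V\<^esub> Y \<subseteq> carrier V"
    proof
      fix v assume "v \<in> Z' <+>\<^bsub>V\<^esub> Y"
      then obtain z' y where z: "z' \<in> Z'" "y \<in> Y" "v = z' \<oplus>\<^bsub>V\<^esub> y" by (auto simp: set_add_iff)
      then have "z' \<in> carrier V" "y \<in> carrier V" using Z's Y' by blast+
      then show "v \<in> carrier V" using z(3) by simp
    qed
    show "\<zero>\<^bsub>V\<^esub> \<in> Z' <+>\<^bsub>V\<^esub> Y" using Z's Y' V.M.l_zero[OF V.M.zero_closed] by (metis set_add_iff)
  next
    fix v w assume "v \<in> Z' <+>\<^bsub>V\<^esub> Y" "w \<in> Z' <+>\<^bsub>V\<^esub> Y"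
    then obtain a b c d where *: "a \<in> Z'" "b \<in> Y" "v = a \<oplus>\<^bsub>V\<^esub> b" "c \<in> Z'" "d \<in> Y" "w = c \<oplus>\<^bsub>V\<^esub> d"
      by (auto simp: set_add_iff)
    have cc: "a \<in> carrier V" "b \<in> carrier V" "c \<in> carrier V" "d \<in> carrier V" using * Z's Y' by auto
    have "v \<oplus>\<^bsub>V\<^esub> w = (a \<oplus>\<^bsub>V\<^esub> c) \<oplus>\<^bsub>V\<^esub> (b \<oplus>\<^bsub>V\<^esub> d)" using * cc by (simp add: V.M.a_ac)
    then show "v \<oplus>\<^bsub>V\<^esub> w \<in> Z' <+>\<^bsub>V\<^esub> Y" using * Z's Y' unfolding set_add_iff by blast
  next
    fix c v assume "v \<in> Z' <+>\<^bsub>V\<^esub> Y"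
    then obtain a b where *: "a \<in> Z'" "b \<in> Y" "v = a \<oplus>\<^bsub>V\<^esub> b" by (auto simp: set_add_iff)
    then have "c \<odot>\<^bsub>V\<^esub> v = (c \<odot>\<^bsub>V\<^esub> a) \<oplus>\<^bsub>V\<^esub> (c \<odot>\<^bsub>V\<^esub> b)"
      using V.smult_r_distr[of c a b] Z's Y' by (auto simp: subset_eq)
    then show "c \<odot>\<^bsub>V\<^esub> v \<in> Z' <+>\<^bsub>V\<^esub> Y" using * Z's Y' unfolding set_add_iff by blast
  qed
  show "Z \<inter> (Z' <+>\<^bsub>V\<^esub> Y) = {\<zero>\<^bsub>V\<^esub>}"
  proof
    show "{\<zero>\<^bsub>V\<^esub>} \<subseteq> Z \<inter> (Z' <+>\<^bsub>V\<^esub> Y)"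
    proof -
      have "\<zero>\<^bsub>V\<^esub> \<in> Z" "\<zero>\<^bsub>V\<^esub> \<in> Z'" "\<zero>\<^bsub>V\<^esub> \<in> Y" using Zs Z's Y' by blast+
      moreover have "\<zero>\<^bsub>V\<^esub> = \<zero>\<^bsub>V\<^esub> \<oplus>\<^bsub>V\<^esub> \<zero>\<^bsub>V\<^esub>" using V.M.l_zero[OF V.M.zero_closed] by simp
      ultimately have "\<zero>\<^bsub>V\<^esub> \<in> Z' <+>\<^bsub>V\<^esub> Y" unfolding set_add_iff by blast
      then show ?thesis using \<open>\<zero>\<^bsub>V\<^esub> \<in> Z\<close> by blast
    qed
    show "Z \<inter> (Z' <+>\<^bsub>V\<^esub> Y) \<subseteq> {\<zero>\<^bsub>V\<^esub>}"
    proof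
      fix z assume "z \<in> Z \<inter> (Z' <+>\<^bsub>V\<^esub> Y)"
      then obtain z' y where *: "z \<in> Z" "z' \<in> Z'" "y \<in> Y" "z = z' \<oplus>\<^bsub>V\<^esub> y" by (auto simp: set_add_iff)
      have cc: "z' \<in> carrier V" "y \<in> carrier V" using * Z's Y' by auto
      have "y = (\<ominus>\<^bsub>V\<^esub> z') \<oplus>\<^bsub>V\<^esub> z" using * cc by (simp add: V.M.r_neg1)
      moreover have "\<ominus>\<^bsub>V\<^esub> z' \<in> X" using subspace_uminus[OF V Z'V *(2)] ZX by blast
      ultimately have "y \<in> X" using * ZX X' by blast
      then have "y = \<zero>\<^bsub>V\<^esub>" using XY(1) *(3) by blast
      then have "z = z'" using * cc by simp
      then show "z \<in> {\<zero>\<^bsub>V\<^esub>}" using * ZZ(1) by blast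
    qed
  qed
  show "Z <+>\<^bsub>V\<^esub> (Z' <+>\<^bsub>V\<^esub> Y) = carrier V"
  proof
    show "Z <+>\<^bsub>V\<^esub> (Z' <+>\<^bsub>V\<^esub> Y) \<subseteq> carrier V"
    proof
      fix v assume "v \<in> Z <+>\<^bsub>V\<^esub> (Z' <+>\<^bsub>V\<^esub> Y)"
      then obtain z z' y where z: "z \<in> Z" "z' \<in> Z'" "y \<in> Y" "v = z \<oplus>\<^bsub>V\<^esub> (z' \<oplus>\<^bsub>V\<^esub> y)" by (auto simp: set_add_iff)
      then have "z \<in> carrier V" "z' \<in> carrier V" "y \<in> carrier V" using Zs Z's Y' by blast+
      then show "v \<in> carrier V" using z(4) by simp
    qed
    show "carrier V \<subseteq> Z <+>\<^bsub>V\<^esub> (Z' <+>\<^bsub>V\<^esub> Y)"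
    proof
      fix v assume "v \<in> carrier V"
      then obtain x y where xy: "x \<in> X" "y \<in> Y" "v = x \<oplus>\<^bsub>V\<^esub> y" unfolding XY(2)[symmetric] set_add_iff by blast
      then obtain z z' where z: "z \<in> Z" "z' \<in> Z'" "x = z \<oplus>\<^bsub>V\<^esub> z'" unfolding ZZ(2)[symmetric] set_add_iff by blast
      have "z \<in> carrier V" "z' \<in> carrier V" "y \<in> carrier V" using xy z Zs Z's Y' by auto
      then have "v = z \<oplus>\<^bsub>V\<^esub> (z' \<oplus>\<^bsub>V\<^esub> y)" using xy z by (simp add: V.M.a_assoc)
      moreover have "z' \<oplus>\<^bsub>V\<^esub> y \<in> Z' <+>\<^bsub>V\<^esub> Y" using xy z unfolding set_add_iff by blast
      ultimately show "v \<in> Z <+>\<^bsub>V\<^esub> (Z' <+>\<^bsub>V\<^esub> Y)" using z(1) set_add_iff[of v V Z] by blast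
    qed
  qed
qed

lemma subspace_subset: "VectorSpace.subspace K W V \<Longrightarrow> W \<subseteq> carrier V"
  unfolding VectorSpace.subspace_def submodule_def by blast

lemma is_subrep_subspace:
  "is_subrep Q M X \<Longrightarrow> i \<in> verts Q \<Longrightarrow> VectorSpace.subspace class_ring (X i) (rspace M i)"
  unfolding is_subrep_def by blast

lemmas is_subrep_subset = subspace_subset[OF is_subrep_subspace]

lemma is_subrep_arrow: "is_subrep Q M X \<Longrightarrow> a \<in> arcs Q \<Longrightarrow> rmap M a ` X (tail Q a) \<subseteq> X (head Q a)"
  unfolding is_subrep_def by blast

lemma complementaryD:
  assumes "complementary Q M X Y"
  shows "is_subrep Q M X" "is_subrep Q M Y"
    and "i \<in> verts Q \<Longrightarrow> X i \<inter> Y i = {\<zero>\<^bsub>rspace M i\<^esub>}"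
    and "i \<in> verts Q \<Longrightarrow> X i <+>\<^bsub>rspace M i\<^esub> Y i = carrier (rspace M i)"
  using assms unfolding complementary_def by simp_all

lemma complementary_commute:
  assumes M: "is_rep Q M" and XY: "complementary Q M X Y"
  shows "complementary Q M Y X"
proof -
  have "X i <+>\<^bsub>rspace M i\<^esub> Y i = Y i <+>\<^bsub>rspace M i\<^esub> X i" if i: "i \<in> verts Q" for i
  proof -
    interpret V: vectorspace class_ring "rspace M i" by (rule is_repD(1)[OF M i])
    have sub: "X i \<subseteq> carrier (rspace M i)" "Y i \<subseteq> carrier (rspace M i)"
      using is_subrep_subset[OF _ i] complementaryD(1,2)[OF XY] by blast+
    have comm: "x \<oplus>\<^bsub>rspace M i\<^esub> y = y \<oplus>\<^bsub>rspace M i\<^esub> x" if "x \<in> X i" "y \<in> Y i" for x y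
      using V.M.a_comm that sub by blast
    have "v \<in> X i <+>\<^bsub>rspace M i\<^esub> Y i \<longleftrightarrow> v \<in> Y i <+>\<^bsub>rspace M i\<^esub> X i" for v
      unfolding set_add_iff using comm by metis
    then show ?thesis by blast
  qed
  then show ?thesis
    unfolding complementary_def using complementaryD[OF XY] by (simp add: Int_commute)
qed

lemma sub_rep_sub_rep: "sub_rep (sub_rep M X) Z = sub_rep M Z"
  by (simp add: sub_rep_def)

lemma zero_sub_sub_rep: "zero_sub Q (sub_rep M X) = zero_sub Q M"
  by (simp add: zero_sub_def sub_rep_def)

lemma is_rep_sub_rep:
  fixes M :: "('i, 'a, 'k::{field, finite}, 'v) quiver_rep"
  assumes M: "is_rep Q M" and X: "is_subrep Q M X" and Q: "fin_digraph Q"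
  shows "is_rep Q (sub_rep M X)"
proof -
  interpret fin_digraph Q by fact
  have sub: "VectorSpace.subspace class_ring (X i) (rspace M i)" "X i \<subseteq> carrier (rspace M i)" if "i \<in> verts Q" for i
    using is_subrep_subspace[OF X that] is_subrep_subset[OF X that] by blast+
  have vs: "vectorspace class_ring ((rspace M i)\<lparr>carrier := X i\<rparr>)" if "i \<in> verts Q" for i
    by (rule subspace_vectorspace[OF is_repD(1)[OF M that] sub(1)[OF that]])
  have fin: "finite (X i)" if "i \<in> verts Q" for i
    using finite_subset[OF sub(2)[OF that] coordinates_exist(2)[OF is_repD(1,2)[OF M that]]] .
  have "vectorspace.fin_dim class_ring ((rspace M i)\<lparr>carrier := X i\<rparr>)" if "i \<in> verts Q" for i
    using fin_dim_of_finite[OF vs[OF that]] fin[OF that] by simp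
  moreover have "rmap M a \<in> LinearCombinations.module_hom class_ring
      ((rspace M (tail Q a))\<lparr>carrier := X (tail Q a)\<rparr>) ((rspace M (head Q a))\<lparr>carrier := X (head Q a)\<rparr>)"
    if a: "a \<in> arcs Q" for a
  proof -
    have "rmap M a ` X (tail Q a) \<subseteq> X (head Q a)" by (rule is_subrep_arrow[OF X a])
    moreover have "X (tail Q a) \<subseteq> carrier (rspace M (tail Q a))" using sub(2) a by simp
    ultimately show ?thesis
      using is_repD(4,5)[OF M a] unfolding LinearCombinations.module_hom_def
      by (auto simp: subset_eq)
  qed
  ultimately show ?thesis using vs unfolding is_rep_def sub_rep_def by simp
qed

lemma complementary_trans:
  fixes M :: "('i, 'a, 'k::{field, finite}, 'v) quiver_rep"
  assumes Q: "fin_digraph Q" and M: "is_rep Q M" and XY: "complementary Q M X Y"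
    and ZZ: "complementary Q (sub_rep M X) Z Z'"
  shows "complementary Q M Z (\<lambda>i\<in>verts Q. Z' i <+>\<^bsub>rspace M i\<^esub> Y i)" (is "complementary Q M Z ?W")
proof -
  interpret fin_digraph Q by fact
  have X: "is_subrep Q M X" and Y: "is_subrep Q M Y" using XY by (auto dest: complementaryD)
  have Z: "is_subrep Q (sub_rep M X) Z" and Z': "is_subrep Q (sub_rep M X) Z'" using ZZ by (auto dest: complementaryD)
  have *: "VectorSpace.subspace class_ring (Z i) (rspace M i)"
    "VectorSpace.subspace class_ring (Z' i <+>\<^bsub>rspace M i\<^esub> Y i) (rspace M i)"
    "Z i \<inter> (Z' i <+>\<^bsub>rspace M i\<^esub> Y i) = {\<zero>\<^bsub>rspace M i\<^esub>}"
    "Z i <+>\<^bsub>rspace M i\<^esub> (Z' i <+>\<^bsub>rspace M i\<^esub> Y i) = carrier (rspace M i)" if i: "i \<in> verts Q" for i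
  proof -
    have "VectorSpace.subspace class_ring (X i) (rspace M i)" "VectorSpace.subspace class_ring (Y i) (rspace M i)"
      "X i \<inter> Y i = {\<zero>\<^bsub>rspace M i\<^esub>}" "X i <+>\<^bsub>rspace M i\<^esub> Y i = carrier (rspace M i)"
      using complementaryD[OF XY] is_subrep_subspace[OF _ i] i by blast+
    moreover have "VectorSpace.subspace class_ring (Z i) ((rspace M i)\<lparr>carrier := X i\<rparr>)"
      "VectorSpace.subspace class_ring (Z' i) ((rspace M i)\<lparr>carrier := X i\<rparr>)"
      "Z i \<inter> Z' i = {\<zero>\<^bsub>rspace M i\<^esub>}" "Z i <+>\<^bsub>rspace M i\<^esub> Z' i = X i"
      using ZZ i unfolding complementary_def is_subrep_def by (simp_all add: sub_rep_def)
    ultimately show "VectorSpace.subspace class_ring (Z i) (rspace M i)"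
    "VectorSpace.subspace class_ring (Z' i <+>\<^bsub>rspace M i\<^esub> Y i) (rspace M i)"
    "Z i \<inter> (Z' i <+>\<^bsub>rspace M i\<^esub> Y i) = {\<zero>\<^bsub>rspace M i\<^esub>}"
    "Z i <+>\<^bsub>rspace M i\<^esub> (Z' i <+>\<^bsub>rspace M i\<^esub> Y i) = carrier (rspace M i)"
      using direct_sum_trans[OF is_repD(1)[OF M i], of "X i" "Y i" "Z i" "Z' i"] by simp_all
  qed
  have "is_subrep Q M Z"
    using Z *(1) unfolding is_subrep_def by (simp add: sub_rep_def)
  moreover have "is_subrep Q M ?W"
    unfolding is_subrep_def
  proof (intro conjI ballI)
    show "?W \<in> extensional (verts Q)" by simp
    show "VectorSpace.subspace class_ring (?W i) (rspace M i)" if "i \<in> verts Q" for i using *(2)[OF that] that by simp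
    fix a assume a: "a \<in> arcs Q"
    then have t: "tail Q a \<in> verts Q" "head Q a \<in> verts Q" by auto
    have in_car: "Z' i \<subseteq> carrier (rspace M i)" "Y i \<subseteq> carrier (rspace M i)" if i: "i \<in> verts Q" for i
    proof -
      have X'i: "X i \<subseteq> carrier (rspace M i)" and Yi: "Y i \<subseteq> carrier (rspace M i)"
        using is_subrep_subset[OF X i] is_subrep_subset[OF Y i] by blast+
      have "Z' i \<subseteq> carrier (rspace (sub_rep M X) i)"
        by (rule is_subrep_subset[OF Z' i])
      then show "Z' i \<subseteq> carrier (rspace M i)" "Y i \<subseteq> carrier (rspace M i)" using X'i Yi by (auto simp: sub_rep_def)
    qed
    have Z'a: "rmap M a ` Z' (tail Q a) \<subseteq> Z' (head Q a)" using is_subrep_arrow[OF Z' a] by (simp add: sub_rep_def)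
    have Ya: "rmap M a ` Y (tail Q a) \<subseteq> Y (head Q a)" by (rule is_subrep_arrow[OF Y a])
    show "rmap M a ` ?W (tail Q a) \<subseteq> ?W (head Q a)"
    proof (rule image_subsetI)
      fix v assume "v \<in> ?W (tail Q a)"
      then obtain z y where zy: "z \<in> Z' (tail Q a)" "y \<in> Y (tail Q a)" "v = z \<oplus>\<^bsub>rspace M (tail Q a)\<^esub> y"
        using t by (auto simp: set_add_iff)
      then have "rmap M a v = rmap M a z \<oplus>\<^bsub>rspace M (head Q a)\<^esub> rmap M a y"
        using is_repD(4)[OF M a, of z y] in_car[OF t(1)] by auto
      moreover have "rmap M a z \<in> Z' (head Q a)" "rmap M a y \<in> Y (head Q a)" using zy Z'a Ya by blast+
      ultimately show "rmap M a v \<in> ?W (head Q a)" using t by (simp add: set_add_iff) blast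
    qed
  qed
  ultimately show ?thesis using *(3,4) unfolding complementary_def by simp
qed

lemma card_carrier_dimv:
  fixes M :: "('i, 'a, 'k::{field, finite}, 'v) quiver_rep"
  assumes "is_rep Q M" "i \<in> verts Q"
  shows "card (carrier (rspace M i)) = card (UNIV :: 'k set) ^ nat (dimv M i)"
  using coordinates_exist(3)[OF is_repD(1,2)[OF assms]] by (simp add: dimv_def)

lemma power_card_field_inject:
  "card (UNIV :: 'k::{field, finite} set) ^ m = card (UNIV :: 'k set) ^ n \<longleftrightarrow> m = n"
  using card_field_gt_1[where 'k = 'k] by simp

lemma dimv_complementary:
  fixes M :: "('i, 'a, 'k::{field, finite}, 'v) quiver_rep"
  assumes Q: "fin_digraph Q" and M: "is_rep Q M" and XY: "complementary Q M X Y" and i: "i \<in> verts Q"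
  shows "dimv M i = dimv (sub_rep M X) i + dimv (sub_rep M Y) i"
proof -
  have X: "is_subrep Q M X" and Y: "is_subrep Q M Y" using XY by (auto dest: complementaryD)
  have "card (X i <+>\<^bsub>rspace M i\<^esub> Y i) = card (X i) * card (Y i)"
    using XY i by (intro subspace_direct_sum_card[OF is_repD(1)[OF M i]]) (auto simp: complementary_def is_subrep_def)
  then have "card (carrier (rspace M i)) = card (carrier (rspace (sub_rep M X) i)) * card (carrier (rspace (sub_rep M Y) i))"
    using XY i unfolding complementary_def by (simp add: sub_rep_def)
  then have "nat (dimv M i) = nat (dimv (sub_rep M X) i) + nat (dimv (sub_rep M Y) i)"
    unfolding card_carrier_dimv[OF M i] card_carrier_dimv[OF is_rep_sub_rep[OF M X Q] i]
      card_carrier_dimv[OF is_rep_sub_rep[OF M Y Q] i] power_add[symmetric] power_card_field_inject .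
  then show ?thesis by (simp add: dimv_def)
qed

lemma is_subrep_nonzero:
  assumes M: "is_rep Q M" and X: "is_subrep Q M X" and nz: "X \<noteq> zero_sub Q M"
  shows "\<exists>i\<in>verts Q. X i \<noteq> {\<zero>\<^bsub>rspace M i\<^esub>}"
proof (rule ccontr)
  assume "\<not> ?thesis"
  then have "X = zero_sub Q M"
    using X unfolding is_subrep_def zero_sub_def by (intro extensionalityI[of X "verts Q"]) auto
  then show False using nz by blast
qed

text \<open>Properties of the defect that are preserved by addition pass from the indecomposable summands to
  all nonzero direct summands, by splitting these further.  Being negative and being zero are such
  properties, and so is the property that never holds, which shows that an indecomposable summand
  exists.\<close>

lemma defect_of_summand:
  fixes M :: "('i, 'a, 'k::{field, finite}, 'v) quiver_rep"
  assumes Q: "fin_digraph Q" and M: "is_rep Q M"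
    and add: "\<And>m n. R m \<Longrightarrow> R n \<Longrightarrow> R (m + n)"
    and sgn: "\<forall>S\<in>indec_summands Q M. R (euler_form Q \<delta> (dimv S))"
    and XY: "complementary Q M X Y" and nz: "X \<noteq> zero_sub Q M"
  shows "R (euler_form Q \<delta> (dimv (sub_rep M X)))"
  using XY nz
proof (induction "\<Sum>i\<in>verts Q. card (X i)" arbitrary: X Y rule: less_induct)
  case less
  interpret fin_digraph Q by fact
  have X: "is_subrep Q M X" and Y: "is_subrep Q M Y" using less.prems(1) by (auto dest: complementaryD)
  have rX: "is_rep Q (sub_rep M X)" by (rule is_rep_sub_rep[OF M X Q])
  show ?case
  proof (cases "indecomposable Q (sub_rep M X)")
    case True
    then have "sub_rep M X \<in> indec_summands Q M" using less.prems(1) unfolding indec_summands_def by blast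
    then show ?thesis using sgn by blast
  next
    case False
    have "\<not> zero_rep Q (sub_rep M X)"
      using is_subrep_nonzero[OF M X less.prems(2)] unfolding zero_rep_def by (auto simp: sub_rep_def)
    then obtain Z Z' where ZZ: "complementary Q (sub_rep M X) Z Z'" "Z \<noteq> zero_sub Q M" "Z' \<noteq> zero_sub Q M"
      using False rX unfolding indecomposable_def zero_sub_sub_rep by blast
    have ZZ': "complementary Q (sub_rep M X) Z' Z" by (rule complementary_commute[OF rX ZZ(1)])
    have smaller: "(\<Sum>i\<in>verts Q. card (A i)) < (\<Sum>i\<in>verts Q. card (X i))"
      if AB: "complementary Q (sub_rep M X) A B" and B: "B \<noteq> zero_sub Q M" for A B
    proof (rule sum_strict_mono_ex1)
      have sA: "is_subrep Q (sub_rep M X) A" and sB: "is_subrep Q (sub_rep M X) B" using AB by (auto dest: complementaryD)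
      have fin: "finite (X i)" if "i \<in> verts Q" for i
        using coordinates_exist(2)[OF is_repD(1,2)[OF rX that]] by (simp add: sub_rep_def)
      have AX: "A i \<subseteq> X i" "B i \<subseteq> X i" if "i \<in> verts Q" for i
        using is_subrep_subset[OF sA that] is_subrep_subset[OF sB that] by (simp_all add: sub_rep_def)
      show "\<forall>i\<in>verts Q. card (A i) \<le> card (X i)" 
        by (intro ballI card_mono fin AX)
      obtain i where i: "i \<in> verts Q" "B i \<noteq> {\<zero>\<^bsub>rspace M i\<^esub>}"
        using is_subrep_nonzero[OF rX sB] B unfolding zero_sub_sub_rep by (auto simp: sub_rep_def)
      have "A i \<inter> B i = {\<zero>\<^bsub>rspace M i\<^esub>}" using AB i(1) unfolding complementary_def by (simp add: sub_rep_def)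
      then have "A i \<noteq> X i" using i AX(2)[OF i(1)] by blast
      then have "card (A i) < card (X i)" using AX(1)[OF i(1)] fin[OF i(1)] by (simp add: psubset_card_mono psubsetI)
      then show "\<exists>i\<in>verts Q. card (A i) < card (X i)" using i(1) by blast
    qed simp
    have 1: "R (euler_form Q \<delta> (dimv (sub_rep M Z)))"
      by (rule less.hyps[OF smaller[OF ZZ(1,3)] complementary_trans[OF Q M less.prems(1) ZZ(1)] ZZ(2)])
    have 2: "R (euler_form Q \<delta> (dimv (sub_rep M Z')))"
      by (rule less.hyps[OF smaller[OF ZZ' ZZ(2)] complementary_trans[OF Q M less.prems(1) ZZ'] ZZ(3)])
    have "euler_form Q \<delta> (dimv (sub_rep M X)) = euler_form Q \<delta> (\<lambda>i. dimv (sub_rep M Z) i + dimv (sub_rep M Z') i)"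
      using dimv_complementary[OF Q rX ZZ(1)] by (intro euler_form_cong wf_digraph_axioms) (simp_all add: sub_rep_sub_rep)
    then show ?thesis using add[OF 1 2] by (simp add: euler_form_add_right)
  qed
qed

lemma complementary_full:
  fixes M :: "('i, 'a, 'k::{field, finite}, 'v) quiver_rep"
  assumes Q: "fin_digraph Q" and M: "is_rep Q M"
  shows "complementary Q M (full_sub Q M) (zero_sub Q M)"
proof -
  interpret fin_digraph Q by fact
  have full: "VectorSpace.subspace class_ring (carrier (rspace M i)) (rspace M i)"
    "VectorSpace.subspace class_ring {\<zero>\<^bsub>rspace M i\<^esub>} (rspace M i)"
    "carrier (rspace M i) \<inter> {\<zero>\<^bsub>rspace M i\<^esub>} = {\<zero>\<^bsub>rspace M i\<^esub>}"
    "carrier (rspace M i) <+>\<^bsub>rspace M i\<^esub> {\<zero>\<^bsub>rspace M i\<^esub>} = carrier (rspace M i)" if i: "i \<in> verts Q" for i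
  proof -
    interpret V: vectorspace class_ring "rspace M i" by (rule is_repD(1)[OF M i])
    show "VectorSpace.subspace class_ring (carrier (rspace M i)) (rspace M i)"
      "VectorSpace.subspace class_ring {\<zero>\<^bsub>rspace M i\<^esub>} (rspace M i)"
      "carrier (rspace M i) \<inter> {\<zero>\<^bsub>rspace M i\<^esub>} = {\<zero>\<^bsub>rspace M i\<^esub>}"
      unfolding subspace_class_ring_iff[OF is_repD(1)[OF M i]] by auto
    show "carrier (rspace M i) <+>\<^bsub>rspace M i\<^esub> {\<zero>\<^bsub>rspace M i\<^esub>} = carrier (rspace M i)"
      by (auto simp: set_add_iff)
  qed
  have "rmap M a \<zero>\<^bsub>rspace M (tail Q a)\<^esub> = \<zero>\<^bsub>rspace M (head Q a)\<^esub>" if a: "a \<in> arcs Q" for a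
  proof -
    have t: "tail Q a \<in> verts Q" "head Q a \<in> verts Q" using a by auto
    interpret T: vectorspace class_ring "rspace M (tail Q a)" by (rule is_repD(1)[OF M t(1)])
    interpret H: vectorspace class_ring "rspace M (head Q a)" by (rule is_repD(1)[OF M t(2)])
    have "rmap M a (0 \<odot>\<^bsub>rspace M (tail Q a)\<^esub> \<zero>\<^bsub>rspace M (tail Q a)\<^esub>) =
      0 \<odot>\<^bsub>rspace M (head Q a)\<^esub> rmap M a \<zero>\<^bsub>rspace M (tail Q a)\<^esub>"
      by (rule is_repD(5)[OF M a]) simp
    then show ?thesis
      using T.smult_l_null[of "\<zero>\<^bsub>rspace M (tail Q a)\<^esub>"] H.smult_l_null is_repD(3)[OF M a T.M.zero_closed] by simp
  qed
  then show ?thesis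
    using full is_repD(3)[OF M] unfolding complementary_def is_subrep_def full_sub_def zero_sub_def
    by auto
qed

lemma dimv_full_sub:
  fixes M :: "('i, 'a, 'k::field, 'v) quiver_rep"
  assumes "i \<in> verts Q"
  shows "dimv (sub_rep M (full_sub Q M)) i = dimv M i"
proof -
  have "(rspace M i)\<lparr>carrier := carrier (rspace M i)\<rparr> = rspace M i" by simp
  then show ?thesis using assms by (simp add: dimv_def sub_rep_def full_sub_def)
qed

lemma defect_from_summands:
  fixes M :: "('i, 'a, 'k::{field, finite}, 'v) quiver_rep"
  assumes Q: "fin_digraph Q" and M: "is_rep Q M"
    and add: "\<And>m n. R m \<Longrightarrow> R n \<Longrightarrow> R (m + n)"
    and sgn: "\<forall>S\<in>indec_summands Q M. R (euler_form Q \<delta> (dimv S))"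
    and nz: "\<not> zero_rep Q M"
  shows "R (euler_form Q \<delta> (dimv M))"
proof -
  interpret fin_digraph Q by fact
  have "full_sub Q M \<noteq> zero_sub Q M"
  proof
    assume eq: "full_sub Q M = zero_sub Q M"
    have "carrier (rspace M i) = {\<zero>\<^bsub>rspace M i\<^esub>}" if "i \<in> verts Q" for i
      using fun_cong[OF eq, of i] that by (simp add: full_sub_def zero_sub_def)
    then show False using nz unfolding zero_rep_def by blast
  qed
  from defect_of_summand[OF Q M add sgn complementary_full[OF Q M] this]
  show ?thesis
    using euler_form_cong[OF wf_digraph_axioms, of \<delta> \<delta> "dimv (sub_rep M (full_sub Q M))" "dimv M"]
    by (simp add: dimv_full_sub)
qed

section \<open>Hall numbers of sums of indecomposables of defect zero\<close>

lemma subspace_add: "VectorSpace.subspace K W V \<Longrightarrow> v \<in> W \<Longrightarrow> w \<in> W \<Longrightarrow> v \<oplus>\<^bsub>V\<^esub> w \<in> W"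
  unfolding VectorSpace.subspace_def by (blast intro: submodule.m_closed)

lemma dimv_nonneg: "dimv M i \<ge> 0"
  by (simp add: dimv_def)

lemma indecomposable_is_rep: "indecomposable Q M \<Longrightarrow> is_rep Q M"
  unfolding indecomposable_def by blast

text \<open>An indecomposable summand of \<open>I\<close> of positive defect would have a nonzero morphism to one of the
  summands \<open>Ys ! j\<close>, through the given embedding of \<open>I\<close>.\<close>

lemma no_preinjective_sub_of_zero_defect:
  fixes I :: "('i, 'a, 'k::{field, finite}, 'v) quiver_rep" and Ys :: "('i, 'a, 'k, 'v) quiver_rep list"
  assumes Q: "acyclic_quiver Q" and \<delta>: "is_delta Q \<delta>" and I: "preinjective Q \<delta> I"
    and Ys: "\<And>Y. Y \<in> set Ys \<Longrightarrow> indecomposable Q Y" "\<And>Y. Y \<in> set Ys \<Longrightarrow> euler_form Q \<delta> (dimv Y) = 0"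
    and X: "is_subrep Q (dsum_rep Ys) X" and iso: "rep_iso Q (sub_rep (dsum_rep Ys) X) I"
  shows "zero_rep Q I"
proof (rule ccontr)
  assume nz: "\<not> zero_rep Q I"
  interpret fin_digraph Q using Q unfolding acyclic_quiver_def by blast
  let ?R = "dsum_rep Ys"
  have rI: "is_rep Q I" using I unfolding preinjective_def by blast
  have "indec_summands Q I \<noteq> {}"
    using defect_from_summands[OF fin_digraph_axioms rI, of "\<lambda>_. False"] nz by blast
  then obtain X0 where S: "indecomposable Q (sub_rep I X0)" "sub_rep I X0 \<in> indec_summands Q I"
    and X0: "is_subrep Q I X0" unfolding indec_summands_def using complementaryD(1) by blast
  have Spos: "euler_form Q \<delta> (dimv (sub_rep I X0)) > 0" using I S(2) unfolding preinjective_def by blast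
  obtain \<phi> where \<phi>: "\<phi> \<in> rep_isos Q (sub_rep ?R X) I" using iso unfolding rep_iso_def by blast
  have bij: "bij_betw (\<phi> i) (X i) (carrier (rspace I i))" if "i \<in> verts Q" for i
    using \<phi> that unfolding rep_isos_def by (auto simp: sub_rep_def)
  have hom: "\<phi> i \<in> LinearCombinations.module_hom class_ring (rspace (sub_rep ?R X) i) (rspace I i)" if "i \<in> verts Q" for i
    using \<phi> that unfolding rep_isos_def rep_hom_def by (auto simp: PiE_iff)
  have padd: "\<phi> i (v \<oplus>\<^bsub>rspace ?R i\<^esub> w) = \<phi> i v \<oplus>\<^bsub>rspace I i\<^esub> \<phi> i w" if "i \<in> verts Q" "v \<in> X i" "w \<in> X i" for i v w
    using hom[OF that(1)] that(2,3) unfolding LinearCombinations.module_hom_def by (simp add: sub_rep_def)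
  have pcomm: "\<phi> (head Q a) (rmap ?R a v) = rmap I a (\<phi> (tail Q a) v)" if "a \<in> arcs Q" "v \<in> X (tail Q a)" for a v
    using \<phi> that unfolding rep_isos_def rep_hom_def by (simp add: sub_rep_def)
  \<comment> \<open>\<open>\<theta>\<close> is the inverse isomorphism, seen as an embedding of \<open>I\<close> into the direct sum.\<close>
  define \<theta> where "\<theta> i = inv_into (X i) (\<phi> i)" for i
  have \<theta>: "\<theta> i v \<in> X i" "\<phi> i (\<theta> i v) = v" if "i \<in> verts Q" "v \<in> carrier (rspace I i)" for i v
    using bij_betw_imp_surj_on[OF bij[OF that(1)]] that(2) inv_into_into[of v "\<phi> i" "X i"]
      f_inv_into_f[of v "\<phi> i" "X i"]
    unfolding \<theta>_def by simp_all
  have \<theta>_eq: "\<theta> i v = x" if "i \<in> verts Q" "x \<in> X i" "\<phi> i x = v" for i v x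
    unfolding \<theta>_def using bij_betw_imp_inj_on[OF bij[OF that(1)]] that(2,3) by (auto intro: inv_into_f_eq)
  have Xin: "X i \<subseteq> carrier (rspace ?R i)" if "i \<in> verts Q" for i by (rule is_subrep_subset[OF X that])
  have X0in: "X0 i \<subseteq> carrier (rspace I i)" if "i \<in> verts Q" for i by (rule is_subrep_subset[OF X0 that])
  have carR: "carrier (rspace ?R i) = (\<Pi>\<^sub>E j\<in>{..<length Ys}. carrier (rspace (Ys ! j) i))" for i
    by (simp add: dsum_rep_def dsum_space_def) (rule PiE_cong, simp)
  have addR: "(v \<oplus>\<^bsub>rspace ?R i\<^esub> w) j = v j \<oplus>\<^bsub>rspace (Ys ! j) i\<^esub> w j" if "j < length Ys" for v w j i
    using that by (simp add: dsum_rep_def dsum_space_def)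
  have mapR: "rmap ?R a v j = rmap (Ys ! j) a (v j)" if "j < length Ys" for a v j
    using that by (simp add: dsum_rep_def)
  have comp0: "\<theta> i v j = \<zero>\<^bsub>rspace (Ys ! j) i\<^esub>" if j: "j < length Ys" and i: "i \<in> verts Q" and v: "v \<in> X0 i" for i v j
  proof -
    let ?g = "\<lambda>i v. \<theta> i v j"
    have Y: "indecomposable Q (Ys ! j)" "euler_form Q \<delta> (dimv (Ys ! j)) = 0" using Ys j by simp_all
    have "?g i v = \<zero>\<^bsub>rspace (Ys ! j) i\<^esub>"
    proof (rule hom_positive_to_zero_defect[OF Q \<delta> S(1) Spos Y, where g = ?g])
      fix i v assume iv: "i \<in> verts Q" "v \<in> carrier (rspace (sub_rep I X0) i)"
      then have vI: "v \<in> carrier (rspace I i)" using X0in[OF iv(1)] by (auto simp: sub_rep_def)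
      show "?g i v \<in> carrier (rspace (Ys ! j) i)"
        using \<theta>(1)[OF iv(1) vI] Xin[OF iv(1)] j unfolding carR by blast
      fix w assume w: "w \<in> carrier (rspace (sub_rep I X0) i)"
      then have wI: "w \<in> carrier (rspace I i)" using X0in[OF iv(1)] by (auto simp: sub_rep_def)
      have "\<theta> i (v \<oplus>\<^bsub>rspace I i\<^esub> w) = \<theta> i v \<oplus>\<^bsub>rspace ?R i\<^esub> \<theta> i w"
      proof (rule \<theta>_eq[OF iv(1)])
        show "\<theta> i v \<oplus>\<^bsub>rspace ?R i\<^esub> \<theta> i w \<in> X i"
          by (rule subspace_add[OF is_subrep_subspace[OF X iv(1)] \<theta>(1)[OF iv(1) vI] \<theta>(1)[OF iv(1) wI]])
        show "\<phi> i (\<theta> i v \<oplus>\<^bsub>rspace ?R i\<^esub> \<theta> i w) = v \<oplus>\<^bsub>rspace I i\<^esub> w"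
          using padd[OF iv(1) \<theta>(1)[OF iv(1) vI] \<theta>(1)[OF iv(1) wI]] \<theta>(2)[OF iv(1) vI] \<theta>(2)[OF iv(1) wI] by simp
      qed
      then show "?g i (v \<oplus>\<^bsub>rspace (sub_rep I X0) i\<^esub> w) = ?g i v \<oplus>\<^bsub>rspace (Ys ! j) i\<^esub> ?g i w"
        using addR[OF j] by (simp add: sub_rep_def)
    next
      fix a v assume a: "a \<in> arcs Q" and v: "v \<in> carrier (rspace (sub_rep I X0) (tail Q a))"
      have t: "tail Q a \<in> verts Q" "head Q a \<in> verts Q" using a by auto
      have vI: "v \<in> carrier (rspace I (tail Q a))" using X0in[OF t(1)] v by (auto simp: sub_rep_def)
      have "\<theta> (head Q a) (rmap I a v) = rmap ?R a (\<theta> (tail Q a) v)"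
      proof (rule \<theta>_eq[OF t(2)])
        show "rmap ?R a (\<theta> (tail Q a) v) \<in> X (head Q a)"
          using is_subrep_arrow[OF X a] \<theta>(1)[OF t(1) vI] by blast
        show "\<phi> (head Q a) (rmap ?R a (\<theta> (tail Q a) v)) = rmap I a v"
          using pcomm[OF a \<theta>(1)[OF t(1) vI]] \<theta>(2)[OF t(1) vI] by simp
      qed
      then show "?g (head Q a) (rmap (sub_rep I X0) a v) = rmap (Ys ! j) a (?g (tail Q a) v)"
        using mapR[OF j] by (simp add: sub_rep_def)
    qed (use i v in \<open>simp_all add: sub_rep_def\<close>)
    then show ?thesis .
  qed
  have "zero_rep Q (sub_rep I X0)"
    unfolding zero_rep_def
  proof
    fix i assume i: "i \<in> verts Q"
    interpret Ii: vectorspace class_ring "rspace I i" by (rule is_repD(1)[OF rI i])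
    let ?z = "\<zero>\<^bsub>rspace ?R i\<^esub>"
    have zX: "?z \<in> X i" using is_subrep_subspace[OF X i] unfolding VectorSpace.subspace_def submodule_def by blast
    have "vectorspace class_ring (rspace ?R i)" using is_subrep_subspace[OF X i] unfolding VectorSpace.subspace_def by blast
    then interpret Ri: vectorspace class_ring "rspace ?R i" .
    have pz: "\<phi> i ?z \<in> carrier (rspace I i)" using bij_betwE[OF bij[OF i]] zX by blast
    have "\<phi> i ?z \<oplus>\<^bsub>rspace I i\<^esub> \<phi> i ?z = \<phi> i ?z"
      using padd[OF i zX zX] Ri.M.l_zero[OF Ri.M.zero_closed] by simp
    then have p0: "\<phi> i ?z = \<zero>\<^bsub>rspace I i\<^esub>" using pz by simp
    have z0: "v = \<zero>\<^bsub>rspace I i\<^esub>" if v: "v \<in> X0 i" for v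
    proof -
      have vI: "v \<in> carrier (rspace I i)" using X0in[OF i] v by blast
      have "\<theta> i v = ?z"
      proof (rule PiE_ext)
        show "\<theta> i v \<in> (\<Pi>\<^sub>E j\<in>{..<length Ys}. carrier (rspace (Ys ! j) i))"
          "?z \<in> (\<Pi>\<^sub>E j\<in>{..<length Ys}. carrier (rspace (Ys ! j) i))"
          using subsetD[OF Xin[OF i] \<theta>(1)[OF i vI]] subsetD[OF Xin[OF i] zX] unfolding carR .
        fix j assume "j \<in> {..<length Ys}"
        then show "\<theta> i v j = ?z j" using comp0[OF _ i v] by (simp add: dsum_rep_def dsum_space_def)
      qed
      then show ?thesis using \<theta>(2)[OF i vI] p0 by simp
    qed
    have "\<zero>\<^bsub>rspace I i\<^esub> \<in> X0 i" using is_subrep_subspace[OF X0 i] unfolding VectorSpace.subspace_def submodule_def by blast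
    moreover have "X0 i \<subseteq> {\<zero>\<^bsub>rspace I i\<^esub>}" by (rule subsetI, drule z0, simp)
    ultimately have "X0 i = {\<zero>\<^bsub>rspace I i\<^esub>}" by (intro equalityI) simp_all
    then show "carrier (rspace (sub_rep I X0) i) = {\<zero>\<^bsub>rspace (sub_rep I X0) i\<^esub>}"
      by (simp add: sub_rep_def)
  qed
  then show False using S(1) unfolding indecomposable_def by blast
qed

lemma card_quot_space_zero:
  assumes "vectorspace class_ring V"
  shows "card (carrier (quot_space V {\<zero>\<^bsub>V\<^esub>})) = card (carrier V)"
proof -
  interpret V: vectorspace class_ring V by fact
  have "carrier (quot_space V {\<zero>\<^bsub>V\<^esub>}) = (\<lambda>v. {v}) ` carrier V"
    by (auto simp: quot_space_def A_RCOSETS_def RCOSETS_def r_coset_def image_iff)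
  then show ?thesis by (simp add: card_image inj_on_def)
qed

lemma hall_sub_zero_defect:
  fixes P I :: "('i, 'a, 'k::{field, finite}, 'v) quiver_rep" and Ys :: "('i, 'a, 'k, 'v) quiver_rep list"
  assumes Q: "acyclic_quiver Q" and \<delta>: "is_delta Q \<delta>"
    and P: "preprojective Q \<delta> P" and I: "preinjective Q \<delta> I"
    and Ys: "\<And>Y. Y \<in> set Ys \<Longrightarrow> indecomposable Q Y" "\<And>Y. Y \<in> set Ys \<Longrightarrow> euler_form Q \<delta> (dimv Y) = 0"
    and ne: "Ys \<noteq> []"
  shows "hall_sub Q (dsum_rep Ys) P I = 0"
proof -
  interpret fin_digraph Q using Q unfolding acyclic_quiver_def by blast
  let ?R = "dsum_rep Ys"
  have rP: "is_rep Q P" using P unfolding preprojective_def by blast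
  have False if X: "is_subrep Q ?R X" and iI: "rep_iso Q (sub_rep ?R X) I" and iP: "rep_iso Q (quot_rep Q ?R X) P" for X
  proof -
    have zI: "zero_rep Q I" by (rule no_preinjective_sub_of_zero_defect[OF Q \<delta> I Ys X iI])
    have dimP: "dimv P i = (\<Sum>j<length Ys. dimv (Ys ! j) i)" if i: "i \<in> verts Q" for i
    proof -
      have V: "vectorspace class_ring (rspace ?R i)" using is_subrep_subspace[OF X i] unfolding VectorSpace.subspace_def by blast
      obtain \<phi> where "\<phi> \<in> rep_isos Q (sub_rep ?R X) I" using iI unfolding rep_iso_def by blast
      then have "bij_betw (\<phi> i) (X i) (carrier (rspace I i))" using i unfolding rep_isos_def by (simp add: sub_rep_def)
      then have "card (X i) = 1" using bij_betw_same_card zI i unfolding zero_rep_def by fastforce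
      moreover have "\<zero>\<^bsub>rspace ?R i\<^esub> \<in> X i"
        using is_subrep_subspace[OF X i] unfolding VectorSpace.subspace_def submodule_def by blast
      ultimately have Xi: "X i = {\<zero>\<^bsub>rspace ?R i\<^esub>}" by (auto simp: card_1_singleton_iff)
      obtain \<psi> where "\<psi> \<in> rep_isos Q (quot_rep Q ?R X) P" using iP unfolding rep_iso_def by blast
      then have "bij_betw (\<psi> i) (carrier (quot_space (rspace ?R i) (X i))) (carrier (rspace P i))"
        using i unfolding rep_isos_def by (simp add: quot_rep_def)
      then have "card (carrier (rspace P i)) = card (carrier (rspace ?R i))"
        using bij_betw_same_card card_quot_space_zero[OF V] unfolding Xi by metis
      also have "\<dots> = (\<Prod>j<length Ys. card (carrier (rspace (Ys ! j) i)))"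
        by (simp add: dsum_rep_def dsum_space_def card_PiE)
      also have "\<dots> = (\<Prod>j<length Ys. card (UNIV :: 'k set) ^ nat (dimv (Ys ! j) i))"
        by (intro prod.cong refl card_carrier_dimv[OF indecomposable_is_rep[OF Ys(1)] i]) simp
      also have "\<dots> = card (UNIV :: 'k set) ^ (\<Sum>j<length Ys. nat (dimv (Ys ! j) i))"
        by (rule power_sum[symmetric])
      finally have "nat (dimv P i) = (\<Sum>j<length Ys. nat (dimv (Ys ! j) i))"
        unfolding card_carrier_dimv[OF rP i] power_card_field_inject .
      then have "int (nat (dimv P i)) = (\<Sum>j<length Ys. int (nat (dimv (Ys ! j) i)))" by simp
      then show ?thesis by (simp add: dimv_nonneg)
    qed
    have "euler_form Q \<delta> (dimv P) = euler_form Q \<delta> (\<lambda>i. \<Sum>j<length Ys. dimv (Ys ! j) i)"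
      by (intro euler_form_cong wf_digraph_axioms dimP refl)
    also have "\<dots> = 0" by (simp add: euler_form_sum_right Ys(2))
    finally have d0: "euler_form Q \<delta> (dimv P) = 0" .
    have "zero_rep Q P"
      using defect_from_summands[OF fin_digraph_axioms rP, of "\<lambda>n. n < 0" \<delta>] P d0
      unfolding preprojective_def by fastforce
    have "zero_rep Q (Ys ! 0)"
      unfolding zero_rep_def
    proof
      fix i assume i: "i \<in> verts Q"
      have rY: "is_rep Q (Ys ! 0)" using Ys(1) ne by (simp add: indecomposable_is_rep)
      interpret Yi: vectorspace class_ring "rspace (Ys ! 0) i" by (rule is_repD(1)[OF rY i])
      have "card (carrier (rspace P i)) = 1" using \<open>zero_rep Q P\<close> i unfolding zero_rep_def by simp
      then have "dimv P i = 0"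
        unfolding card_carrier_dimv[OF rP i] using card_field_gt_1[where 'k = 'k] dimv_nonneg[of P i] by simp
      then have "dimv (Ys ! 0) i = 0"
        using ne unfolding dimP[OF i] by (subst (asm) sum_nonneg_eq_0_iff) (auto simp: dimv_nonneg)
      then have "card (carrier (rspace (Ys ! 0) i)) = 1" using card_carrier_dimv[OF rY i] by simp
      then show "carrier (rspace (Ys ! 0) i) = {\<zero>\<^bsub>rspace (Ys ! 0) i\<^esub>}"
        using Yi.M.zero_closed by (metis card_1_singletonE singletonD)
    qed
    moreover have "indecomposable Q (Ys ! 0)" using Ys(1) ne by simp
    ultimately show False unfolding indecomposable_def by blast
  qed
  then have "{X. is_subrep Q ?R X \<and> rep_iso Q (sub_rep ?R X) I \<and> rep_iso Q (quot_rep Q ?R X) P} = {}" by blast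
  then show ?thesis unfolding hall_sub_def by (simp only: card.empty)
qed

lemma tube_member_regular:
  assumes "T \<in> tubes Q \<delta>" "M \<in> T"
  shows "M \<in> regular_indecs Q \<delta>"
proof -
  obtain N where N: "N \<in> regular_indecs Q \<delta>" "T = (linked Q \<delta>)\<^sup>* `` {N}"
    using assms(1) unfolding tubes_def by (rule quotientE)
  have "(N, M) \<in> (linked Q \<delta>)\<^sup>*" using assms(2) N(2) by blast
  then show ?thesis by (cases rule: rtranclE) (use N(1) in \<open>auto simp: linked_def\<close>)
qed

lemma regular_indec_defect:
  fixes M :: "('i, 'a, 'k::{field, finite}, 'v) quiver_rep"
  assumes Q: "fin_digraph Q" and M: "M \<in> regular_indecs Q \<delta>"
  shows "euler_form Q \<delta> (dimv M) = 0"
  using defect_from_summands[OF Q, of M "\<lambda>n. n = 0" \<delta>] M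
  unfolding regular_indecs_def regular_def indecomposable_def by simp

theorem corollary7p6:
  fixes Q :: "('i, 'a) pre_digraph"
    and \<delta> :: "'i \<Rightarrow> int"
    and tube :: "'k::{field, finite} p1_point \<Rightarrow> ('i, 'a, 'k, 'v::infinite) quiver_rep set"
    and Ind :: "'k p1_point \<Rightarrow> nat \<Rightarrow> ('i, 'a, 'k, 'v) quiver_rep"
    and P I :: "('i, 'a, 'k, 'v) quiver_rep"
    and lam :: "nat list"
    and x y :: "'k p1_point"
  assumes "affine_quiver Q" and "acyclic_quiver Q"
    and "is_delta Q \<delta>"
    and "tube_parametrization Q \<delta> tube"
    and "homogeneous_indecs Q \<delta> tube Ind"
    and "preprojective Q \<delta> P"
    and "preinjective Q \<delta> I"
    and "is_partition lam"
    and "x \<in> closed_points - exceptional_points Q \<delta> tube"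
    and "y \<in> closed_points - exceptional_points Q \<delta> tube"
  shows "hall_F Q (I_lam Ind lam x) P I = hall_F Q (I_lam Ind lam y) P I"
proof (cases "lam = []")
  case True
  then show ?thesis by (simp add: I_lam_def)
next
  case False
  have Q: "fin_digraph Q" using assms(2) unfolding acyclic_quiver_def by blast
  have "hall_sub Q (I_lam Ind lam z) P I = 0" if z: "z \<in> closed_points - exceptional_points Q \<delta> tube" for z
  proof -
    have "Y \<in> regular_indecs Q \<delta>" if Y: "Y \<in> set (map (Ind z) lam)" for Y
    proof -
      obtain m where m: "m \<in> set lam" "Y = Ind z m" using Y by auto
      have "m \<noteq> 0" using m(1) assms(8) unfolding is_partition_def by metis
      then have "m \<ge> 1" by simp
      then have "Y \<in> tube z" using assms(5) z m(2) unfolding homogeneous_indecs_def by blast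
      moreover have "tube z \<in> tubes Q \<delta>"
        using assms(4) z bij_betwE unfolding tube_parametrization_def by blast
      ultimately show ?thesis by (rule tube_member_regular[rotated])
    qed
    then have "indecomposable Q Y" "euler_form Q \<delta> (dimv Y) = 0" if "Y \<in> set (map (Ind z) lam)" for Y
      using that regular_indec_defect[OF Q] unfolding regular_indecs_def by blast+
    then show ?thesis
      unfolding I_lam_def using False by (intro hall_sub_zero_defect[OF assms(2,3,6,7)]) auto
  qed
  then show ?thesis using assms(9,10) by (simp add: hall_F_def)
qed

end
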